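(* Let $V/\mathbb{Z}_3$ be the quotient of the $4$-dimensional real symplectic vector space $V=\mathbb{R}^2\times\mathbb{R}^2$ by the diagonal rotation action of the cyclic group $\mathbb{Z}_3$, with its induced Poisson structure. There exist a Poisson structure on $\mathbb{R}^{78}$ and an embedding $V/\mathbb{Z}_3\hookrightarrow\mathbb{R}^{78}$ that realizes $V/\mathbb{Z}_3$ as a Poisson subspace of $\mathbb{R}^{78}$ (i.e. the embedding is a Poisson embedding).
   Context: A Poisson bracket on a commutative algebra is a Lie bracket that is a derivation in each argument (Leibniz identity). $V=\mathbb{R}^2\times\mathbb{R}^2$ has linear coordinates $(x_1,y_1,x_2,y_2)$ and the standard Poisson bracket $\{x_i,y_j\}=\delta_{ij}$, $\{x_i,x_j\}=\{y_i,y_j\}=0$. A generator of $\mathbb{Z}_3$ acts on each factor $\mathbb{R}^2$ (with coordinates $(x_i,y_i)$) by the same matrix $\begin{pmatrix}\cos(2\pi/3)&\sin(2\pi/3)\\-\sin(2\pi/3)&\cos(2\pi/3)\end{pmatrix}$; this action is linear and preserves the bracket. The smooth functions on $V/\mathbb{Z}_3$ are by definition the invariant functions $C^\infty(V)^{\mathbb{Z}_3}$, which form a Poisson subalgebra of $C^\infty(V)$; this is the induced Poisson structure on $V/\mathbb{Z}_3$. Smooth embedding: an injective map $\phi:V/\mathbb{Z}_3\to M$ into a smooth manifold $M$ such that pullback gives a well-defined surjection $\phi^*:C^\infty(M)\to C^\infty(V)^{\mathbb{Z}_3}$. Poisson embedding: a smooth embedding into a Poisson manifold $(M,\{\cdot,\cdot\}_M)$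 such that $\phi^*$ is in addition a homomorphism of Poisson algebras. *)

theory Defs
  imports "HOL-Analysis.Analysis"
begin

text \<open>In finite dimension, \<open>f\<close> is of class \<open>C\<^sup>k\<^sup>+\<^sup>1\<close> iff it is differentiable and all its
  directional derivatives are of class \<open>C\<^sup>k\<close>.\<close>

primrec is_Ck :: "nat \<Rightarrow> ('a::euclidean_space \<Rightarrow> real) \<Rightarrow> bool" where
  "is_Ck 0 f \<longleftrightarrow> continuous_on UNIV f"
| "is_Ck (Suc k) f \<longleftrightarrow>
     (\<forall>x. f differentiable (at x)) \<and> (\<forall>v. is_Ck k (\<lambda>x. frechet_derivative f (at x) v))"

definition smooth_functions :: "('a::euclidean_space \<Rightarrow> real) set" where
  "smooth_functions = {f. \<forall>k. is_Ck k f}"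

type_synonym 'a bracket = "('a \<Rightarrow> real) \<Rightarrow> ('a \<Rightarrow> real) \<Rightarrow> 'a \<Rightarrow> real"

text \<open>Here \<open>A\<close> is meant to be an algebra of real functions under pointwise operations; the
  values of \<open>br\<close> outside \<open>A\<close> are irrelevant.\<close>

definition lie_bracket_on :: "('a \<Rightarrow> real) set \<Rightarrow> 'a bracket \<Rightarrow> bool" where
  "lie_bracket_on A br \<longleftrightarrow>
     (\<forall>f\<in>A. \<forall>g\<in>A. br f g \<in> A) \<and>
     (\<forall>f\<in>A. \<forall>g\<in>A. \<forall>h\<in>A. \<forall>a b.
        br (\<lambda>x. a * f x + b * g x) h = (\<lambda>x. a * br f h x + b * br g h x) \<and>
        br h (\<lambda>x. a * f x + b * g x) = (\<lambda>x. a * br h f x + b * br h g x)) \<and>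
     (\<forall>f\<in>A. br f f = (\<lambda>x. 0)) \<and>
     (\<forall>f\<in>A. \<forall>g\<in>A. \<forall>h\<in>A.
        (\<lambda>x. br f (br g h) x + br g (br h f) x + br h (br f g) x) = (\<lambda>x. 0))"

definition poisson_bracket_on :: "('a \<Rightarrow> real) set \<Rightarrow> 'a bracket \<Rightarrow> bool" where
  "poisson_bracket_on A br \<longleftrightarrow>
     lie_bracket_on A br \<and>
     (\<forall>f\<in>A. \<forall>g\<in>A. \<forall>h\<in>A.
        br (\<lambda>x. f x * g x) h = (\<lambda>x. f x * br g h x + br f h x * g x) \<and>
        br h (\<lambda>x. f x * g x) = (\<lambda>x. f x * br h g x + br h f x * g x))"

definition poisson_algebra_hom ::
  "('a \<Rightarrow> real) set \<Rightarrow> 'a bracket \<Rightarrow> ('b \<Rightarrow> real) set \<Rightarrow> 'b bracket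
    \<Rightarrow> (('a \<Rightarrow> real) \<Rightarrow> ('b \<Rightarrow> real)) \<Rightarrow> bool" where
  "poisson_algebra_hom A brA B brB \<Phi> \<longleftrightarrow>
     \<Phi> \<in> A \<rightarrow> B \<and>
     (\<forall>f\<in>A. \<forall>g\<in>A. \<forall>a b.
        \<Phi> (\<lambda>x. a * f x + b * g x) = (\<lambda>y. a * \<Phi> f y + b * \<Phi> g y)) \<and>
     (\<forall>f\<in>A. \<forall>g\<in>A. \<Phi> (\<lambda>x. f x * g x) = (\<lambda>y. \<Phi> f y * \<Phi> g y)) \<and>
     \<Phi> (\<lambda>x. 1) = (\<lambda>y. 1) \<and>
     (\<forall>f\<in>A. \<forall>g\<in>A. \<Phi> (brA f g) = brB (\<Phi> f) (\<Phi> g))"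

text \<open>The coordinates of \<open>v :: V\<close> are \<open>x\<^sub>1 = fst v $ 1\<close>, \<open>y\<^sub>1 = fst v $ 2\<close>,
  \<open>x\<^sub>2 = snd v $ 1\<close> and \<open>y\<^sub>2 = snd v $ 2\<close>.\<close>

type_synonym V = "(real ^ 2) \<times> (real ^ 2)"

definition standard_bracket :: "V bracket" where
  "standard_bracket f g = (\<lambda>v.
     (let df = frechet_derivative f (at v); dg = frechet_derivative g (at v) in
       df (axis 1 1, 0) * dg (axis 2 1, 0) - df (axis 2 1, 0) * dg (axis 1 1, 0) +
       df (0, axis 1 1) * dg (0, axis 2 1) - df (0, axis 2 1) * dg (0, axis 1 1)))"

lemma frechet_derivative_coordinates:
  "frechet_derivative (\<lambda>v::V. fst v $ i) (at v) = (\<lambda>v. fst v $ i)"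
  "frechet_derivative (\<lambda>v::V. snd v $ i) (at v) = (\<lambda>v. snd v $ i)"
proof -
  have "bounded_linear (\<lambda>v::V. fst v $ i)" "bounded_linear (\<lambda>v::V. snd v $ i)"
    by (intro bounded_linear_compose[OF bounded_linear_vec_nth]
        bounded_linear_fst bounded_linear_snd)+
  then show "frechet_derivative (\<lambda>v::V. fst v $ i) (at v) = (\<lambda>v. fst v $ i)"
    "frechet_derivative (\<lambda>v::V. snd v $ i) (at v) = (\<lambda>v. snd v $ i)"
    by (auto intro!: frechet_derivative_at[symmetric] bounded_linear_imp_has_derivative)
qed

lemma standard_bracket_coordinates:
  "standard_bracket (\<lambda>v. fst v $ 1) (\<lambda>v. fst v $ 2) = (\<lambda>v. 1)"
  "standard_bracket (\<lambda>v. snd v $ 1) (\<lambda>v. snd v $ 2) = (\<lambda>v. 1)"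
  "standard_bracket (\<lambda>v. fst v $ i) (\<lambda>v. snd v $ j) = (\<lambda>v. 0)"
  by (simp_all add: standard_bracket_def frechet_derivative_coordinates axis_def)

definition rotation_matrix :: "real ^ 2 ^ 2" where
  "rotation_matrix = vector [vector [cos (2 * pi / 3), sin (2 * pi / 3)],
                             vector [- sin (2 * pi / 3), cos (2 * pi / 3)]]"

definition rotation :: "V \<Rightarrow> V" where
  "rotation v = (rotation_matrix *v fst v, rotation_matrix *v snd v)"

definition Z3 :: "(V \<Rightarrow> V) set" where
  "Z3 = {rotation ^^ k | k. k < 3}"

definition orbit_relation :: "(V \<times> V) set" where
  "orbit_relation = {(v, w). \<exists>g\<in>Z3. w = g v}"

definition orbit :: "V \<Rightarrow> V set" where
  "orbit v = orbit_relation `` {v}"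

definition V_mod_Z3 :: "V set set" where
  "V_mod_Z3 = UNIV // orbit_relation"

lemma rotation_order: "rotation ^^ 3 = id"
proof
  fix v :: V
  have eq: "2 * pi / 3 = pi - pi / 3" by simp
  have c: "cos (2 * pi / 3) = - (1 / 2)" and s: "sin (2 * pi / 3) = sqrt 3 / 2"
    unfolding eq cos_pi_minus sin_pi_minus by (simp_all add: cos_60 sin_60)
  have mult: "rotation_matrix *v u =
      vector [sqrt 3 / 2 * u $ 2 - u $ 1 / 2, - sqrt 3 / 2 * u $ 1 - u $ 2 / 2]"
    for u :: "real ^ 2"
    unfolding rotation_matrix_def c s
    by (simp add: vec_eq_iff forall_2 matrix_vector_mult_def sum_2)
  have sq: "sqrt 3 * (sqrt 3 * t) = 3 * t" for t :: real
    by (simp flip: mult.assoc)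
  have "rotation_matrix *v (rotation_matrix *v (rotation_matrix *v u)) = u" for u :: "real ^ 2"
    by (simp add: mult vec_eq_iff forall_2 field_simps sq)
  then show "(rotation ^^ 3) v = id v"
    by (simp add: numeral_3_eq_3 rotation_def)
qed

lemma equiv_orbit_relation: "equiv UNIV orbit_relation"
proof -
  have mod: "rotation ^^ k = rotation ^^ (k mod 3)" for k
  proof -
    have "rotation ^^ k = rotation ^^ (k div 3 * 3 + k mod 3)" by simp
    also have "\<dots> = (rotation ^^ 3) ^^ (k div 3) \<circ> rotation ^^ (k mod 3)"
      by (simp only: funpow_add funpow_mult mult.commute)
    finally show ?thesis by (simp add: rotation_order)
  qed
  have rel: "(v, w) \<in> orbit_relation \<longleftrightarrow> (\<exists>k. w = (rotation ^^ k) v)" for v w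
  proof
    assume "\<exists>k. w = (rotation ^^ k) v"
    then obtain k where "w = (rotation ^^ (k mod 3)) v" using mod by metis
    moreover have "rotation ^^ (k mod 3) \<in> Z3" unfolding Z3_def by force
    ultimately show "(v, w) \<in> orbit_relation" unfolding orbit_relation_def by blast
  qed (auto simp: orbit_relation_def Z3_def)
  show ?thesis
  proof (rule equivI)
    show "refl orbit_relation"
      by (rule refl_onI) (auto simp: rel intro: exI[of _ 0])
    show "sym orbit_relation"
    proof (rule symI)
      fix v w assume "(v, w) \<in> orbit_relation"
      then obtain k where w: "w = (rotation ^^ k) v" by (auto simp: rel)
      have "(rotation ^^ (2 * k)) w = (rotation ^^ (3 * k)) v"
        unfolding w by (simp flip: funpow_add[THEN fun_cong, unfolded comp_def])
      also have "\<dots> = v"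
        using mod[of "3 * k"] by simp
      finally show "(w, v) \<in> orbit_relation" by (metis rel)
    qed
    show "trans orbit_relation"
      by (rule transI) (metis rel funpow_add comp_apply)
  qed simp
qed

text \<open>The smooth functions on \<open>V_mod_Z3\<close> are by definition the invariant smooth functions on
  \<open>V\<close>; their bracket is the restriction of \<open>standard_bracket\<close>.\<close>

definition invariant_smooth_functions :: "(V \<Rightarrow> real) set" where
  "invariant_smooth_functions = {f \<in> smooth_functions. \<forall>g\<in>Z3. \<forall>v. f (g v) = f v}"

text \<open>A map \<open>\<phi>\<close> is only relevant on \<open>V_mod_Z3\<close>; the pulled back function is
  regarded as a function on \<open>V\<close>.\<close>

definition pullback :: "(V set \<Rightarrow> 'm) \<Rightarrow> ('m \<Rightarrow> real) \<Rightarrow> V \<Rightarrow> real" where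
  "pullback \<phi> F = (\<lambda>v. F (\<phi> (orbit v)))"

definition smooth_embedding :: "(V set \<Rightarrow> 'm::euclidean_space) \<Rightarrow> bool" where
  "smooth_embedding \<phi> \<longleftrightarrow>
     inj_on \<phi> V_mod_Z3 \<and>
     pullback \<phi> ` smooth_functions = invariant_smooth_functions"

definition poisson_embedding :: "'m bracket \<Rightarrow> (V set \<Rightarrow> 'm::euclidean_space) \<Rightarrow> bool" where
  "poisson_embedding br \<phi> \<longleftrightarrow>
     smooth_embedding \<phi> \<and>
     poisson_algebra_hom smooth_functions br invariant_smooth_functions standard_bracket
       (pullback \<phi>)"

end

theory Submission
  imports Defs "HOL-Computational_Algebra.Polynomial" "HOL-Library.Landau_Symbols"
    "HOL-Library.Function_Algebras"
begin

text \<open>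
  Identify \<open>V\<close> with pairs \<open>z = (a\<^sub>1, a\<^sub>2)\<close> of complex numbers, on which the cyclic group acts by cube
  roots of unity.  The invariant polynomials are generated by twelve invariants:
  the products \<open>a\<^sub>i * cnj a\<^sub>j\<close>, the cubic monomials in \<open>a\<^sub>1, a\<^sub>2\<close>, and their conjugates.  Sending a point
  to these values is injective on orbits, and it is a smooth embedding once every smooth invariant
  function is known to be a smooth function of the twelve invariants.

  That last fact is the theorem of Schwarz for this group, \<open>invariant_factors\<close>.  Averaging the
  Taylor polynomials of an invariant function \<open>f\<close> over the group writes them as polynomials in the
  invariants, and Borel's lemma (\<open>borel_homogeneous\<close>) turns the resulting formal series into a
  smooth function; subtracting it from \<open>f\<close> leaves an invariant function that is flat at the origin.
  Away from the origin \<open>a\<^sub>1\<close> or \<open>a\<^sub>2\<close> is nonzero, say \<open>a\<^sub>1\<close>, and then \<open>(a\<^sub>1\<^sup>3, a\<^sub>1\<^sup>2 * a\<^sub>2)\<close> determines \<open>z\<close> up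
  to the group, with a cube root as inverse.  The singularities of that inverse are of finite
  order, so flatness absorbs them (\<open>flat_invariant_factors\<close>).

  The brackets of these invariants are polynomials in them, but only modulo the relations between
  them, whereas the Jacobi identity is required on the whole ambient space, where the relations fail.
  Sixteen more coordinates make room for it: nine of them take the values
  \<open>2 * a\<^sub>i * a\<^sub>j * cnj (a\<^sub>k * a\<^sub>l)\<close> on the image, the other seven vanish there.
  On the resulting 28-dimensional space an explicit polynomial bracket, modelled on
  the transverse slice to the 50-dimensional nilpotent orbit of type \<open>A\<^sub>2 + 2 A\<^sub>1\<close> in the
  78-dimensional Lie algebra \<open>E\<^sub>6\<close>, is a Poisson bracket; the other 50 coordinates of the ambient
  space are Casimir functions.  Checking the Jacobi identity for all triples of coordinates by
  expanding polynomials would be heavy.  Instead, the functions \<open>f\<close> for which \<open>{f, _}\<close> is a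
  derivation of the bracket form a ring closed under the bracket (\<open>balanced_bracket\<close>), and every
  coordinate is obtained by ring operations and brackets from six of them (\<open>balanced_X\<close>).  Only the
  Jacobi identities that involve one of these six are expanded.

  Because pullback is a ring homomorphism and both brackets are given by first order derivatives,
  the embedding is a Poisson map as soon as the brackets of the coordinate functions agree with
  those of the invariants, which is the polynomial identity \<open>entry_invariants\<close>.
\<close>

section \<open>Smooth functions on open sets\<close>

abbreviation ddir :: "'a::real_normed_vector \<Rightarrow> ('a \<Rightarrow> real) \<Rightarrow> 'a \<Rightarrow> real" where
  "ddir v f \<equiv> (\<lambda>x. frechet_derivative f (at x) v)"

text \<open>The coinductive form turns smoothness into an invariant to be found: a class of functions closed
  under directional derivatives consists of smooth functions.\<close>

coinductive smooth_on :: "'a::euclidean_space set \<Rightarrow> ('a \<Rightarrow> real) \<Rightarrow> bool" for U where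
  "(\<forall>x\<in>U. f differentiable (at x)) \<Longrightarrow> (\<forall>v. smooth_on U (ddir v f)) \<Longrightarrow> smooth_on U f"

lemma smooth_on_differentiable: "smooth_on U f \<Longrightarrow> x \<in> U \<Longrightarrow> f differentiable (at x)"
  by (erule smooth_on.cases) auto

lemma smooth_on_has_derivative:
  "smooth_on U f \<Longrightarrow> x \<in> U \<Longrightarrow> (f has_derivative frechet_derivative f (at x)) (at x)"
  using smooth_on_differentiable frechet_derivative_works by blast

lemma smooth_on_ddir: "smooth_on U f \<Longrightarrow> smooth_on U (ddir v f)"
  by (erule smooth_on.cases) auto

lemma smooth_on_isCont: "smooth_on U f \<Longrightarrow> x \<in> U \<Longrightarrow> isCont f x"
  using smooth_on_differentiable differentiable_imp_continuous_within by blast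

text \<open>The derivatives are only required to agree with members of the class on \<open>U\<close>, since a formula for
  a derivative is usually valid only there.\<close>

definition derivatives_in ::
  "'a::euclidean_space set \<Rightarrow> (('a \<Rightarrow> real) \<Rightarrow> bool) \<Rightarrow> ('a \<Rightarrow> real) \<Rightarrow> bool" where
  "derivatives_in U X f \<longleftrightarrow> (\<exists>f'. (\<forall>x\<in>U. (f has_derivative f' x) (at x)) \<and>
     (\<forall>v. \<exists>g. X g \<and> (\<forall>x\<in>U. f' x v = g x)))"

lemma derivatives_inI:
  assumes "\<And>x. x \<in> U \<Longrightarrow> (f has_derivative (\<lambda>v. d v x)) (at x)" "\<And>v. X (d v)"
  shows "derivatives_in U X f"
  unfolding derivatives_in_def by (rule exI[of _ "\<lambda>x v. d v x"]) (use assms in blast)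

lemma derivatives_inE:
  assumes "derivatives_in U X f"
  obtains d where "\<And>x. x \<in> U \<Longrightarrow> (f has_derivative (\<lambda>v. d v x)) (at x)" "\<And>v. X (d v)"
proof -
  obtain f' where f': "\<And>x. x \<in> U \<Longrightarrow> (f has_derivative f' x) (at x)"
    and ex: "\<And>v. \<exists>g. X g \<and> (\<forall>x\<in>U. f' x v = g x)"
    using assms unfolding derivatives_in_def by blast
  obtain d where d: "\<And>v. X (d v)" "\<And>v x. x \<in> U \<Longrightarrow> f' x v = d v x"
    using ex by metis
  have "f' x = (\<lambda>v. d v x)" if "x \<in> U" for x using d(2)[OF that] by auto
  with f' d(1) that show thesis by metis
qed

lemma derivatives_in_add:
  assumes "derivatives_in U X f" "derivatives_in U X g"
    and "\<And>f g. X f \<Longrightarrow> X g \<Longrightarrow> X (\<lambda>x. f x + g x)"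
  shows "derivatives_in U X (\<lambda>x. f x + g x)"
proof -
  obtain d e where "\<And>x. x \<in> U \<Longrightarrow> (f has_derivative (\<lambda>v. d v x)) (at x)" "\<And>v. X (d v)"
    "\<And>x. x \<in> U \<Longrightarrow> (g has_derivative (\<lambda>v. e v x)) (at x)" "\<And>v. X (e v)"
    using assms(1,2) by (metis derivatives_inE)
  then show ?thesis
    by (intro derivatives_inI[where d = "\<lambda>v x. d v x + e v x"] has_derivative_add assms(3))
qed

lemma derivatives_in_mult:
  assumes "derivatives_in U X f" "derivatives_in U Y g"
    and "\<And>h k. X h \<Longrightarrow> Y k \<Longrightarrow> Z (\<lambda>x. f x * k x + h x * g x)"
  shows "derivatives_in U Z (\<lambda>x. f x * g x)"
proof -
  obtain d e where "\<And>x. x \<in> U \<Longrightarrow> (f has_derivative (\<lambda>v. d v x)) (at x)" "\<And>v. X (d v)"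
    "\<And>x. x \<in> U \<Longrightarrow> (g has_derivative (\<lambda>v. e v x)) (at x)" "\<And>v. Y (e v)"
    using assms(1,2) by (metis derivatives_inE)
  then show ?thesis
    by (intro derivatives_inI[where d = "\<lambda>v x. f x * e v x + d v x * g x"] has_derivative_mult assms(3))
qed

lemma derivatives_in_smooth: "smooth_on U f \<Longrightarrow> (\<And>v. X (ddir v f)) \<Longrightarrow> derivatives_in U X f"
  by (rule derivatives_inI[OF smooth_on_has_derivative])

text \<open>Directional derivatives agree with the given members of \<open>X\<close> on \<open>U\<close> but not necessarily outside, so the coinduction runs over all functions that coincide on \<open>U\<close> with a member of \<open>X\<close>.\<close>

lemma smooth_on_coinduct:
  fixes f :: "'a::euclidean_space \<Rightarrow> real"
  assumes U: "open U" and "X f"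
    and step: "\<And>f. X f \<Longrightarrow> derivatives_in U X f"
  shows "smooth_on U f"
proof -
  define Y where "Y f \<longleftrightarrow> (\<exists>g. X g \<and> (\<forall>x\<in>U. f x = g x))" for f
  have "Y f" using \<open>X f\<close> unfolding Y_def by blast
  then show ?thesis
  proof (coinduction arbitrary: f rule: smooth_on.coinduct)
    case (smooth_on f)
    then obtain g where g: "X g" "\<And>x. x \<in> U \<Longrightarrow> f x = g x" unfolding Y_def by blast
    obtain d where d: "\<And>x. x \<in> U \<Longrightarrow> (g has_derivative (\<lambda>v. d v x)) (at x)" "\<And>v. X (d v)"
      using step[OF g(1)] derivatives_inE by metis
    have f': "(f has_derivative (\<lambda>v. d v x)) (at x)" if "x \<in> U" for x
      using has_derivative_transform_within_open[OF d(1)[OF that] U that] g(2) by auto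
    then have "frechet_derivative f (at x) v = d v x" if "x \<in> U" for x v
      using that frechet_derivative_at by metis
    then have "Y (ddir v f)" for v
      using d(2)[of v] unfolding Y_def by blast
    then show ?case using f' by (auto simp: differentiable_def)
  qed
qed

lemma smooth_functions_iff: "f \<in> smooth_functions \<longleftrightarrow> smooth_on UNIV f"
proof
  assume "f \<in> smooth_functions"
  then have "\<forall>k. is_Ck k f" by (simp add: smooth_functions_def)
  then show "smooth_on UNIV f"
  proof (coinduction arbitrary: f rule: smooth_on.coinduct)
    case (smooth_on f)
    then have "is_Ck (Suc k) f" for k by blast
    then show ?case by auto
  qed
next
  assume "smooth_on UNIV f"
  then have "is_Ck k f" for k
  proof (induction k arbitrary: f)
    case 0
    then show ?case by (simp add: continuous_on_eq_continuous_at smooth_on_isCont)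
  next
    case (Suc k)
    then show ?case
      using smooth_on_differentiable[OF Suc.prems] smooth_on_ddir[OF Suc.prems] by simp
  qed
  then show "f \<in> smooth_functions" by (simp add: smooth_functions_def)
qed

lemma smooth_on_const: "smooth_on U (\<lambda>x. c)"
proof (coinduction arbitrary: c rule: smooth_on.coinduct)
  case smooth_on
  have "frechet_derivative (\<lambda>x. c) (at x) = (\<lambda>v. 0)" for x :: 'a
    using frechet_derivative_at[OF has_derivative_const] by metis
  then show ?case by auto
qed

lemma smooth_on_linear:
  assumes "bounded_linear f" shows "smooth_on U f"
proof (rule smooth_on.intros)
  have "(f has_derivative f) (at x)" for x
    using assms by (rule bounded_linear_imp_has_derivative)
  then have "frechet_derivative f (at x) = f" for x by (metis frechet_derivative_at)
  then show "\<forall>v. smooth_on U (ddir v f)" by (simp add: smooth_on_const)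
  show "\<forall>x\<in>U. f differentiable (at x)"
    using \<open>\<And>x. (f has_derivative f) (at x)\<close> by (auto simp: differentiable_def)
qed

text \<open>The derivative of a product of smooth functions is a sum of two such products, so smoothness
  has to be proved for the whole ring of functions they generate.\<close>

inductive ring_closure :: "'a::euclidean_space set \<Rightarrow> ('a \<Rightarrow> real) \<Rightarrow> bool" for U where
  base: "smooth_on U f \<Longrightarrow> ring_closure U f"
| add: "ring_closure U f \<Longrightarrow> ring_closure U g \<Longrightarrow> ring_closure U (\<lambda>x. f x + g x)"
| mult: "ring_closure U f \<Longrightarrow> ring_closure U g \<Longrightarrow> ring_closure U (\<lambda>x. f x * g x)"

lemma ring_closure_smooth:
  assumes "open U" "ring_closure U f" shows "smooth_on U f"
proof (rule smooth_on_coinduct[where X = "ring_closure U", OF assms])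
  fix f :: "'a \<Rightarrow> real" assume "ring_closure U f"
  then show "derivatives_in U (ring_closure U) f"
  proof induction
    case (base f)
    then show ?case
      by (rule derivatives_in_smooth[where X = "ring_closure U"]) (intro ring_closure.base smooth_on_ddir base)
  next
    case (add f g)
    then show ?case
      by (intro derivatives_in_add[where X = "ring_closure U"] ring_closure.add)
  next
    case (mult f g)
    then show ?case
      by (intro derivatives_in_mult[where X = "ring_closure U" and Y = "ring_closure U"]
          ring_closure.add ring_closure.mult)
  qed
qed

lemma smooth_on_add: "open U \<Longrightarrow> smooth_on U f \<Longrightarrow> smooth_on U g \<Longrightarrow> smooth_on U (\<lambda>x. f x + g x)"
  by (rule ring_closure_smooth) (simp_all add: ring_closure.add ring_closure.base)

lemma smooth_on_mult: "open U \<Longrightarrow> smooth_on U f \<Longrightarrow> smooth_on U g \<Longrightarrow> smooth_on U (\<lambda>x. f x * g x)"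
  by (rule ring_closure_smooth) (simp_all add: ring_closure.mult ring_closure.base)

lemma smooth_on_minus: "open U \<Longrightarrow> smooth_on U f \<Longrightarrow> smooth_on U (\<lambda>x. - f x)"
  using smooth_on_mult[of U "\<lambda>x. -1" f] by (simp add: smooth_on_const)

lemma smooth_on_diff: "open U \<Longrightarrow> smooth_on U f \<Longrightarrow> smooth_on U g \<Longrightarrow> smooth_on U (\<lambda>x. f x - g x)"
  using smooth_on_add[of U f "\<lambda>x. - g x"] by (simp add: smooth_on_minus)

lemma smooth_on_sum:
  "open U \<Longrightarrow> (\<And>i. i \<in> I \<Longrightarrow> smooth_on U (f i)) \<Longrightarrow> smooth_on U (\<lambda>x. \<Sum>i\<in>I. f i x)"
  by (induction I rule: infinite_finite_induct) (auto intro: smooth_on_const smooth_on_add)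

lemma smooth_on_power: "open U \<Longrightarrow> smooth_on U f \<Longrightarrow> smooth_on U (\<lambda>x. f x ^ n)"
  by (induction n) (auto intro: smooth_on_const smooth_on_mult)

lemma linear_component_sum:
  fixes g' :: "'b::euclidean_space \<Rightarrow> real"
  assumes "linear g'" shows "g' y = (\<Sum>b\<in>Basis. (y \<bullet> b) * g' b)"
proof -
  have "g' y = g' (\<Sum>b\<in>Basis. (y \<bullet> b) *\<^sub>R b)" by (simp add: euclidean_representation)
  also have "\<dots> = (\<Sum>b\<in>Basis. (y \<bullet> b) * g' b)"
    using assms by (simp add: linear_sum linear_scale)
  finally show ?thesis .
qed

text \<open>By the chain rule, derivatives of a composition \<open>g \<circ> \<phi>\<close> stay in the span of the products of such a
  composition with a smooth function of the original variable.\<close>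

inductive comp_span ::
  "'a::euclidean_space set \<Rightarrow> 'b::euclidean_space set \<Rightarrow> ('a \<Rightarrow> 'b) \<Rightarrow> ('a \<Rightarrow> real) \<Rightarrow> bool"
  for U W \<phi> where
  base: "smooth_on W g \<Longrightarrow> smooth_on U h \<Longrightarrow> comp_span U W \<phi> (\<lambda>x. g (\<phi> x) * h x)"
| add: "comp_span U W \<phi> f \<Longrightarrow> comp_span U W \<phi> g \<Longrightarrow> comp_span U W \<phi> (\<lambda>x. f x + g x)"

lemma comp_span_sum:
  assumes "finite I" "\<And>i. i \<in> I \<Longrightarrow> comp_span U W \<phi> (f i)"
  shows "comp_span U W \<phi> (\<lambda>x. \<Sum>i\<in>I. f i x)"
  using assms
proof (induction I rule: finite_induct)
  case empty
  show ?case using comp_span.base[OF smooth_on_const[of W 0] smooth_on_const[of U 0]] by simp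
qed (auto intro: comp_span.add)

lemma componentwise_has_derivative:
  fixes \<phi> :: "'a::euclidean_space \<Rightarrow> 'b::euclidean_space"
  assumes "\<And>b. b \<in> Basis \<Longrightarrow> ((\<lambda>x. \<phi> x \<bullet> b) has_derivative d b) (at x)"
  shows "(\<phi> has_derivative (\<lambda>v. \<Sum>b\<in>Basis. d b v *\<^sub>R b)) (at x)"
  using assms by (subst has_derivative_componentwise_within) (simp add: inner_sum_left inner_Basis if_distrib cong: if_cong)

lemma smooth_on_compose:
  fixes \<phi> :: "'a::euclidean_space \<Rightarrow> 'b::euclidean_space"
  assumes U: "open U" and \<phi>: "\<And>b. b \<in> Basis \<Longrightarrow> smooth_on U (\<lambda>x. \<phi> x \<bullet> b)"
    and W: "\<phi> ` U \<subseteq> W" and g: "smooth_on W g"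
  shows "smooth_on U (\<lambda>x. g (\<phi> x))"
proof -
  have "comp_span U W \<phi> (\<lambda>x. g (\<phi> x))"
    using comp_span.base[OF g smooth_on_const[of U 1]] by simp
  then show ?thesis
  proof (rule smooth_on_coinduct[where X = "comp_span U W \<phi>", OF U])
    fix f assume "comp_span U W \<phi> f"
    then show "derivatives_in U (comp_span U W \<phi>) f"
    proof induction
      case (base g h)
      let ?d = "\<lambda>b x. frechet_derivative (\<lambda>x. \<phi> x \<bullet> b) (at x)"
      let ?f' = "\<lambda>x v. g (\<phi> x) * frechet_derivative h (at x) v +
          (\<Sum>b\<in>Basis. ?d b x v * frechet_derivative g (at (\<phi> x)) b) * h x"
      have "((\<lambda>x. g (\<phi> x) * h x) has_derivative ?f' x) (at x)" if "x \<in> U" for x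
      proof -
        have 1: "(\<phi> has_derivative (\<lambda>v. \<Sum>b\<in>Basis. ?d b x v *\<^sub>R b)) (at x)"
          using \<phi> that by (intro componentwise_has_derivative smooth_on_has_derivative)
        have 2: "(g has_derivative frechet_derivative g (at (\<phi> x))) (at (\<phi> x))"
          using base(1) W that by (intro smooth_on_has_derivative) auto
        then have lin: "linear (frechet_derivative g (at (\<phi> x)))"
          using has_derivative_linear by blast
        have "((\<lambda>x. g (\<phi> x)) has_derivative
           (\<lambda>v. \<Sum>b\<in>Basis. ?d b x v * frechet_derivative g (at (\<phi> x)) b)) (at x)"
          using has_derivative_compose[OF 1 2] lin by (simp add: linear_sum linear_scale)
        then show ?thesis
          by (rule has_derivative_mult[OF _ smooth_on_has_derivative[OF base(2) that]])
      qed
      moreover have "comp_span U W \<phi> (\<lambda>x. ?f' x v)" for v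
      proof -
        have "comp_span U W \<phi> (\<lambda>x. g (\<phi> x) * ddir v h x + (\<Sum>b\<in>Basis. ddir b g (\<phi> x) * (?d b x v * h x)))"
          using base \<phi> U
          by (intro comp_span.add comp_span_sum comp_span.base smooth_on_mult smooth_on_ddir) auto
        then show ?thesis by (simp add: sum_distrib_right sum_distrib_left mult_ac)
      qed
      ultimately show ?case
        by (rule derivatives_inI[where d = "\<lambda>v x. ?f' x v" and X = "comp_span U W \<phi>"])
    next
      case (add f g)
      then show ?case
        by (intro derivatives_in_add[where X = "comp_span U W \<phi>"] comp_span.add)
    qed
  qed
qed

lemma smooth_on_compose_real:
  fixes g :: "real \<Rightarrow> real"
  assumes "open U" "smooth_on U \<phi>" "\<phi> ` U \<subseteq> W" "smooth_on W g"
  shows "smooth_on U (\<lambda>x. g (\<phi> x))"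
  by (rule smooth_on_compose[OF assms(1) _ assms(3,4)]) (use assms(2) in simp)

text \<open>Differentiation preserves the class of multiples of the powers \<open>inverse x ^ n\<close>.\<close>

lemma smooth_on_inverse_real: "smooth_on {x::real. x \<noteq> 0} inverse"
proof -
  define X where "X f \<longleftrightarrow> (\<exists>c n. f = (\<lambda>x::real. c * inverse x ^ n))" for f
  have X: "X inverse" unfolding X_def by (rule exI[of _ 1], rule exI[of _ 1]) simp
  have U: "open {x::real. x \<noteq> 0}" by (simp add: open_Collect_neq)
  show ?thesis
  proof (rule smooth_on_coinduct[where X = X, OF U X])
    fix f :: "real \<Rightarrow> real" assume "X f"
    then obtain c n where f: "f = (\<lambda>x. c * inverse x ^ n)" by (auto simp: X_def)
    have "(f has_derivative (\<lambda>v. - (c * n * v) * inverse x ^ (n + 1))) (at x)" if "x \<noteq> 0" for x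
    proof -
      have "(f has_real_derivative c * (n * inverse x ^ (n - 1) * - (inverse x * inverse x))) (at x)"
        unfolding f using that by (auto intro!: derivative_eq_intros)
      moreover have "c * (n * inverse x ^ (n - 1) * - (inverse x * inverse x)) =
          - (c * n) * inverse x ^ (n + 1)"
        by (cases n) simp_all
      ultimately have "(f has_real_derivative - (c * n) * inverse x ^ (n + 1)) (at x)" by metis
      then show ?thesis
        unfolding has_field_derivative_def by (rule has_derivative_eq_rhs) (auto simp: mult_ac)
    qed
    moreover have "X (\<lambda>x. - (c * n * v) * inverse x ^ (n + 1))" for v unfolding X_def by blast
    ultimately show "derivatives_in {x. x \<noteq> 0} X f"
      by (intro derivatives_inI[where d = "\<lambda>v x. - (c * n * v) * inverse x ^ (n + 1)" and X = X]) auto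
  qed
qed

lemma smooth_on_inverse:
  assumes "open U" "smooth_on U f" "\<And>x. x \<in> U \<Longrightarrow> f x \<noteq> 0"
  shows "smooth_on U (\<lambda>x. inverse (f x))"
  by (rule smooth_on_compose_real[OF assms(1,2) _ smooth_on_inverse_real]) (use assms(3) in auto)

section \<open>Symmetry of second derivatives and cutoff functions\<close>

lemma smooth_on_line_derivative:
  assumes "smooth_on UNIV f"
  shows "((\<lambda>s. f (p + s *\<^sub>R w)) has_real_derivative ddir w f (p + s *\<^sub>R w)) (at s)"
proof -
  have f: "(f has_derivative frechet_derivative f (at (p + s *\<^sub>R w))) (at (p + s *\<^sub>R w))"
    using assms by (rule smooth_on_has_derivative) simp
  have l: "((\<lambda>s. p + s *\<^sub>R w) has_derivative (\<lambda>h. h *\<^sub>R w)) (at s)"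
    by (auto intro!: derivative_eq_intros)
  show ?thesis
    using has_derivative_compose[OF l f] has_derivative_linear[OF f]
    by (simp add: has_field_derivative_def linear_scale mult.commute[of _ "frechet_derivative _ _ _"]
        mult_commute_abs)
qed

text \<open>Applying the mean value theorem twice, first along \<open>w\<close> and then along \<open>v\<close>; the left-hand side is
  symmetric in \<open>v\<close> and \<open>w\<close>, which gives the symmetry of second derivatives.\<close>

lemma second_difference_mean_value:
  assumes f: "smooth_on UNIV f" and t: "0 < t"
  shows "\<exists>r s. 0 < r \<and> r < t \<and> 0 < s \<and> s < t \<and>
    f (x + t *\<^sub>R v + t *\<^sub>R w) - f (x + t *\<^sub>R v) - f (x + t *\<^sub>R w) + f x =
      t * t * ddir v (ddir w f) (x + r *\<^sub>R v + s *\<^sub>R w)"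
proof -
  define \<phi> where "\<phi> s = f ((x + t *\<^sub>R v) + s *\<^sub>R w) - f (x + s *\<^sub>R w)" for s
  have "\<exists>s. 0 < s \<and> s < t \<and> \<phi> t - \<phi> 0 =
      (t - 0) * (ddir w f ((x + t *\<^sub>R v) + s *\<^sub>R w) - ddir w f (x + s *\<^sub>R w))"
    unfolding \<phi>_def using t
    by (intro MVT2) (auto intro!: DERIV_diff smooth_on_line_derivative f)
  then obtain s where s: "0 < s" "s < t" "\<phi> t - \<phi> 0 =
      t * (ddir w f ((x + t *\<^sub>R v) + s *\<^sub>R w) - ddir w f (x + s *\<^sub>R w))" by auto
  define \<psi> where "\<psi> r = ddir w f ((x + s *\<^sub>R w) + r *\<^sub>R v)" for r
  have "\<exists>r. 0 < r \<and> r < t \<and> \<psi> t - \<psi> 0 = (t - 0) * ddir v (ddir w f) ((x + s *\<^sub>R w) + r *\<^sub>R v)"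
    unfolding \<psi>_def using t
    by (intro MVT2) (auto intro!: smooth_on_line_derivative smooth_on_ddir f)
  then obtain r where "0 < r" "r < t" "\<psi> t - \<psi> 0 = t * ddir v (ddir w f) ((x + s *\<^sub>R w) + r *\<^sub>R v)"
    by auto
  then show ?thesis
    using s by (intro exI[of _ r] exI[of _ s]) (simp add: \<phi>_def \<psi>_def add_ac)
qed

text \<open>Both mixed derivatives are limits of the same second difference quotient.\<close>

lemma ddir_commute:
  assumes f: "smooth_on UNIV f"
  shows "ddir v (ddir w f) = ddir w (ddir v f)"
proof
  fix x
  let ?A = "ddir v (ddir w f)" and ?B = "ddir w (ddir v f)"
  show "?A x = ?B x"
  proof (rule ccontr)
    assume ne: "?A x \<noteq> ?B x"
    define e where "e = \<bar>?A x - ?B x\<bar> / 2"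
    have e: "e > 0" using ne by (simp add: e_def)
    have "isCont ?A x" "isCont ?B x"
      using f by (auto intro!: smooth_on_isCont[of UNIV] smooth_on_ddir)
    then obtain d1 d2 where d: "d1 > 0" "\<And>y. dist y x < d1 \<Longrightarrow> dist (?A y) (?A x) < e"
      "d2 > 0" "\<And>y. dist y x < d2 \<Longrightarrow> dist (?B y) (?B x) < e"
      using e unfolding continuous_at_eps_delta by metis
    define t where "t = min d1 d2 / (norm v + norm w + 1)"
    have pos: "norm v + norm w + 1 > 0" using norm_ge_zero[of v] norm_ge_zero[of w] by linarith
    then have t: "t > 0" using d by (simp add: t_def)
    have near: "dist (x + r *\<^sub>R v + s *\<^sub>R w) x < min d1 d2" if "0 < r" "r < t" "0 < s" "s < t" for r s
    proof -
      have "dist (x + r *\<^sub>R v + s *\<^sub>R w) x = norm (r *\<^sub>R v + s *\<^sub>R w)" by (simp add: dist_norm)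
      also have "\<dots> \<le> r * norm v + s * norm w" using norm_triangle_ineq[of "r *\<^sub>R v" "s *\<^sub>R w"] that by simp
      also have "\<dots> \<le> t * norm v + t * norm w" using that by (intro add_mono mult_right_mono) auto
      also have "\<dots> < t * (norm v + norm w + 1)" using t by (simp add: algebra_simps)
      also have "\<dots> = min d1 d2" using pos by (simp add: t_def)
      finally show ?thesis .
    qed
    obtain r s where 1: "0 < r" "r < t" "0 < s" "s < t"
      "f (x + t *\<^sub>R v + t *\<^sub>R w) - f (x + t *\<^sub>R v) - f (x + t *\<^sub>R w) + f x = t * t * ?A (x + r *\<^sub>R v + s *\<^sub>R w)"
      using second_difference_mean_value[OF f t] by metis
    obtain r' s' where 2: "0 < r'" "r' < t" "0 < s'" "s' < t"
      "f (x + t *\<^sub>R w + t *\<^sub>R v) - f (x + t *\<^sub>R w) - f (x + t *\<^sub>R v) + f x = t * t * ?B (x + r' *\<^sub>R w + s' *\<^sub>R v)"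
      using second_difference_mean_value[OF f t] by metis
    have "t * t * ?A (x + r *\<^sub>R v + s *\<^sub>R w) = t * t * ?B (x + s' *\<^sub>R v + r' *\<^sub>R w)"
    proof -
      have 3: "x + t *\<^sub>R w + t *\<^sub>R v = x + t *\<^sub>R v + t *\<^sub>R w" by (simp add: add_ac)
      have 4: "x + r' *\<^sub>R w + s' *\<^sub>R v = x + s' *\<^sub>R v + r' *\<^sub>R w" by (simp add: add_ac)
      show ?thesis using 1(5) 2(5) unfolding 3 4 by linarith
    qed
    then have "?A (x + r *\<^sub>R v + s *\<^sub>R w) = ?B (x + s' *\<^sub>R v + r' *\<^sub>R w)" using t by simp
    moreover have "dist (?A (x + r *\<^sub>R v + s *\<^sub>R w)) (?A x) < e" "dist (?B (x + s' *\<^sub>R v + r' *\<^sub>R w)) (?B x) < e"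
      using d(2)[of "x + r *\<^sub>R v + s *\<^sub>R w"] d(4)[of "x + s' *\<^sub>R v + r' *\<^sub>R w"] near[OF 1(1-4)] near[OF 2(3,4,1,2)] by simp_all
    ultimately show False by (simp add: e_def dist_real_def abs_if split: if_splits)
  qed
qed

text \<open>With the polynomial factor the class of these functions is closed under differentiation: the
  derivative of \<open>p (1/x) * exp (- 1/x)\<close> has the factor \<open>x\<^sup>2 * (p - p')\<close> at \<open>1/x\<close>.\<close>

definition exp_flat :: "real poly \<Rightarrow> real \<Rightarrow> real" where
  "exp_flat p x = (if x \<le> 0 then 0 else poly p (inverse x) * exp (- inverse x))"

lemma poly_times_power_div_exp_tendsto_0:
  "((\<lambda>y::real. poly p y * y ^ n / exp y) \<longlongrightarrow> 0) at_top"
proof (induction p arbitrary: n)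
  case (pCons a p)
  have "((\<lambda>y. a * (y ^ n / exp y) + poly p y * y ^ Suc n / exp y) \<longlongrightarrow> a * 0 + 0) at_top"
    by (intro tendsto_intros tendsto_power_div_exp_0 pCons.IH)
  then show ?case by (simp add: field_simps)
qed simp

lemma exp_flat_has_derivative:
  "(exp_flat p has_real_derivative exp_flat ([:0, 0, 1:] * (p - pderiv p)) x) (at x)"
proof -
  consider "x < 0" | "x > 0" | "x = 0" by linarith
  then show ?thesis
  proof cases
    case 1
    have "((\<lambda>_. 0) has_real_derivative 0) (at x)" by simp
    then have "(exp_flat p has_real_derivative 0) (at x)"
      by (rule has_field_derivative_transform_within_open[of _ _ _ "{..<0}"])
         (use 1 in \<open>auto simp: exp_flat_def\<close>)
    then show ?thesis using 1 by (simp add: exp_flat_def)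
  next
    case 2
    have "((\<lambda>x. poly p (inverse x) * exp (- inverse x)) has_real_derivative
       exp_flat ([:0, 0, 1:] * (p - pderiv p)) x) (at x)"
      using 2 by (auto intro!: derivative_eq_intros simp: exp_flat_def algebra_simps power2_eq_square)
    then show ?thesis
      by (rule has_field_derivative_transform_within_open[of _ _ _ "{0<..}"])
         (use 2 in \<open>auto simp: exp_flat_def\<close>)
  next
    case 3
    have "((\<lambda>y. poly p (inverse y) * inverse y ^ 1 / exp (inverse y)) \<longlongrightarrow> 0) (at_right 0)"
      by (rule filterlim_compose[OF poly_times_power_div_exp_tendsto_0 filterlim_inverse_at_top_right])
    moreover have "\<forall>\<^sub>F y in at_right (0::real). poly p (inverse y) * inverse y ^ 1 / exp (inverse y) =
        (exp_flat p y - exp_flat p 0) / (y - 0)"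
      by (rule eventually_at_rightI[of 0 1]) (auto simp: exp_flat_def exp_minus field_simps)
    ultimately have "((\<lambda>y. (exp_flat p y - exp_flat p 0) / (y - 0)) \<longlongrightarrow> 0) (at_right 0)"
      by (rule Lim_transform_eventually)
    moreover have "((\<lambda>y. (exp_flat p y - exp_flat p 0) / (y - 0)) \<longlongrightarrow> 0) (at_left 0)"
      by (rule tendsto_eventually) (auto simp: exp_flat_def eventually_at_filter)
    ultimately have "((\<lambda>y. (exp_flat p y - exp_flat p 0) / (y - 0)) \<longlongrightarrow> 0) (at 0)"
      by (simp add: filterlim_split_at)
    then show ?thesis using 3 by (simp add: exp_flat_def has_field_derivative_iff)
  qed
qed

lemma exp_flat_smooth: "smooth_on UNIV (exp_flat p)"
proof -
  define X where "X f \<longleftrightarrow> (\<exists>p. f = exp_flat p)" for f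
  have "X (exp_flat p)" by (auto simp: X_def)
  then show ?thesis
  proof (rule smooth_on_coinduct[where X = X, OF open_UNIV])
    fix f assume "X f"
    then obtain p where f: "f = exp_flat p" by (auto simp: X_def)
    define q where "q = [:0, 0, 1:] * (p - pderiv p)"
    let ?d = "\<lambda>v. exp_flat (smult v q)"
    have "(f has_derivative (\<lambda>v. ?d v x)) (at x)" for x
    proof -
      have "(\<lambda>v. exp_flat (smult v q) x) = (*) (exp_flat q x)"
        by (auto simp: exp_flat_def)
      then show ?thesis
        using exp_flat_has_derivative[of p x] unfolding f has_field_derivative_def q_def by simp
    qed
    then show "derivatives_in UNIV X f"
      by (intro derivatives_inI[where d = ?d and X = X]) (auto simp: X_def)
  qed
qed

definition smooth_step :: "real \<Rightarrow> real" where
  "smooth_step t = exp_flat 1 t / (exp_flat 1 t + exp_flat 1 (1 - t))"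

lemma exp_flat_1_sum_pos: "exp_flat 1 t + exp_flat 1 (1 - t) > 0"
  by (cases "t \<le> 0") (auto simp: exp_flat_def intro: add_pos_nonneg)

lemma smooth_step_smooth: "smooth_on UNIV smooth_step"
proof -
  have "smooth_on UNIV (\<lambda>t. exp_flat 1 (1 - t))"
    by (rule smooth_on_compose_real[OF _ _ _ exp_flat_smooth])
       (simp_all add: smooth_on_diff smooth_on_const smooth_on_linear bounded_linear_ident)
  then have "smooth_on UNIV (\<lambda>t. exp_flat 1 t * inverse (exp_flat 1 t + exp_flat 1 (1 - t)))"
    by (intro smooth_on_mult smooth_on_inverse smooth_on_add exp_flat_smooth open_UNIV)
       (use exp_flat_1_sum_pos in \<open>auto simp: less_le\<close>)
  then show ?thesis unfolding smooth_step_def[abs_def] by (simp add: divide_inverse)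
qed

lemma smooth_step_eq_0: "t \<le> 0 \<Longrightarrow> smooth_step t = 0"
  by (simp add: smooth_step_def exp_flat_def)

lemma smooth_step_eq_1: "t \<ge> 1 \<Longrightarrow> smooth_step t = 1"
  using exp_flat_1_sum_pos[of t] by (simp add: smooth_step_def exp_flat_def)

text \<open>This symmetry makes \<open>smooth_step t\<close> and \<open>smooth_step (1 - t)\<close> a partition of unity.\<close>

lemma smooth_step_reflect: "smooth_step t + smooth_step (1 - t) = 1"
proof -
  have "a / (a + b) + b / (b + a) = 1" if "a + b > 0" for a b :: real
    using that by (simp add: add.commute[of b a] flip: add_divide_distrib)
  from this[OF exp_flat_1_sum_pos[of t]] show ?thesis by (simp add: smooth_step_def)
qed

lemma smooth_step_bounds: "0 \<le> smooth_step t" "smooth_step t \<le> 1"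
proof -
  have "0 \<le> exp_flat 1 t" for t by (simp add: exp_flat_def)
  then have nonneg: "0 \<le> smooth_step t" for t unfolding smooth_step_def by (simp add: add_nonneg_nonneg)
  show "0 \<le> smooth_step t" by (rule nonneg)
  show "smooth_step t \<le> 1" using nonneg[of "1 - t"] smooth_step_reflect[of t] by linarith
qed

lemma smooth_on_inner_self: "smooth_on UNIV (\<lambda>x::'a::euclidean_space. x \<bullet> x)"
proof -
  have "smooth_on UNIV (\<lambda>x::'a. \<Sum>b\<in>Basis. (x \<bullet> b) * (x \<bullet> b))"
    by (intro smooth_on_sum smooth_on_mult smooth_on_linear bounded_linear_inner_left open_UNIV)
  then show ?thesis by (simp flip: euclidean_inner)
qed

definition bump :: "'a::euclidean_space \<Rightarrow> real" where
  "bump x = smooth_step (2 - x \<bullet> x)"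

lemma bump_smooth: "smooth_on UNIV bump"
  unfolding bump_def[abs_def]
  by (rule smooth_on_compose_real[OF _ _ _ smooth_step_smooth])
     (simp_all add: smooth_on_diff smooth_on_const smooth_on_inner_self)

lemma bump_eq_1: "norm x \<le> 1 \<Longrightarrow> bump x = 1"
  unfolding bump_def dot_square_norm by (rule smooth_step_eq_1) (simp add: power_le_one)

lemma bump_eq_0:
  assumes "norm x \<ge> 2" shows "bump x = 0"
proof -
  have "(norm x)\<^sup>2 \<ge> 2\<^sup>2" using assms by (intro power_mono) auto
  then show ?thesis unfolding bump_def dot_square_norm by (intro smooth_step_eq_0) simp
qed

section \<open>Partial derivatives and Borel's lemma\<close>

inductive lin_span :: "('a::euclidean_space \<Rightarrow> real) set \<Rightarrow> ('a \<Rightarrow> real) \<Rightarrow> bool" for S where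
  base: "f \<in> S \<Longrightarrow> lin_span S f"
| zero: "lin_span S (\<lambda>x. 0)"
| add: "lin_span S f \<Longrightarrow> lin_span S g \<Longrightarrow> lin_span S (\<lambda>x. f x + g x)"
| scale: "lin_span S f \<Longrightarrow> lin_span S (\<lambda>x. c * f x)"

lemma lin_span_sum:
  "finite I \<Longrightarrow> (\<And>i. i \<in> I \<Longrightarrow> lin_span S (f i)) \<Longrightarrow> lin_span S (\<lambda>x. \<Sum>i\<in>I. f i x)"
  by (induction I rule: finite_induct) (auto intro: lin_span.zero lin_span.add)

text \<open>It suffices to close a class under partial derivatives, since the directional derivatives lie in
  its linear span.\<close>

lemma smooth_on_partials:
  fixes f :: "'a::euclidean_space \<Rightarrow> real"
  assumes U: "open U" and f: "f \<in> S"
    and step: "\<And>f. f \<in> S \<Longrightarrow> \<exists>d. (\<forall>x\<in>U. (f has_derivative (\<lambda>v. \<Sum>b\<in>Basis. (v \<bullet> b) * d b x)) (at x)) \<and>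
       (\<forall>b\<in>Basis. d b \<in> S)"
  shows "smooth_on U f"
proof (rule smooth_on_coinduct[where X = "lin_span S", OF U lin_span.base[OF f]])
  fix f assume "lin_span S f"
  then show "derivatives_in U (lin_span S) f"
  proof induction
    case (base f)
    then obtain d where d: "\<And>x. x \<in> U \<Longrightarrow> (f has_derivative (\<lambda>v. \<Sum>b\<in>Basis. (v \<bullet> b) * d b x)) (at x)"
      "\<And>b. b \<in> Basis \<Longrightarrow> d b \<in> S" using step by blast
    show ?case
      by (rule derivatives_inI[where d = "\<lambda>v x. \<Sum>b\<in>Basis. (v \<bullet> b) * d b x" and X = "lin_span S"])
         (simp_all add: d lin_span_sum lin_span.scale lin_span.base)
  next
    case zero
    show ?case
      by (rule derivatives_inI[where d = "\<lambda>v x. 0" and X = "lin_span S"]) (simp_all add: lin_span.zero)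
  next
    case (add f g)
    then show ?case
      by (intro derivatives_in_add[where X = "lin_span S"] lin_span.add)
  next
    case (scale f c)
    then obtain d where d: "\<And>x. x \<in> U \<Longrightarrow> (f has_derivative (\<lambda>v. d v x)) (at x)" "\<And>v. lin_span S (d v)"
      by (metis derivatives_inE)
    show ?case
      by (rule derivatives_inI[where d = "\<lambda>v x. c * d v x" and X = "lin_span S"])
         (simp_all add: d lin_span.scale has_derivative_mult_right)
  qed
qed

text \<open>Iterated directional derivatives; the head of the word is applied last.\<close>

primrec word_deriv :: "'a::euclidean_space list \<Rightarrow> ('a \<Rightarrow> real) \<Rightarrow> 'a \<Rightarrow> real" where
  "word_deriv [] f = f"
| "word_deriv (v # w) f = ddir v (word_deriv w f)"

lemma smooth_on_word_deriv: "smooth_on U f \<Longrightarrow> smooth_on U (word_deriv w f)"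
  by (induction w) (auto intro: smooth_on_ddir)

lemma word_deriv_scale:
  assumes f: "smooth_on UNIV f"
  shows "word_deriv w (\<lambda>x. c * f (\<mu> *\<^sub>R x)) = (\<lambda>x. c * \<mu> ^ length w * word_deriv w f (\<mu> *\<^sub>R x))"
proof (induction w)
  case (Cons v w)
  let ?g = "word_deriv w f" and ?c = "c * \<mu> ^ length w"
  have "((\<lambda>x. ?c * ?g (\<mu> *\<^sub>R x)) has_derivative
      (\<lambda>v. ?c * frechet_derivative ?g (at (\<mu> *\<^sub>R x)) (\<mu> *\<^sub>R v))) (at x)" for x
  proof -
    have "(?g has_derivative frechet_derivative ?g (at (\<mu> *\<^sub>R x))) (at (\<mu> *\<^sub>R x))"
      using smooth_on_word_deriv[OF f] by (rule smooth_on_has_derivative) simp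
    from has_derivative_compose[OF has_derivative_scaleR_right[OF has_derivative_ident] this]
    show ?thesis by (rule has_derivative_mult_right)
  qed
  moreover have "frechet_derivative ?g (at y) (\<mu> *\<^sub>R v) = \<mu> * frechet_derivative ?g (at y) v" for y
    using has_derivative_linear[OF smooth_on_has_derivative[OF smooth_on_word_deriv[OF f], of y w]]
    by (simp add: linear_scale)
  ultimately have "ddir v (\<lambda>x. ?c * ?g (\<mu> *\<^sub>R x)) x = ?c * (\<mu> * ddir v ?g (\<mu> *\<^sub>R x))" for x
    by (metis frechet_derivative_at)
  then show ?case by (auto simp: Cons.IH)
qed simp

lemma word_deriv_eq_0:
  assumes "open U" "\<And>x. x \<in> U \<Longrightarrow> f x = 0" "x \<in> U"
  shows "word_deriv w f x = 0"
  using assms(3)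
proof (induction w arbitrary: x)
  case (Cons v w)
  have "(word_deriv w f has_derivative (\<lambda>v. 0)) (at x)"
    by (rule has_derivative_transform_within_open[OF has_derivative_const[of 0] assms(1) Cons.prems])
       (use Cons.IH in simp)
  from frechet_derivative_at[OF this] show ?case by (metis word_deriv.simps(2))
qed (use assms in simp)

lemma word_deriv_bounded:
  assumes f: "smooth_on UNIV f" and 0: "\<And>x. norm x \<ge> r \<Longrightarrow> f x = 0"
  shows "\<exists>C. \<forall>x. \<bar>word_deriv w f x\<bar> \<le> C"
proof -
  have "continuous_on (cball 0 r) (word_deriv w f)"
    by (intro continuous_at_imp_continuous_on ballI smooth_on_isCont[OF smooth_on_word_deriv[OF f]]) simp
  from compact_imp_bounded[OF compact_continuous_image[OF this compact_cball]]
  obtain C where "\<forall>y\<in>word_deriv w f ` cball 0 r. norm y \<le> C" unfolding bounded_iff by blast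
  then have C: "\<bar>word_deriv w f x\<bar> \<le> C" if "norm x \<le> r" for x using that by simp
  have "word_deriv w f x = 0" if "norm x > r" for x
    by (rule word_deriv_eq_0[of "- cball 0 r"]) (use 0 that in auto)
  then have "\<bar>word_deriv w f x\<bar> \<le> max C 0" for x
    using C[of x] by (cases "norm x \<le> r") auto
  then show ?thesis by blast
qed

text \<open>Every derivative of the series is dominated by a geometric series up to finitely many terms, so
  all series of derivatives converge uniformly and may be differentiated term by term.\<close>

lemma smooth_series:
  fixes t :: "nat \<Rightarrow> 'a::euclidean_space \<Rightarrow> real"
  assumes t: "\<And>m. smooth_on UNIV (t m)"
    and bnd: "\<And>w. set w \<subseteq> Basis \<Longrightarrow> \<forall>\<^sub>F m in sequentially. \<forall>x. \<bar>word_deriv w (t m) x\<bar> \<le> (1/2) ^ m"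
  shows "smooth_on UNIV (\<lambda>x. \<Sum>m. t m x)" "summable (\<lambda>m. t m x)"
proof -
  define F where "F w x = (\<Sum>m. word_deriv w (t m) x)" for w x
  have ul: "uniform_limit UNIV (\<lambda>n x. \<Sum>m<n. word_deriv w (t m) x) (F w) sequentially"
    if "set w \<subseteq> Basis" for w
    unfolding F_def using bnd[OF that]
    by (intro Weierstrass_m_test_ev[where M = "\<lambda>m. (1/2) ^ m"]) (auto simp: summable_geometric elim: eventually_mono)
  have sm: "(\<lambda>m. word_deriv w (t m) x) sums F w x" if "set w \<subseteq> Basis" for w x
    using tendsto_uniform_limitI[OF ul[OF that], of x] by (simp add: sums_def)
  show "summable (\<lambda>m. t m x)" using sm[of "[]" x] by (auto simp: sums_iff)
  have D: "(F w has_derivative (\<lambda>v. \<Sum>b\<in>Basis. (v \<bullet> b) * F (b # w) x)) (at x)" if w: "set w \<subseteq> Basis" for w x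
  proof -
    let ?f' = "\<lambda>m x. frechet_derivative (word_deriv w (t m)) (at x)"
    let ?g' = "\<lambda>x v. \<Sum>b\<in>Basis. (v \<bullet> b) * F (b # w) x"
    have "\<exists>g. \<forall>x\<in>UNIV. (\<lambda>m. word_deriv w (t m) x) sums g x \<and> (g has_derivative ?g' x) (at x within UNIV)"
    proof (rule has_derivative_series[where f' = ?f'])
      show "(word_deriv w (t m) has_derivative ?f' m x) (at x within UNIV)" for m x
        using smooth_on_has_derivative[OF smooth_on_word_deriv[OF t]] by simp
      show "(\<lambda>m. word_deriv w (t m) 0) sums F w 0" using sm[OF w] .
      fix e :: real assume e: "e > 0"
      define e' where "e' = e / real (DIM('a))"
      have e': "e' > 0" using e by (simp add: e'_def)
      have "\<forall>\<^sub>F n in sequentially. \<forall>b\<in>Basis. \<forall>x. \<bar>(\<Sum>m<n. word_deriv (b # w) (t m) x) - F (b # w) x\<bar> < e'"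
      proof (intro eventually_ball_finite ballI)
        fix b :: 'a assume "b \<in> Basis"
        then have "set (b # w) \<subseteq> Basis" using w by simp
        from uniform_limitD[OF ul[OF this] e']
        show "\<forall>\<^sub>F n in sequentially. \<forall>x. \<bar>(\<Sum>m<n. word_deriv (b # w) (t m) x) - F (b # w) x\<bar> < e'"
          by (simp add: dist_real_def)
      qed simp
      then show "\<forall>\<^sub>F n in sequentially. \<forall>x\<in>UNIV. \<forall>h. norm ((\<Sum>m<n. ?f' m x h) - ?g' x h) \<le> e * norm h"
      proof (rule eventually_mono, intro ballI allI)
        fix n x and h :: 'a
        assume *: "\<forall>b\<in>Basis. \<forall>x. \<bar>(\<Sum>m<n. word_deriv (b # w) (t m) x) - F (b # w) x\<bar> < e'"
        have "?f' m x h = (\<Sum>b\<in>Basis. (h \<bullet> b) * word_deriv (b # w) (t m) x)" for m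
          using linear_component_sum[OF has_derivative_linear[OF smooth_on_has_derivative[OF smooth_on_word_deriv[OF t], of x w m]], of h]
          by simp
        then have "(\<Sum>m<n. ?f' m x h) - ?g' x h =
          (\<Sum>b\<in>Basis. (h \<bullet> b) * ((\<Sum>m<n. word_deriv (b # w) (t m) x) - F (b # w) x))"
          by (simp add: sum.swap[of _ Basis] sum_distrib_left right_diff_distrib sum_subtractf)
        also have "norm \<dots> \<le> (\<Sum>b\<in>(Basis :: 'a set). norm h * e')"
        proof (rule sum_norm_le)
          fix b :: 'a assume b: "b \<in> Basis"
          with * have "\<bar>(\<Sum>m<n. word_deriv (b # w) (t m) x) - F (b # w) x\<bar> \<le> e'"
            by (intro less_imp_le) blast
          then show "norm ((h \<bullet> b) * ((\<Sum>m<n. word_deriv (b # w) (t m) x) - F (b # w) x)) \<le> norm h * e'"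
            unfolding real_norm_def abs_mult using Basis_le_norm[OF b, of h] by (intro mult_mono) auto
        qed
        also have "\<dots> = e * norm h" by (simp add: e'_def)
        finally show "norm ((\<Sum>m<n. ?f' m x h) - ?g' x h) \<le> e * norm h" .
      qed
    qed auto
    then obtain g where g: "\<And>x. (\<lambda>m. word_deriv w (t m) x) sums g x" "\<And>x. (g has_derivative ?g' x) (at x)"
      by auto
    have "g = F w" using g(1) sm[OF w] sums_unique2 by blast
    with g(2) show ?thesis by simp
  qed
  have "smooth_on UNIV (F [])"
  proof (rule smooth_on_partials[where S = "{F w | w. set w \<subseteq> Basis}", OF open_UNIV])
    show "F [] \<in> {F w | w. set w \<subseteq> Basis}" by (force intro: exI[of _ "[]"])
    fix f assume "f \<in> {F w | w. set w \<subseteq> Basis}"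
    then obtain w where w: "f = F w" "set w \<subseteq> Basis" by blast
    then show "\<exists>d. (\<forall>x\<in>UNIV. (f has_derivative (\<lambda>v. \<Sum>b\<in>Basis. (v \<bullet> b) * d b x)) (at x)) \<and>
       (\<forall>b\<in>Basis. d b \<in> {F w | w. set w \<subseteq> Basis})"
      using D[OF w(2)] by (intro exI[of _ "\<lambda>b. F (b # w)"]) fastforce
  qed
  then show "smooth_on UNIV (\<lambda>x. \<Sum>m. t m x)" by (simp add: F_def[abs_def])
qed

lemma homogeneous_bound:
  fixes g :: "'a::euclidean_space \<Rightarrow> real"
  assumes g: "smooth_on UNIV g" and hom: "\<And>c x. g (c *\<^sub>R x) = c ^ m * g x"
  shows "\<exists>G. \<forall>x. \<bar>g x\<bar> \<le> G * norm x ^ m"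
proof -
  have "continuous_on (cball 0 1) g"
    by (intro continuous_at_imp_continuous_on ballI smooth_on_isCont[OF g]) simp
  from compact_imp_bounded[OF compact_continuous_image[OF this compact_cball]]
  obtain G where "\<forall>y\<in>g ` cball 0 1. norm y \<le> G" unfolding bounded_iff by blast
  then have G: "\<bar>g x\<bar> \<le> G" if "norm x \<le> 1" for x using that by simp
  have "\<bar>g x\<bar> \<le> G * norm x ^ m" for x
  proof (cases "x = 0")
    case True
    then show ?thesis using G[of 0] hom[of 0 0] by (cases m) auto
  next
    case False
    have "g x = norm x ^ m * g ((1 / norm x) *\<^sub>R x)"
      using hom[of "norm x" "(1 / norm x) *\<^sub>R x"] False by simp
    then have "\<bar>g x\<bar> = norm x ^ m * \<bar>g ((1 / norm x) *\<^sub>R x)\<bar>" by (simp add: abs_mult)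
    also have "\<dots> \<le> norm x ^ m * G" using False by (intro mult_left_mono G) auto
    finally show ?thesis by (simp add: mult.commute)
  qed
  then show ?thesis by blast
qed

text \<open>Borel's lemma.  The term of degree \<open>m\<close> is cut off at radius \<open>2 / \<mu> m\<close>.  Since the term is
  homogeneous, the result has the form \<open>inverse (\<mu> m) ^ m * h m (\<mu> m *\<^sub>R x)\<close>, where \<open>h m\<close> is the term times
  a fixed bump function, and derivatives of order \<open>k < m\<close> gain the factor \<open>inverse (\<mu> m) ^ (m - k)\<close>; this makes the series of cut off terms and all its
  derivatives converge if \<open>\<mu> m\<close> grows fast enough.\<close>

theorem borel_homogeneous:
  fixes g :: "nat \<Rightarrow> 'a::euclidean_space \<Rightarrow> real"
  assumes g: "\<And>m. smooth_on UNIV (g m)" and hom: "\<And>m c x. g m (c *\<^sub>R x) = c ^ m * g m x"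
  obtains F where "smooth_on UNIV F"
    "\<And>n. (\<lambda>x. F x - (\<Sum>m<n. g m x)) \<in> O[nhds 0](\<lambda>x. norm x ^ n)"
proof -
  define h where "h m x = g m x * bump x" for m x
  have h: "smooth_on UNIV (h m)" for m unfolding h_def[abs_def]
    by (intro smooth_on_mult g bump_smooth open_UNIV)
  have h0: "h m x = 0" if "norm x \<ge> 2" for m x using that by (simp add: h_def bump_eq_0)
  obtain G where G: "\<And>m x. \<bar>g m x\<bar> \<le> G m * norm x ^ m" using homogeneous_bound[OF g hom] by metis
  have "\<exists>C\<ge>1. 2 ^ m * \<bar>G m\<bar> \<le> C \<and>
      (\<forall>w. set w \<subseteq> Basis \<and> length w \<le> m \<longrightarrow> (\<forall>x. \<bar>word_deriv w (h m) x\<bar> \<le> C))" for m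
  proof -
    let ?W = "{w. set w \<subseteq> (Basis :: 'a set) \<and> length w \<le> m}"
    obtain C where C: "\<And>w x. \<bar>word_deriv w (h m) x\<bar> \<le> C w"
      using word_deriv_bounded[OF h, of 2 m] h0 by metis
    have fin: "finite ?W" by (rule finite_lists_length_le) simp
    have pos: "0 \<le> C w" for w using C[of w 0] by linarith
    have "C w \<le> (\<Sum>w\<in>?W. C w)" if "w \<in> ?W" for w
      by (rule member_le_sum[OF that pos fin])
    moreover have "0 \<le> (\<Sum>w\<in>?W. C w)" by (intro sum_nonneg pos)
    ultimately show ?thesis using C
      by (intro exI[of _ "1 + 2 ^ m * \<bar>G m\<bar> + (\<Sum>w\<in>?W. C w)"])
         (fastforce intro: order_trans add_increasing)
  qed
  then obtain C where C1: "\<And>m. C m \<ge> 1" and CG: "\<And>m. 2 ^ m * \<bar>G m\<bar> \<le> C m"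
    and CW: "\<And>m w x. set w \<subseteq> Basis \<Longrightarrow> length w \<le> m \<Longrightarrow> \<bar>word_deriv w (h m) x\<bar> \<le> C m" by metis
  \<comment> \<open>One factor \<open>inverse (\<mu> m)\<close> beats the bound \<open>C m\<close> and leaves \<open>(1/2) ^ m\<close>.\<close>
  define \<mu> where "\<mu> m = 2 ^ m * C m" for m
  have \<mu>1: "\<mu> m \<ge> 1" for m
    unfolding \<mu>_def using mult_mono[of 1 "2 ^ m" 1 "C m"] C1[of m] by simp
  have \<mu>0: "\<mu> m > 0" for m using \<mu>1[of m] by linarith
  have C\<mu>: "inverse (\<mu> m) * C m = (1/2) ^ m" for m
    using C1[of m] by (simp add: \<mu>_def power_one_over field_simps)
  have small: "inverse (\<mu> m) ^ m * \<mu> m ^ k * C m \<le> (1/2) ^ m" if "k < m" for m k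
  proof -
    have "inverse (\<mu> m) ^ m * \<mu> m ^ k = inverse (\<mu> m) ^ (m - k)"
      using that \<mu>0[of m] by (simp add: power_diff field_simps)
    also have "\<dots> \<le> inverse (\<mu> m) ^ 1"
      using that \<mu>1[of m] by (intro power_decreasing) (auto simp: inverse_le_1_iff)
    finally have "inverse (\<mu> m) ^ m * \<mu> m ^ k * C m \<le> inverse (\<mu> m) * C m"
      using C1[of m] by (intro mult_right_mono) auto
    then show ?thesis unfolding C\<mu> .
  qed
  define t where "t m x = inverse (\<mu> m) ^ m * h m (\<mu> m *\<^sub>R x)" for m x
  have t: "smooth_on UNIV (t m)" for m unfolding t_def[abs_def]
    by (intro smooth_on_mult smooth_on_const open_UNIV smooth_on_compose[OF _ _ _ h])
       (auto intro!: smooth_on_mult smooth_on_const smooth_on_linear bounded_linear_const_mult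
         bounded_linear_inner_left)
  have tb: "\<bar>word_deriv w (t m) x\<bar> \<le> (1/2) ^ m" if "set w \<subseteq> Basis" "length w < m" for w m x
  proof -
    have "\<bar>word_deriv w (t m) x\<bar> = inverse (\<mu> m) ^ m * \<mu> m ^ length w * \<bar>word_deriv w (h m) (\<mu> m *\<^sub>R x)\<bar>"
      unfolding t_def[abs_def] word_deriv_scale[OF h] using \<mu>0[of m] by (simp add: abs_mult)
    also have "\<dots> \<le> inverse (\<mu> m) ^ m * \<mu> m ^ length w * C m"
      using that \<mu>0[of m] by (intro mult_left_mono CW) auto
    also have "\<dots> \<le> (1/2) ^ m" using small[OF that(2)] .
    finally show ?thesis .
  qed
  have ev: "\<forall>\<^sub>F m in sequentially. \<forall>x. \<bar>word_deriv w (t m) x\<bar> \<le> (1/2) ^ m" if "set w \<subseteq> Basis" for w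
    using eventually_gt_at_top[of "length w"] by eventually_elim (use tb[OF that] in blast)
  note F = smooth_series[OF t ev]
  show thesis
  proof (rule that[OF F(1)])
    fix n
    \<comment> \<open>The terms beyond the degree \<open>n\<close> are small of order \<open>n\<close> with geometrically decreasing constants.\<close>
    have tn: "\<bar>t m x\<bar> \<le> (1/2) ^ m * norm x ^ n" if "n < m" for m x
    proof (cases "norm (\<mu> m *\<^sub>R x) \<ge> 2")
      case True
      then show ?thesis by (simp add: t_def h0)
    next
      case False
      let ?y = "\<mu> m *\<^sub>R x"
      have b: "\<bar>bump ?y\<bar> \<le> 1" unfolding bump_def using smooth_step_bounds by (simp add: abs_le_iff)
      have "\<bar>h m ?y\<bar> \<le> G m * norm ?y ^ m * 1"
        unfolding h_def abs_mult using G[of m ?y] b by (intro mult_mono) auto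
      also have "\<dots> \<le> \<bar>G m\<bar> * norm ?y ^ m" by (simp add: mult_right_mono)
      also have "norm ?y ^ m = norm ?y ^ n * norm ?y ^ (m - n)" using that by (simp flip: power_add)
      also have "\<bar>G m\<bar> * (norm ?y ^ n * norm ?y ^ (m - n)) \<le> \<bar>G m\<bar> * (norm ?y ^ n * 2 ^ m)"
      proof (intro mult_left_mono)
        have "norm ?y ^ (m - n) \<le> 2 ^ (m - n)" using False by (intro power_mono) auto
        also have "\<dots> \<le> (2::real) ^ m" by (intro power_increasing) auto
        finally show "norm ?y ^ (m - n) \<le> 2 ^ m" .
      qed auto
      also have "\<dots> = (2 ^ m * \<bar>G m\<bar>) * (\<mu> m ^ n * norm x ^ n)"
        using \<mu>0[of m] by (simp add: power_mult_distrib)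
      also have "\<dots> \<le> C m * (\<mu> m ^ n * norm x ^ n)"
        using \<mu>0[of m] by (intro mult_right_mono CG) auto
      finally have "\<bar>t m x\<bar> \<le> inverse (\<mu> m) ^ m * (C m * (\<mu> m ^ n * norm x ^ n))"
        unfolding t_def abs_mult using \<mu>0[of m] by (simp add: mult_left_mono)
      also have "\<dots> = (inverse (\<mu> m) ^ m * \<mu> m ^ n * C m) * norm x ^ n" by simp
      also have "\<dots> \<le> (1/2) ^ m * norm x ^ n" by (intro mult_right_mono small that) auto
      finally show ?thesis .
    qed
    \<comment> \<open>Close to the origin the cutoffs of the finitely many terms of degree at most \<open>n\<close> equal one.\<close>
    have near: "\<forall>\<^sub>F x in nhds 0. \<forall>m\<in>{..n}. t m x = g m x"
    proof (intro eventually_ball_finite ballI)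
      fix m
      have "\<forall>\<^sub>F x in nhds 0. x \<in> ball (0::'a) (1 / \<mu> m)"
        using \<mu>0[of m] by (intro eventually_nhds_in_open) auto
      then show "\<forall>\<^sub>F x in nhds 0. t m x = g m x"
      proof eventually_elim
        case (elim x)
        then have "norm (\<mu> m *\<^sub>R x) \<le> 1" using \<mu>0[of m] by (simp add: field_simps)
        then show ?case using \<mu>0[of m] by (simp add: t_def h_def bump_eq_1 hom power_inverse)
      qed
    qed auto
    show "(\<lambda>x. (\<Sum>m. t m x) - (\<Sum>m<n. g m x)) \<in> O[nhds 0](\<lambda>x. norm x ^ n)"
    proof (rule bigoI[where c = "G n + 2"])
      show "\<forall>\<^sub>F x in nhds 0. norm ((\<Sum>m. t m x) - (\<Sum>m<n. g m x)) \<le> (G n + 2) * norm (norm x ^ n)"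
        using near
      proof eventually_elim
        case (elim x)
        have sg: "summable (\<lambda>m. (1/2::real) ^ (m + Suc n) * norm x ^ n)"
          by (intro summable_mult2) (simp add: power_add summable_mult2 summable_geometric)
        have "(\<Sum>m. t m x) = (\<Sum>m. t (m + Suc n) x) + (\<Sum>m<Suc n. t m x)"
          by (rule suminf_split_initial_segment[OF F(2)])
        also have "(\<Sum>m<Suc n. t m x) = (\<Sum>m<n. g m x) + g n x" using elim by simp
        finally have "(\<Sum>m. t m x) - (\<Sum>m<n. g m x) = (\<Sum>m. t (m + Suc n) x) + g n x" by simp
        moreover have "\<bar>\<Sum>m. t (m + Suc n) x\<bar> \<le> (\<Sum>m. (1/2) ^ (m + Suc n) * norm x ^ n)"
          unfolding real_norm_def[symmetric] 
        proof (rule norm_suminf_le[OF _ sg])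
          show "norm (t (m + Suc n) x) \<le> (1/2) ^ (m + Suc n) * norm x ^ n" for m
            using tn[of "m + Suc n" x] by (simp only: real_norm_def)
        qed
        moreover have "(\<Sum>m. (1/2::real) ^ (m + Suc n) * norm x ^ n) \<le> 2 * norm x ^ n"
        proof -
          have "(\<Sum>m. (1/2::real) ^ (m + Suc n) * norm x ^ n) = (\<Sum>m. (1/2::real) ^ m * ((1/2) ^ Suc n * norm x ^ n))"
            by (simp add: power_add mult_ac)
          also have "\<dots> = 2 * ((1/2) ^ Suc n * norm x ^ n)"
            by (subst suminf_mult2[symmetric]) (auto simp: suminf_geometric summable_geometric)
          also have "\<dots> \<le> 2 * (1 * norm x ^ n)"
            by (intro mult_left_mono mult_right_mono power_le_one) auto
          finally show ?thesis by simp
        qed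
        ultimately show ?case using G[of n x] by (simp add: algebra_simps abs_if split: if_splits)
      qed
    qed
  qed
qed

section \<open>Flat and tame functions\<close>

definition small_near_zeros :: "('a::euclidean_space \<Rightarrow> real) \<Rightarrow> ('a \<Rightarrow> real) \<Rightarrow> bool" where
  "small_near_zeros \<omega> f \<longleftrightarrow>
     (\<forall>x. \<omega> x = 0 \<longrightarrow> f x = 0 \<and> (\<forall>n. f \<in> O[nhds x](\<lambda>y. \<omega> y ^ n)))"

text \<open>Here \<open>\<omega>\<close> measures the distance to a singular set, its set of zeros.  A
  flat function and all its derivatives decrease near the singular set faster than every power of
  \<open>\<omega>\<close>.  Derivatives are taken only off the singular set; differentiability at its points is a
  consequence (\<open>flat_smooth\<close>).\<close>

coinductive flat :: "('a::euclidean_space \<Rightarrow> real) \<Rightarrow> ('a \<Rightarrow> real) \<Rightarrow> bool" for \<omega> where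
  "small_near_zeros \<omega> f \<Longrightarrow> (\<forall>x\<in>{x. \<omega> x \<noteq> 0}. f differentiable (at x)) \<Longrightarrow>
   (\<forall>v. flat \<omega> (\<lambda>x. if \<omega> x = 0 then 0 else ddir v f x)) \<Longrightarrow> flat \<omega> f"

lemma flat_small: "flat \<omega> f \<Longrightarrow> small_near_zeros \<omega> f"
  by (erule flat.cases) auto

lemma flat_zero: "flat \<omega> f \<Longrightarrow> \<omega> x = 0 \<Longrightarrow> f x = 0"
  using flat_small by (auto simp: small_near_zeros_def)

lemma flat_bigo: "flat \<omega> f \<Longrightarrow> \<omega> x = 0 \<Longrightarrow> f \<in> O[nhds x](\<lambda>y. \<omega> y ^ n)"
  using flat_small unfolding small_near_zeros_def by blast

lemma flat_derivatives:
  assumes "flat \<omega> f" shows "derivatives_in {x. \<omega> x \<noteq> 0} (flat \<omega>) f"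
proof (rule derivatives_inI[where X = "flat \<omega>" and d = "\<lambda>v x. if \<omega> x = 0 then 0 else ddir v f x"])
  show "flat \<omega> (\<lambda>x. if \<omega> x = 0 then 0 else ddir v f x)" for v
    using assms by (auto elim: flat.cases)
  fix x assume x: "x \<in> {x. \<omega> x \<noteq> 0}"
  then have "f differentiable (at x)" using assms by (auto elim: flat.cases)
  then show "(f has_derivative (\<lambda>v. if \<omega> x = 0 then 0 else ddir v f x)) (at x)"
    using x frechet_derivative_works by auto
qed

lemma flat_coinduct:
  assumes "X f" and zero: "\<And>f x. X f \<Longrightarrow> \<omega> x = 0 \<Longrightarrow> f x = 0"
    and bigo: "\<And>f x n. X f \<Longrightarrow> \<omega> x = 0 \<Longrightarrow> f \<in> O[nhds x](\<lambda>y. \<omega> y ^ n)"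
    and deriv: "\<And>f. X f \<Longrightarrow> derivatives_in {x. \<omega> x \<noteq> 0} X f"
  shows "flat \<omega> f"
  using assms(1)
proof (coinduction arbitrary: f rule: flat.coinduct)
  case (flat f)
  obtain d where d: "\<And>x. x \<in> {x. \<omega> x \<noteq> 0} \<Longrightarrow> (f has_derivative (\<lambda>v. d v x)) (at x)" "\<And>v. X (d v)"
    using deriv[OF flat] by (metis derivatives_inE)
  have "(\<lambda>x. if \<omega> x = 0 then 0 else ddir v f x) = d v" for v
  proof
    fix x show "(if \<omega> x = 0 then 0 else ddir v f x) = d v x"
      using zero[OF d(2)] fun_cong[OF frechet_derivative_at[OF d(1)[of x]], of v] by auto
  qed
  with d(2) have "X (\<lambda>x. if \<omega> x = 0 then 0 else ddir v f x)" for v by simp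
  moreover have "\<forall>x\<in>{x. \<omega> x \<noteq> 0}. f differentiable (at x)"
    using d(1) unfolding differentiable_def by blast
  moreover have "small_near_zeros \<omega> f" using zero[OF flat] bigo[OF flat] by (simp add: small_near_zeros_def)
  ultimately show ?case by blast
qed

lemma has_derivative_zero_if_quadratic:
  fixes f :: "'a::euclidean_space \<Rightarrow> real"
  assumes "f \<in> O[nhds x](\<lambda>y. norm (y - x) ^ 2)"
  shows "(f has_derivative (\<lambda>v. 0)) (at x)"
proof -
  obtain C where C: "C > 0" "\<forall>\<^sub>F y in nhds x. \<bar>f y\<bar> \<le> C * norm (y - x) ^ 2"
    using assms by (elim landau_o.bigE) auto
  have fx: "f x = 0" using eventually_nhds_x_imp_x[OF C(2)] by simp
  have "((\<lambda>y. \<bar>f y\<bar> / norm (y - x)) \<longlongrightarrow> 0) (at x)"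
  proof (rule tendsto_sandwich[of "\<lambda>_. 0" _ _ "\<lambda>y. C * norm (y - x)"])
    show "\<forall>\<^sub>F y in at x. \<bar>f y\<bar> / norm (y - x) \<le> C * norm (y - x)"
      using eventually_nhds_conv_at[THEN iffD1, OF C(2)]
    proof (elim conjE eventually_mono)
      fix y assume "\<bar>f y\<bar> \<le> C * norm (y - x) ^ 2"
      then show "\<bar>f y\<bar> / norm (y - x) \<le> C * norm (y - x)"
        by (cases "y = x") (simp_all add: divide_le_eq power2_eq_square mult.assoc)
    qed
    show "((\<lambda>y. C * norm (y - x)) \<longlongrightarrow> 0) (at x)"
      by (auto intro!: tendsto_eq_intros)
  qed auto
  then show ?thesis
    unfolding has_derivative_iff_norm using fx by simp
qed

text \<open>Near a zero of \<open>\<omega>\<close> the function is quadratically small, hence differentiable there with derivative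
  zero; the derivatives are flat again.\<close>

lemma flat_smooth:
  assumes "\<And>x. \<omega> x = 0 \<Longrightarrow> \<omega> \<in> O[nhds x](\<lambda>y. norm (y - x))" and "flat \<omega> f"
  shows "smooth_on UNIV f"
proof (rule smooth_on_coinduct[where X = "flat \<omega>", OF open_UNIV assms(2)])
  fix f assume f: "flat \<omega> f"
  obtain d where d: "\<And>x. x \<in> {x. \<omega> x \<noteq> 0} \<Longrightarrow> (f has_derivative (\<lambda>v. d v x)) (at x)" "\<And>v. flat \<omega> (d v)"
    using flat_derivatives[OF f] by (metis derivatives_inE)
  have "(f has_derivative (\<lambda>v. d v x)) (at x)" for x
  proof (cases "\<omega> x = 0")
    case True
    have "(\<lambda>y. \<omega> y ^ 2) \<in> O[nhds x](\<lambda>y. norm (y - x) ^ 2)"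
      by (rule landau_o.big_power[OF assms(1)[OF True]])
    then have "f \<in> O[nhds x](\<lambda>y. norm (y - x) ^ 2)"
      using flat_bigo[OF f True, of 2] landau_o.big_trans by blast
    from has_derivative_zero_if_quadratic[OF this] show ?thesis
      using flat_zero[OF d(2) True] by simp
  qed (use d(1) in simp)
  then show "derivatives_in UNIV (flat \<omega>) f"
    by (rule derivatives_inI[where X = "flat \<omega>" and d = d, OF _ d(2)])
qed

text \<open>Functions with singularities of at most polynomial order in \<open>1 / \<omega>\<close>.  Compositions are admitted only
  with a bounded inner function: the values of \<open>g\<close> are then bounded, while the inner derivatives still
  contribute poles.\<close>

inductive tame :: "('a::euclidean_space \<Rightarrow> real) \<Rightarrow> ('a \<Rightarrow> real) \<Rightarrow> bool" for \<omega> where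
  smooth: "smooth_on UNIV f \<Longrightarrow> tame \<omega> f"
| inverse: "tame \<omega> (\<lambda>x. inverse (\<omega> x))"
| add: "tame \<omega> f \<Longrightarrow> tame \<omega> g \<Longrightarrow> tame \<omega> (\<lambda>x. f x + g x)"
| mult: "tame \<omega> f \<Longrightarrow> tame \<omega> g \<Longrightarrow> tame \<omega> (\<lambda>x. f x * g x)"
| compose: "tame \<omega> r \<Longrightarrow> (\<And>x. \<omega> x = 0 \<Longrightarrow> r \<in> O[nhds x](\<lambda>_. 1)) \<Longrightarrow> smooth_on UNIV g \<Longrightarrow>
    tame \<omega> (\<lambda>x. g (r x))"

lemma isCont_bigo_1: "isCont f x \<Longrightarrow> f \<in> O[nhds x](\<lambda>_. 1)" for f :: "'a::t2_space \<Rightarrow> real"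
  unfolding isCont_def tendsto_at_iff_tendsto_nhds
  by (rule bigoI_tendsto[where c = "f x"]) auto

lemma smooth_bigo_1: "smooth_on UNIV f \<Longrightarrow> f \<in> O[nhds x](\<lambda>_. 1)"
  by (rule isCont_bigo_1) (auto intro: smooth_on_isCont)

lemma tame_bigo:
  assumes \<omega>: "smooth_on UNIV \<omega>" and f: "tame \<omega> f" and x: "\<omega> x = 0"
  shows "\<exists>n. (\<lambda>y. f y * \<omega> y ^ n) \<in> O[nhds x](\<lambda>_. 1)"
proof -
  have pow: "(\<lambda>y. \<omega> y ^ n) \<in> O[nhds x](\<lambda>_. 1)" for n
    by (rule smooth_bigo_1) (intro smooth_on_power \<omega> open_UNIV)
  have mult: "(\<lambda>y. p y * q y) \<in> O[nhds x](\<lambda>_. 1)"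
    if "p \<in> O[nhds x](\<lambda>_. 1)" "q \<in> O[nhds x](\<lambda>_. 1)" for p q :: "'a \<Rightarrow> real"
    using landau_o.big.mult[OF that] by simp
  show ?thesis using f
  proof induction
    case (smooth f)
    show ?case using smooth_bigo_1[OF smooth] by (intro exI[of _ 0]) simp
  next
    case inverse
    have "(\<lambda>y. inverse (\<omega> y) * \<omega> y ^ 1) \<in> O[nhds x](\<lambda>_. 1)"
    proof (rule bigoI[where c = 1])
      have "\<bar>inverse a * a\<bar> \<le> 1" for a :: real by (cases "a = 0") auto
      then show "\<forall>\<^sub>F y in nhds x. norm (inverse (\<omega> y) * \<omega> y ^ 1) \<le> 1 * norm (1 :: real)" by simp
    qed
    then show ?case by blast
  next
    case (add f g)
    then obtain n m where nm: "(\<lambda>y. f y * \<omega> y ^ n) \<in> O[nhds x](\<lambda>_. 1)" "(\<lambda>y. g y * \<omega> y ^ m) \<in> O[nhds x](\<lambda>_. 1)"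
      by blast
    show ?case
      using sum_in_bigo(1)[OF mult[OF nm(1) pow[of m]] mult[OF nm(2) pow[of n]]]
      by (intro exI[of _ "n + m"]) (simp add: power_add algebra_simps)
  next
    case (mult f g)
    then obtain n m where nm: "(\<lambda>y. f y * \<omega> y ^ n) \<in> O[nhds x](\<lambda>_. 1)" "(\<lambda>y. g y * \<omega> y ^ m) \<in> O[nhds x](\<lambda>_. 1)"
      by blast
    show ?case
      using \<open>\<And>p q. p \<in> O[nhds x](\<lambda>_. 1) \<Longrightarrow> q \<in> O[nhds x](\<lambda>_. 1) \<Longrightarrow> (\<lambda>y. p y * q y) \<in> O[nhds x](\<lambda>_. 1)\<close>[OF nm]
      by (intro exI[of _ "n + m"]) (simp add: power_add mult_ac)
  next
    case (compose r g)
    obtain C where C: "\<forall>\<^sub>F y in nhds x. \<bar>r y\<bar> \<le> C"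
      using compose.hyps(2)[OF x] by (elim landau_o.bigE) auto
    have "continuous_on (cball 0 C) g"
      by (intro continuous_at_imp_continuous_on ballI smooth_on_isCont[OF compose.hyps(3)]) simp
    from compact_imp_bounded[OF compact_continuous_image[OF this compact_cball]]
    obtain B where B: "\<forall>y\<in>g ` cball 0 C. norm y \<le> B" unfolding bounded_iff by blast
    have "(\<lambda>y. g (r y)) \<in> O[nhds x](\<lambda>_. 1)"
      by (rule bigoI[where c = B], rule eventually_mono[OF C]) (use B in auto)
    then show ?case by (intro exI[of _ 0]) simp
  qed
qed

lemma tame_derivatives:
  assumes \<omega>: "smooth_on UNIV \<omega>" and "tame \<omega> f"
  shows "derivatives_in {x. \<omega> x \<noteq> 0} (tame \<omega>) f"
  using assms(2)
proof induction
  case (smooth f)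
  show ?case
    by (rule derivatives_inI[where X = "tame \<omega>" and d = "\<lambda>v. ddir v f"])
       (auto intro: smooth_on_has_derivative[OF smooth] tame.smooth smooth_on_ddir[OF smooth])
next
  case inverse
  let ?d = "\<lambda>v x. - 1 * (inverse (\<omega> x) * ddir v \<omega> x * inverse (\<omega> x))"
  show ?case
  proof (rule derivatives_inI[where X = "tame \<omega>" and d = ?d])
    show "((\<lambda>x. inverse (\<omega> x)) has_derivative (\<lambda>v. ?d v x)) (at x)" if "x \<in> {x. \<omega> x \<noteq> 0}" for x
      using Deriv.has_derivative_inverse[OF _ smooth_on_has_derivative[OF \<omega>, of x]] that by simp
    show "tame \<omega> (?d v)" for v
      by (intro tame.mult tame.inverse tame.smooth[OF smooth_on_const] tame.smooth[OF smooth_on_ddir[OF \<omega>]])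
  qed
next
  case (add f g)
  then show ?case by (intro derivatives_in_add[where X = "tame \<omega>"] tame.add)
next
  case (mult f g)
  then show ?case
    by (intro derivatives_in_mult[where X = "tame \<omega>" and Y = "tame \<omega>"] tame.add tame.mult)
next
  case (compose r g)
  obtain d where d: "\<And>x. x \<in> {x. \<omega> x \<noteq> 0} \<Longrightarrow> (r has_derivative (\<lambda>v. d v x)) (at x)" "\<And>v. tame \<omega> (d v)"
    using compose.IH by (metis derivatives_inE)
  let ?d = "\<lambda>v x. ddir 1 g (r x) * d v x"
  show ?case
  proof (rule derivatives_inI[where X = "tame \<omega>" and d = ?d])
    fix x assume x: "x \<in> {x. \<omega> x \<noteq> 0}"
    have g: "(g has_derivative frechet_derivative g (at (r x))) (at (r x))"
      using compose.hyps(3) by (rule smooth_on_has_derivative) simp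
    have lin: "frechet_derivative g (at (r x)) y = ddir 1 g (r x) * y" for y
      using linear_component_sum[OF has_derivative_linear[OF g], of y] by simp
    show "((\<lambda>x. g (r x)) has_derivative (\<lambda>v. ?d v x)) (at x)"
      by (rule has_derivative_eq_rhs[OF has_derivative_compose[OF d(1)[OF x] g] ext]) (rule lin)
  next
    show "tame \<omega> (?d v)" for v
      by (intro tame.mult d(2) tame.compose[OF compose.hyps(1,2) smooth_on_ddir[OF compose.hyps(3)]])
  qed
qed

inductive flat_tame :: "('a::euclidean_space \<Rightarrow> real) \<Rightarrow> ('a \<Rightarrow> real) \<Rightarrow> bool" for \<omega> where
  prod: "flat \<omega> f \<Longrightarrow> tame \<omega> m \<Longrightarrow> flat_tame \<omega> (\<lambda>x. f x * m x)"
| add: "flat_tame \<omega> f \<Longrightarrow> flat_tame \<omega> g \<Longrightarrow> flat_tame \<omega> (\<lambda>x. f x + g x)"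

lemma bigo_flat_times_tame:
  assumes "smooth_on UNIV \<omega>" "tame \<omega> m" "\<omega> x = 0" "\<And>n. f \<in> O[nhds x](\<lambda>y. \<omega> y ^ n)"
  shows "(\<lambda>y. f y * m y) \<in> O[nhds x](\<lambda>y. \<omega> y ^ n)"
proof -
  obtain k where k: "(\<lambda>y. m y * \<omega> y ^ k) \<in> O[nhds x](\<lambda>_. 1)" using tame_bigo[OF assms(1-3)] by blast
  have "(\<lambda>y. f y * m y) \<in> O[nhds x](\<lambda>y. \<omega> y ^ (n + k) * m y)"
    by (rule landau_o.big.mult[OF assms(4) landau_o.big_refl])
  also have "(\<lambda>y. \<omega> y ^ (n + k) * m y) = (\<lambda>y. \<omega> y ^ n * (m y * \<omega> y ^ k))"
    by (simp add: power_add mult_ac)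
  also have "(\<lambda>y. \<omega> y ^ n * (m y * \<omega> y ^ k)) \<in> O[nhds x](\<lambda>y. \<omega> y ^ n * 1)"
    by (rule landau_o.big.mult[OF landau_o.big_refl k])
  finally show ?thesis by simp
qed

text \<open>Infinite order of vanishing beats a pole of finite order, and by the product rule this persists
  under differentiation.\<close>

lemma flat_times_tame:
  assumes \<omega>: "smooth_on UNIV \<omega>" and "flat \<omega> f" "tame \<omega> m"
  shows "flat \<omega> (\<lambda>x. f x * m x)"
proof (rule flat_coinduct[where X = "flat_tame \<omega>", OF flat_tame.prod[OF assms(2,3)]])
  show "f x = 0" if "flat_tame \<omega> f" "\<omega> x = 0" for f x
    using that by induction (auto simp: flat_zero)
  show "f \<in> O[nhds x](\<lambda>y. \<omega> y ^ n)" if "flat_tame \<omega> f" "\<omega> x = 0" for f x n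
    using that by induction (auto intro: bigo_flat_times_tame[OF \<omega>] flat_bigo sum_in_bigo)
  fix f assume "flat_tame \<omega> f"
  then show "derivatives_in {x. \<omega> x \<noteq> 0} (flat_tame \<omega>) f"
  proof induction
    case (prod f m)
    show ?case
      by (rule derivatives_in_mult[OF flat_derivatives[OF prod(1)] tame_derivatives[OF \<omega> prod(2)]])
         (intro flat_tame.intros prod)
  next
    case (add f g)
    then show ?case by (intro derivatives_in_add[where X = "flat_tame \<omega>"] flat_tame.add)
  qed
qed

section \<open>Lifting flat invariant functions through two invariants\<close>

definition flat_at_0 :: "('a::euclidean_space \<Rightarrow> real) \<Rightarrow> bool" where
  "flat_at_0 f \<longleftrightarrow> smooth_on UNIV f \<and> (\<forall>n. f \<in> O[nhds 0](\<lambda>x. norm x ^ n))"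

text \<open>Smallness of a function passes to its derivative by interpolation with the bounded second
  derivative: a difference quotient of step \<open>h = norm x ^ (n + 1)\<close> has size at most a multiple of
  \<open>h\<close>, because the function is of order \<open>h\<^sup>2\<close>, and it differs from the derivative by a multiple of \<open>h\<close>.\<close>

lemma flat_at_0_ddir:
  fixes f :: "'a::euclidean_space \<Rightarrow> real"
  assumes f: "flat_at_0 f" shows "flat_at_0 (ddir v f)"
proof -
  have sm: "smooth_on UNIV f" using f by (simp add: flat_at_0_def)
  have "ddir v f \<in> O[nhds 0](\<lambda>x. norm x ^ n)" for n
  proof -
    obtain C where C: "C > 0" "\<forall>\<^sub>F y in nhds 0. \<bar>f y\<bar> \<le> C * norm y ^ (2 * Suc n)"
      using f unfolding flat_at_0_def by (elim conjE allE[of _ "2 * Suc n"] landau_o.bigE) auto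
    obtain M where M: "M > 0" "\<forall>\<^sub>F y in nhds 0. \<bar>ddir v (ddir v f) y\<bar> \<le> M"
      using smooth_bigo_1[OF smooth_on_ddir[OF smooth_on_ddir[OF sm]], of v v 0] by (elim landau_o.bigE) auto
    have "\<forall>\<^sub>F y in nhds 0. \<bar>f y\<bar> \<le> C * norm y ^ (2 * Suc n) \<and> \<bar>ddir v (ddir v f) y\<bar> \<le> M"
      by (rule eventually_conj[OF C(2) M(2)])
    then obtain d where d: "d > 0"
      "\<And>y. norm y < d \<Longrightarrow> \<bar>f y\<bar> \<le> C * norm y ^ (2 * Suc n) \<and> \<bar>ddir v (ddir v f) y\<bar> \<le> M"
      unfolding eventually_nhds_metric by auto
    define K where "K = 1 + norm v"
    have K: "K \<ge> 1" by (simp add: K_def)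
    define B where "B = C * K ^ (2 * Suc n) + C + M"
    have main: "\<bar>ddir v f x\<bar> \<le> B * norm x ^ n" if x: "norm x < min 1 (d / K)" "x \<noteq> 0" for x
    proof -
      let ?h = "norm x ^ Suc n"
      have h: "?h > 0" "?h \<le> norm x"
        using x power_decreasing[of 1 "Suc n" "norm x"] by (auto simp: less_imp_le)
      have near: "norm (x + s *\<^sub>R v) \<le> K * norm x" if "0 \<le> s" "s \<le> ?h" for s
      proof -
        have "norm (x + s *\<^sub>R v) \<le> norm x + s * norm v" using norm_triangle_ineq[of x "s *\<^sub>R v"] that by simp
        also have "s * norm v \<le> norm x * norm v" using that h by (intro mult_right_mono) auto
        finally show ?thesis by (simp add: K_def algebra_simps)
      qed
      have Kd: "K * norm x < d" using x K by (simp add: field_simps)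
      have near': "norm (x + s *\<^sub>R v) < d" if "0 \<le> s" "s \<le> ?h" for s
        using near[OF that] Kd by linarith
      obtain s where s: "0 < s" "s < ?h" "f (x + ?h *\<^sub>R v) - f (x + 0 *\<^sub>R v) = (?h - 0) * ddir v f (x + s *\<^sub>R v)"
        using MVT2[of 0 ?h "\<lambda>s. f (x + s *\<^sub>R v)" "\<lambda>s. ddir v f (x + s *\<^sub>R v)"] h
          smooth_on_line_derivative[OF sm] by blast
      obtain r where r: "0 < r" "r < s"
        "ddir v f (x + s *\<^sub>R v) - ddir v f (x + 0 *\<^sub>R v) = (s - 0) * ddir v (ddir v f) (x + r *\<^sub>R v)"
        using MVT2[of 0 s "\<lambda>s. ddir v f (x + s *\<^sub>R v)" "\<lambda>s. ddir v (ddir v f) (x + s *\<^sub>R v)"] s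
          smooth_on_line_derivative[OF smooth_on_ddir[OF sm]] by blast
      have "\<bar>f (x + ?h *\<^sub>R v)\<bar> \<le> C * norm (x + ?h *\<^sub>R v) ^ (2 * Suc n)"
        using d(2)[OF near'[of ?h]] h by simp
      also have "\<dots> \<le> C * (K * norm x) ^ (2 * Suc n)"
        using C near[of ?h] h by (intro mult_left_mono power_mono) auto
      finally have f1: "\<bar>f (x + ?h *\<^sub>R v)\<bar> \<le> C * K ^ (2 * Suc n) * (?h * ?h)"
        by (simp add: power_mult_distrib power_mult power2_eq_square mult_ac power_even_eq)
      have f0: "\<bar>f x\<bar> \<le> C * (?h * ?h)"
        using d(2)[OF near'[of 0]] h by (simp add: power_mult power2_eq_square mult_ac power_even_eq)
      have "?h * \<bar>ddir v f (x + s *\<^sub>R v)\<bar> = \<bar>f (x + ?h *\<^sub>R v) - f x\<bar>"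
        using s(3) h by (simp add: abs_mult)
      also have "\<dots> \<le> ?h * ((C * K ^ (2 * Suc n) + C) * ?h)"
        using f1 f0 by (simp add: algebra_simps)
      finally have "\<bar>ddir v f (x + s *\<^sub>R v)\<bar> \<le> (C * K ^ (2 * Suc n) + C) * ?h"
        using h by (simp add: mult_le_cancel_left_pos)
      moreover have "\<bar>ddir v f (x + s *\<^sub>R v) - ddir v f x\<bar> \<le> ?h * M"
        using r s d(2)[OF near'[of r]] by (simp add: abs_mult) (intro mult_mono; simp)
      ultimately have "\<bar>ddir v f x\<bar> \<le> (C * K ^ (2 * Suc n) + C) * ?h + ?h * M" by linarith
      also have "\<dots> = B * ?h" by (simp add: B_def algebra_simps)
      also have "\<dots> \<le> B * norm x ^ n"
        using C M K x by (intro mult_left_mono power_decreasing) (auto simp: B_def)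
      finally show ?thesis .
    qed
    have at0: "\<bar>ddir v f 0\<bar> \<le> B * norm (0::'a) ^ n"
    proof -
      have "f \<in> O[nhds 0](\<lambda>y. norm (y - 0) ^ 2)" using f by (auto simp: flat_at_0_def)
      from frechet_derivative_at[OF has_derivative_zero_if_quadratic[OF this]]
      have 0: "ddir v f 0 = 0" by metis
      show ?thesis
      proof (cases n)
        case 0
        with \<open>ddir v f 0 = 0\<close> show ?thesis using C M K by (auto simp: B_def)
      next
        case (Suc k)
        with 0 show ?thesis by simp
      qed
    qed
    have "\<forall>\<^sub>F x in nhds 0. x \<in> ball 0 (min 1 (d / K))"
      using d(1) K by (intro eventually_nhds_in_open) auto
    then have "\<forall>\<^sub>F x in nhds 0. norm (ddir v f x) \<le> B * norm (norm x ^ n)"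
      by eventually_elim (use main at0 in \<open>force simp: dist_norm\<close>)
    then show ?thesis by (rule bigoI)
  qed
  then show ?thesis using smooth_on_ddir[OF sm] by (auto simp: flat_at_0_def)
qed

lemma flat_at_0_zero: "flat_at_0 f \<Longrightarrow> f 0 = 0"
proof -
  assume "flat_at_0 f"
  then have "f \<in> O[nhds 0](\<lambda>x. norm x ^ 1)" unfolding flat_at_0_def by blast
  then obtain C where "\<forall>\<^sub>F y in nhds 0. \<bar>f y\<bar> \<le> C * norm y" by (elim landau_o.bigE) auto
  from eventually_nhds_x_imp_x[OF this] show ?thesis by simp
qed

lemma flat_at_0_bigo_inner: "flat_at_0 f \<Longrightarrow> f \<in> O[nhds 0](\<lambda>x. (x \<bullet> x) ^ n)"
  unfolding flat_at_0_def dot_square_norm power_mult[symmetric] by blast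

lemma flat_at_0_flat: "flat_at_0 f \<Longrightarrow> flat (\<lambda>x. x \<bullet> x) f"
proof (rule flat_coinduct[where X = flat_at_0])
  fix f :: "'a \<Rightarrow> real" assume f: "flat_at_0 f"
  show "derivatives_in {x. x \<bullet> x \<noteq> 0} flat_at_0 f"
  proof (rule derivatives_inI[where X = flat_at_0 and d = "\<lambda>v. ddir v f"])
    show "(f has_derivative (\<lambda>v. ddir v f x)) (at x)" for x
      by (rule smooth_on_has_derivative[of UNIV]) (use f in \<open>simp_all add: flat_at_0_def\<close>)
  qed (rule flat_at_0_ddir[OF f])
qed (auto simp: flat_at_0_zero flat_at_0_bigo_inner)

lemma inner_self_bigo: "(\<lambda>x. x \<bullet> x) \<in> O[nhds 0](\<lambda>y::'a::euclidean_space. norm (y - 0))"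
proof (rule bigoI[where c = 1])
  have "\<forall>\<^sub>F x in nhds 0. x \<in> ball (0::'a) 1" by (intro eventually_nhds_in_open) auto
  then show "\<forall>\<^sub>F x in nhds 0. norm (x \<bullet> x) \<le> 1 * norm (norm (x - (0::'a)))"
    by eventually_elim (auto simp: dot_square_norm power2_eq_square mult_left_le)
qed

lemma flat_inner_flat_at_0: "flat (\<lambda>x. x \<bullet> x) f \<Longrightarrow> flat_at_0 f"
proof -
  assume f: "flat (\<lambda>x. x \<bullet> x) f"
  have "smooth_on UNIV f"
    by (rule flat_smooth[OF _ f]) (use inner_self_bigo in auto)
  moreover have "f \<in> O[nhds 0](\<lambda>x. norm x ^ n)" for n
  proof -
    have "f \<in> O[nhds 0](\<lambda>y. (y \<bullet> y) ^ n)" by (rule flat_bigo[OF f]) simp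
    also have "(\<lambda>y::'a. (y \<bullet> y) ^ n) \<in> O[nhds 0](\<lambda>y. norm (y - 0) ^ n)"
      by (rule landau_o.big_power[OF inner_self_bigo])
    finally show ?thesis by simp
  qed
  ultimately show ?thesis by (simp add: flat_at_0_def)
qed

lemma flat_at_0_times_tame:
  "flat_at_0 f \<Longrightarrow> tame (\<lambda>x. x \<bullet> x) m \<Longrightarrow> flat_at_0 (\<lambda>x. f x * m x)"
  by (rule flat_inner_flat_at_0[OF flat_times_tame[OF smooth_on_inner_self flat_at_0_flat]])

lemma flat_at_0_times_smooth:
  "flat_at_0 f \<Longrightarrow> smooth_on UNIV m \<Longrightarrow> flat_at_0 (\<lambda>x. f x * m x)"
  by (rule flat_at_0_times_tame[OF _ tame.smooth])

lemma flat_at_0_sum: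
  "finite I \<Longrightarrow> (\<And>i. i \<in> I \<Longrightarrow> flat_at_0 (f i)) \<Longrightarrow> flat_at_0 (\<lambda>x. \<Sum>i\<in>I. f i x)"
  unfolding flat_at_0_def by (auto intro: smooth_on_sum big_sum_in_bigo)

definition scale2 :: "complex \<Rightarrow> complex \<times> complex \<Rightarrow> complex \<times> complex" where
  "scale2 \<zeta> z = (\<zeta> * fst z, \<zeta> * snd z)"

definition cube_invariant :: "(complex \<times> complex \<Rightarrow> real) \<Rightarrow> bool" where
  "cube_invariant h \<longleftrightarrow> (\<forall>\<zeta> z. \<zeta> ^ 3 = 1 \<longrightarrow> h (scale2 \<zeta> z) = h z)"

text \<open>The support is confined to a cone around the line \<open>snd z = 0\<close>, where \<open>norm z\<close> is bounded by a
  multiple of \<open>cmod (fst z)\<close>; there \<open>fst z\<close> controls everything.\<close>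

definition liftable :: "(complex \<times> complex \<Rightarrow> real) \<Rightarrow> bool" where
  "liftable h \<longleftrightarrow> flat_at_0 h \<and> cube_invariant h \<and>
     (\<forall>z. cmod (snd z) > 2 * cmod (fst z) \<longrightarrow> h z = 0)"

lemma liftable_cone: "liftable h \<Longrightarrow> cmod (snd z) > 2 * cmod (fst z) \<Longrightarrow> h z = 0"
  unfolding liftable_def by blast

definition root_point :: "complex \<times> complex \<Rightarrow> complex \<times> complex" where
  "root_point c = (fst c powr (1/3), fst c powr (1/3) * snd c / fst c)"

text \<open>The map \<open>z \<mapsto> (fst z ^ 3, fst z ^ 2 * snd z)\<close> has \<open>root_point\<close> as a section off \<open>fst c = 0\<close>, and
  invariance makes the value independent of the choice of the cube root.\<close>

definition lift :: "(complex \<times> complex \<Rightarrow> real) \<Rightarrow> complex \<times> complex \<Rightarrow> real" where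
  "lift h c = (if fst c = 0 then 0 else h (root_point c))"

lemma cube_root_cubed: "c \<noteq> 0 \<Longrightarrow> (c powr (1/3)) ^ 3 = (c::complex)"
  by (simp add: powr_def exp_of_nat_mult[symmetric])

text \<open>An arbitrary cube root may replace the principal one, which is discontinuous along a ray.\<close>

lemma cube_invariant_root:
  assumes h: "cube_invariant h" and w: "w ^ 3 = fst c" and c: "fst c \<noteq> 0"
  shows "lift h c = h (w, w * snd c / fst c)"
proof -
  let ?r = "fst c powr (1/3)"
  have r: "?r ^ 3 = fst c" by (rule cube_root_cubed[OF c])
  have w0: "w \<noteq> 0" using w c by auto
  have "(?r / w) ^ 3 = 1" using r w c by (simp add: power_divide)
  then have "h (scale2 (?r / w) (w, w * snd c / fst c)) = h (w, w * snd c / fst c)"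
    using h by (simp add: cube_invariant_def)
  moreover have "scale2 (?r / w) (w, w * snd c / fst c) = root_point c"
    using w0 by (simp add: scale2_def root_point_def)
  ultimately show ?thesis using c by (simp add: lift_def)
qed

lemma lift_eq:
  assumes "liftable h" shows "lift h (fst z ^ 3, fst z ^ 2 * snd z) = h z"
proof (cases "fst z = 0")
  case True
  have "h z = 0"
  proof (cases "snd z = 0")
    case True
    with \<open>fst z = 0\<close> have "z = 0" by (simp add: prod_eq_iff)
    then show ?thesis using assms flat_at_0_zero by (auto simp: liftable_def)
  qed (use liftable_cone[OF assms] True in simp)
  with True show ?thesis by (simp add: lift_def)
next
  case False
  have "lift h (fst z ^ 3, fst z ^ 2 * snd z) = h (fst z, fst z * (fst z ^ 2 * snd z) / fst z ^ 3)"
    using cube_invariant_root[of h "fst z" "(fst z ^ 3, fst z ^ 2 * snd z)"] assms False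
    by (simp add: liftable_def)
  also have "fst z * (fst z ^ 2 * snd z) / fst z ^ 3 = snd z"
    using False by (simp add: power3_eq_cube power2_eq_square)
  finally show ?thesis by simp
qed

text \<open>Vector fields of this form commute with the cyclic group, so they map liftable functions to
  liftable functions.\<close>

definition field2 :: "complex \<Rightarrow> complex \<Rightarrow> complex \<Rightarrow> complex \<times> complex \<Rightarrow> complex \<times> complex" where
  "field2 p q r z = (p * fst z, q * snd z + r * fst z)"

lemma bounded_linear_field2: "bounded_linear (field2 p q r)"
  unfolding field2_def[abs_def]
  by (intro bounded_linear_Pair bounded_linear_add bounded_linear_const_mult bounded_linear_fst bounded_linear_snd)

lemma bounded_linear_scale2: "bounded_linear (scale2 \<zeta>)"
  unfolding scale2_def[abs_def]
  by (intro bounded_linear_Pair bounded_linear_const_mult bounded_linear_fst bounded_linear_snd)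

lemma liftable_field2:
  assumes h: "liftable h"
  shows "liftable (\<lambda>z. frechet_derivative h (at z) (field2 p q r z))"
proof -
  let ?A = "field2 p q r"
  have fl: "flat_at_0 h" and inv: "cube_invariant h"
    and cone: "\<And>z. cmod (snd z) > 2 * cmod (fst z) \<Longrightarrow> h z = 0"
    using h by (auto simp: liftable_def)
  have sm: "smooth_on UNIV h" using fl by (simp add: flat_at_0_def)
  have D: "(h has_derivative frechet_derivative h (at z)) (at z)" for z
    using sm by (rule smooth_on_has_derivative) simp
  have "(\<lambda>z. frechet_derivative h (at z) (?A z)) = (\<lambda>z. \<Sum>b\<in>Basis. ddir b h z * (?A z \<bullet> b))"
  proof
    fix z show "frechet_derivative h (at z) (?A z) = (\<Sum>b\<in>Basis. ddir b h z * (?A z \<bullet> b))"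
      using linear_component_sum[OF has_derivative_linear[OF D], of z "?A z"] by (simp add: mult.commute)
  qed
  moreover have "flat_at_0 (\<lambda>z. \<Sum>b\<in>Basis. ddir b h z * (?A z \<bullet> b))"
    by (intro flat_at_0_sum flat_at_0_times_smooth flat_at_0_ddir fl smooth_on_linear finite_Basis
        bounded_linear_compose[OF bounded_linear_inner_left bounded_linear_field2])
  ultimately have "flat_at_0 (\<lambda>z. frechet_derivative h (at z) (?A z))" by simp
  moreover have "cube_invariant (\<lambda>z. frechet_derivative h (at z) (?A z))"
    unfolding cube_invariant_def
  proof (intro allI impI)
    fix \<zeta> z assume \<zeta>: "(\<zeta>::complex) ^ 3 = 1"
    have "((\<lambda>z. h (scale2 \<zeta> z)) has_derivative (\<lambda>v. frechet_derivative h (at (scale2 \<zeta> z)) (scale2 \<zeta> v))) (at z)"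
      by (rule has_derivative_compose[OF bounded_linear_imp_has_derivative[OF bounded_linear_scale2] D])
    moreover have "(\<lambda>z. h (scale2 \<zeta> z)) = h" using inv \<zeta> by (auto simp: cube_invariant_def)
    ultimately have "frechet_derivative h (at z) = (\<lambda>v. frechet_derivative h (at (scale2 \<zeta> z)) (scale2 \<zeta> v))"
      by (metis frechet_derivative_at)
    moreover have "scale2 \<zeta> (?A z) = ?A (scale2 \<zeta> z)"
      by (simp add: scale2_def field2_def algebra_simps)
    ultimately show "frechet_derivative h (at (scale2 \<zeta> z)) (?A (scale2 \<zeta> z)) = frechet_derivative h (at z) (?A z)"
      by metis
  qed
  moreover have "frechet_derivative h (at z) (?A z) = 0" if "cmod (snd z) > 2 * cmod (fst z)" for z
  proof -
    have "open {z :: complex \<times> complex. 2 * cmod (fst z) < cmod (snd z)}"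
      by (intro open_Collect_less continuous_intros)
    from has_derivative_transform_within_open[OF has_derivative_const[of 0] this, of z h]
    have "(h has_derivative (\<lambda>v. 0)) (at z)" using cone that by simp
    then show ?thesis by (metis frechet_derivative_at)
  qed
  ultimately show ?thesis by (simp add: liftable_def)
qed

abbreviation first_sq :: "complex \<times> complex \<Rightarrow> real" where
  "first_sq \<equiv> (\<lambda>c. fst c \<bullet> fst c)"

lemma smooth_on_first_sq: "smooth_on UNIV first_sq"
proof -
  have "smooth_on UNIV (\<lambda>c :: complex \<times> complex. (fst c \<bullet> 1) * (fst c \<bullet> 1) + (fst c \<bullet> \<i>) * (fst c \<bullet> \<i>))"
    by (intro smooth_on_add smooth_on_mult smooth_on_linear open_UNIV
        bounded_linear_compose[OF bounded_linear_inner_left bounded_linear_fst])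
  moreover have "first_sq = (\<lambda>c. (fst c \<bullet> 1) * (fst c \<bullet> 1) + (fst c \<bullet> \<i>) * (fst c \<bullet> \<i>))"
    by (simp add: inner_complex_def)
  ultimately show ?thesis by simp
qed

text \<open>In the coordinates of \<open>z\<close>, moving \<open>c\<close> means moving along the linear vector fields \<open>field2\<close>, with
  coefficients that have a simple pole along \<open>fst c = 0\<close>.  So the derivatives of a lift are again
  combinations of lifts with tame coefficients.\<close>

lemma lift_has_derivative:
  assumes h: "liftable h" and c: "fst c \<noteq> 0"
  shows "(lift h has_derivative (\<lambda>v.
     Re (fst v / fst c) * lift (\<lambda>z. frechet_derivative h (at z) (field2 (1/3) (-2/3) 0 z)) c +
     Im (fst v / fst c) * lift (\<lambda>z. frechet_derivative h (at z) (field2 (\<i>/3) (-2*\<i>/3) 0 z)) c +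
     Re (snd v / fst c) * lift (\<lambda>z. frechet_derivative h (at z) (field2 0 0 1 z)) c +
     Im (snd v / fst c) * lift (\<lambda>z. frechet_derivative h (at z) (field2 0 0 \<i> z)) c)) (at c)"
proof -
  let ?w0 = "fst c powr (1/3)"
  \<comment> \<open>A branch of the cube root of \<open>fst e\<close> that is differentiable at the given point \<open>c\<close>.\<close>
  define w where "w e = ?w0 * exp (Ln (fst e / fst c) / 3)" for e :: "complex \<times> complex"
  define U where "U = {e :: complex \<times> complex. fst e \<noteq> 0}"
  have U: "open U" "c \<in> U" using c by (auto simp: U_def intro!: open_Collect_neq continuous_intros)
  have w3: "w e ^ 3 = fst e" if "e \<in> U" for e
  proof -
    have "exp (Ln (fst e / fst c) / 3) ^ 3 = fst e / fst c"
      using that c by (simp add: exp_of_nat_mult[symmetric] U_def)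
    then show ?thesis using cube_root_cubed[OF c] c by (simp add: w_def power_mult_distrib)
  qed
  let ?f = "\<lambda>e. (w e, w e * snd e / fst e)"
  let ?z = "root_point c"
  have wc: "w c = ?w0" using c by (simp add: w_def)
  have dw: "(w has_derivative (\<lambda>v. ?w0 * (fst v / fst c) / 3)) (at c)"
  proof -
    have "((\<lambda>t. ?w0 * exp (Ln (t / fst c) / 3)) has_field_derivative ?w0 * (1 / fst c) / 3) (at (fst c))"
      using c by (auto intro!: derivative_eq_intros)
    from has_derivative_compose[OF has_derivative_fst[OF has_derivative_ident]
        this[unfolded has_field_derivative_def]]
    show ?thesis unfolding w_def by (rule has_derivative_eq_rhs) (auto simp: field_simps)
  qed
  have "(?f has_derivative (\<lambda>v. (?w0 * (fst v / fst c) / 3,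
      ?w0 * (fst v / fst c) / 3 * (snd c / fst c) + ?w0 * (snd v / fst c - snd c / fst c * (fst v / fst c))))) (at c)"
    using c by (auto intro!: derivative_eq_intros dw simp: wc field_simps power2_eq_square)
  then have df: "(?f has_derivative (\<lambda>v. field2 (fst v / fst c / 3) (-2/3 * (fst v / fst c)) (snd v / fst c) ?z)) (at c)"
    by (rule has_derivative_eq_rhs) (auto simp: field2_def root_point_def field_simps)
  have sm: "smooth_on UNIV h" using h by (simp add: liftable_def flat_at_0_def)
  have fc: "?f c = ?z" by (simp add: wc root_point_def)
  have D: "(h has_derivative frechet_derivative h (at (?f c))) (at (?f c))"
    using sm by (rule smooth_on_has_derivative) simp
  then have lin: "linear (frechet_derivative h (at ?z))" unfolding fc by (rule has_derivative_linear)
  have 1: "((\<lambda>e. h (?f e)) has_derivative (\<lambda>v. frechet_derivative h (at ?z)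
      (field2 (fst v / fst c / 3) (-2/3 * (fst v / fst c)) (snd v / fst c) ?z))) (at c)"
    using has_derivative_compose[OF df D] unfolding fc .
  have 2: "lift h e = h (?f e)" if "e \<in> U" for e
    using cube_invariant_root[OF _ w3[OF that]] that h by (simp add: U_def liftable_def)
  have "(lift h has_derivative (\<lambda>v. frechet_derivative h (at ?z)
      (field2 (fst v / fst c / 3) (-2/3 * (fst v / fst c)) (snd v / fst c) ?z))) (at c)"
    by (rule has_derivative_transform_within_open[OF 1 U]) (rule 2[symmetric])
  then show ?thesis
  proof (rule has_derivative_eq_rhs, intro ext)
    fix v
    let ?a = "fst v / fst c" and ?b = "snd v / fst c"
    have "field2 (?a / 3) (-2/3 * ?a) ?b ?z =
      Re ?a *\<^sub>R field2 (1/3) (-2/3) 0 ?z + Im ?a *\<^sub>R field2 (\<i>/3) (-2*\<i>/3) 0 ?z +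
      Re ?b *\<^sub>R field2 0 0 1 ?z + Im ?b *\<^sub>R field2 0 0 \<i> ?z"
    proof -
      have *: "x * y = Re x *\<^sub>R y + Im x *\<^sub>R (\<i> * y)" for x y :: complex
        by (simp add: complex_eq_iff)
      have **: "field2 (a / 3) (-2/3 * a) b z =
          Re a *\<^sub>R field2 (1/3) (-2/3) 0 z + Im a *\<^sub>R field2 (\<i>/3) (-2*\<i>/3) 0 z +
          Re b *\<^sub>R field2 0 0 1 z + Im b *\<^sub>R field2 0 0 \<i> z" for a b z
        using *[of a "fst z / 3"] *[of a "-2/3 * snd z"] *[of b "fst z"]
        by (simp add: field2_def algebra_simps)
      show ?thesis by (rule **)
    qed
    then show "frechet_derivative h (at ?z) (field2 (?a / 3) (-2/3 * ?a) ?b ?z) =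
      Re ?a * lift (\<lambda>z. frechet_derivative h (at z) (field2 (1/3) (-2/3) 0 z)) c +
      Im ?a * lift (\<lambda>z. frechet_derivative h (at z) (field2 (\<i>/3) (-2*\<i>/3) 0 z)) c +
      Re ?b * lift (\<lambda>z. frechet_derivative h (at z) (field2 0 0 1 z)) c +
      Im ?b * lift (\<lambda>z. frechet_derivative h (at z) (field2 0 0 \<i> z)) c"
      using c by (simp add: lift_def linear_add[OF lin] linear_scale[OF lin])
  qed
qed

text \<open>On the cone \<open>norm z\<close> is at most three times the modulus of the cube root of \<open>fst c\<close>, so six orders of
  vanishing at the origin give one power of \<open>first_sq c\<close>.\<close>

lemma lift_bigo:
  assumes h: "liftable h" and c0: "first_sq c0 = 0"
  shows "lift h \<in> O[nhds c0](\<lambda>c. first_sq c ^ n)"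
proof -
  have "h \<in> O[nhds 0](\<lambda>x. norm x ^ (6 * n))" using h by (simp add: liftable_def flat_at_0_def)
  then obtain C where C: "C > 0" "\<forall>\<^sub>F z in nhds 0. \<bar>h z\<bar> \<le> C * norm z ^ (6 * n)"
    by (elim landau_o.bigE) auto
  then obtain d where d: "d > 0" "\<And>z. norm z < d \<Longrightarrow> \<bar>h z\<bar> \<le> C * norm z ^ (6 * n)"
    unfolding eventually_nhds_metric by auto
  have "\<forall>\<^sub>F c in nhds c0. c \<in> {c. cmod (fst c) < (d / 3) ^ 3}"
  proof (rule eventually_nhds_in_open)
    show "open {c :: complex \<times> complex. cmod (fst c) < (d / 3) ^ 3}"
      by (intro open_Collect_less continuous_intros)
  qed (use c0 d(1) in simp)
  then have "\<forall>\<^sub>F c in nhds c0. norm (lift h c) \<le> (C * 3 ^ (6 * n)) * norm (first_sq c ^ n)"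
  proof eventually_elim
    case (elim c)
    show ?case
    proof (cases "fst c = 0 \<or> lift h c = 0")
      case True
      then have "lift h c = 0" by (auto simp: lift_def)
      then show ?thesis using C(1) by simp
    next
      case False
      let ?z = "root_point c"
      have c: "fst c \<noteq> 0" and hz: "lift h c = h ?z" "h ?z \<noteq> 0" using False by (auto simp: lift_def)
      have "\<not> cmod (snd ?z) > 2 * cmod (fst ?z)" using hz(2) liftable_cone[OF h] by blast
      moreover have "norm ?z \<le> cmod (fst ?z) + cmod (snd ?z)" using norm_Pair_le[of "fst ?z" "snd ?z"] by simp
      ultimately have nz: "norm ?z \<le> 3 * cmod (fst ?z)" by linarith
      have cube: "cmod (fst ?z) ^ 3 = cmod (fst c)"
        using cube_root_cubed[OF c] by (simp add: root_point_def flip: norm_power)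
      then have "cmod (fst ?z) ^ 3 < (d / 3) ^ 3" using elim by simp
      then have "cmod (fst ?z) < d / 3" by (rule power_less_imp_less_base) (use d(1) in simp)
      then have "norm ?z < d" using nz by linarith
      then have "\<bar>h ?z\<bar> \<le> C * norm ?z ^ (6 * n)" by (rule d(2))
      also have "\<dots> \<le> C * (3 * cmod (fst ?z)) ^ (6 * n)"
        using C(1) nz by (intro mult_left_mono power_mono) auto
      also have "\<dots> = C * 3 ^ (6 * n) * ((cmod (fst ?z) ^ 3) ^ 2) ^ n"
        by (simp add: power_mult_distrib flip: power_mult)
      also have "(cmod (fst ?z) ^ 3) ^ 2 = first_sq c" by (simp add: cube dot_square_norm)
      finally show ?thesis using hz(1) by simp
    qed
  qed
  then show ?thesis by (rule bigoI)
qed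

inductive lift_span :: "(complex \<times> complex \<Rightarrow> real) \<Rightarrow> bool" where
  prod: "liftable h \<Longrightarrow> tame first_sq m \<Longrightarrow> lift_span (\<lambda>c. lift h c * m c)"
| add: "lift_span f \<Longrightarrow> lift_span g \<Longrightarrow> lift_span (\<lambda>c. f c + g c)"

lemma tame_quotient:
  assumes "bounded_linear g"
  shows "tame first_sq (\<lambda>c. g (v / fst c))"
proof -
  have "g (v / fst c) = g (v * cnj (fst c)) * inverse (first_sq c)" for c
  proof -
    have "v / fst c = inverse (first_sq c) *\<^sub>R (v * cnj (fst c))"
      by (cases "fst c = 0") (simp_all add: scaleR_conv_of_real field_simps flip: complex_norm_square power2_norm_eq_inner)
    then show ?thesis using assms by (simp add: linear_simps)
  qed
  moreover have "bounded_linear (\<lambda>c :: complex \<times> complex. g (v * cnj (fst c)))"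
    by (intro bounded_linear_compose[OF assms] bounded_linear_const_mult
        bounded_linear_compose[OF bounded_linear_cnj] bounded_linear_fst)
  ultimately show ?thesis
    using tame.mult[OF tame.smooth[OF smooth_on_linear] tame.inverse] by (metis (no_types, lifting) ext)
qed

text \<open>Finite sums of lifts with tame coefficients form a class closed under differentiation, and each of
  them is flat along \<open>fst c = 0\<close>.\<close>

theorem lift_smooth:
  assumes "liftable h" shows "smooth_on UNIV (lift h)"
proof -
  have "lift_span (\<lambda>c. lift h c * 1)"
    by (intro lift_span.prod assms tame.smooth smooth_on_const)
  then have "lift_span (lift h)" by simp
  then have "flat first_sq (lift h)"
  proof (rule flat_coinduct[where X = lift_span])
    show "f x = 0" if "lift_span f" "first_sq x = 0" for f x
      using that by induction (auto simp: lift_def)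
    show "f \<in> O[nhds x](\<lambda>y. first_sq y ^ n)" if "lift_span f" "first_sq x = 0" for f x n
      using that(1)
    proof induction
      case (prod h m)
      show ?case
        by (rule bigo_flat_times_tame[OF smooth_on_first_sq prod(2) that(2) lift_bigo[OF prod(1) that(2)]])
    next
      case (add f g)
      show ?case by (rule sum_in_bigo(1)[OF add.IH])
    qed
    fix f assume "lift_span f"
    then show "derivatives_in {x. first_sq x \<noteq> 0} lift_span f"
    proof induction
      case (prod h m)
      let ?D = "\<lambda>p q r. lift (\<lambda>z. frechet_derivative h (at z) (field2 p q r z))"
      have "derivatives_in {x. first_sq x \<noteq> 0} lift_span (lift h)"
      proof (rule derivatives_inI[where X = lift_span and d = "\<lambda>v c.
          ?D (1/3) (-2/3) 0 c * Re (fst v / fst c) + ?D (\<i>/3) (-2*\<i>/3) 0 c * Im (fst v / fst c) +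
          ?D 0 0 1 c * Re (snd v / fst c) + ?D 0 0 \<i> c * Im (snd v / fst c)"])
        show "(lift h has_derivative (\<lambda>v.
          ?D (1/3) (-2/3) 0 c * Re (fst v / fst c) + ?D (\<i>/3) (-2*\<i>/3) 0 c * Im (fst v / fst c) +
          ?D 0 0 1 c * Re (snd v / fst c) + ?D 0 0 \<i> c * Im (snd v / fst c))) (at c)"
          if "c \<in> {x. first_sq x \<noteq> 0}" for c
          by (rule has_derivative_eq_rhs[OF lift_has_derivative[OF prod(1)]]) (use that in \<open>auto simp: mult.commute\<close>)
        show "lift_span (\<lambda>c.
          ?D (1/3) (-2/3) 0 c * Re (fst v / fst c) + ?D (\<i>/3) (-2*\<i>/3) 0 c * Im (fst v / fst c) +
          ?D 0 0 1 c * Re (snd v / fst c) + ?D 0 0 \<i> c * Im (snd v / fst c))" for v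
          by (intro lift_span.add lift_span.prod liftable_field2 prod(1) tame_quotient
              bounded_linear_Re bounded_linear_Im)
      qed
      then show ?case
      proof (rule derivatives_in_mult[OF _ tame_derivatives[OF smooth_on_first_sq prod(2)]])
        fix f k assume "lift_span f" "tame first_sq k"
        moreover have "lift_span (\<lambda>c. f c * m c)" if "lift_span f" for f
          using that
        proof induction
          case (prod h' m')
          have "lift_span (\<lambda>c. lift h' c * (m' c * m c))"
            by (intro lift_span.prod tame.mult prod.hyps \<open>tame first_sq m\<close>)
          then show ?case by (simp add: mult.assoc)
        next
          case (add f g)
          then show ?case using lift_span.add[OF add.IH] by (simp add: algebra_simps)
        qed
        ultimately show "lift_span (\<lambda>x. lift h x * k x + f x * m x)"
          by (intro lift_span.add lift_span.prod prod(1))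
      qed
    next
      case (add f g)
      then show ?case by (intro derivatives_in_add[where X = lift_span] lift_span.add)
    qed
  qed
  moreover have "first_sq \<in> O[nhds x](\<lambda>y. norm (y - x))" if "first_sq x = 0" for x
  proof (rule bigoI[where c = 1])
    have "\<forall>\<^sub>F y in nhds x. y \<in> ball x 1" by (intro eventually_nhds_in_open) auto
    then show "\<forall>\<^sub>F y in nhds x. norm (first_sq y) \<le> 1 * norm (norm (y - x))"
    proof eventually_elim
      case (elim y)
      have "norm (fst y) \<le> norm (y - x)" using norm_fst_le[of "fst (y - x)" "snd (y - x)"] that unfolding prod.collapse by simp
      moreover have "norm (y - x) < 1" using elim by (simp add: dist_norm norm_minus_commute)
      ultimately have "norm (fst y) * norm (fst y) \<le> norm (y - x) * 1"
        by (intro mult_mono) auto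
      then show ?case by (simp add: dot_square_norm power2_eq_square)
    qed
  qed
  ultimately show ?thesis by (intro flat_smooth[where \<omega> = first_sq])
qed

lemma smooth_bounded_linear_compose:
  assumes "smooth_on UNIV g" "bounded_linear L" shows "smooth_on UNIV (\<lambda>x. g (L x))"
  by (rule smooth_on_compose[OF open_UNIV _ _ assms(1)])
     (auto intro!: smooth_on_linear bounded_linear_compose[OF bounded_linear_inner_left assms(2)])

text \<open>The cutoff depends only on the ratio \<open>first_sq z / (z \<bullet> z)\<close> between 0 and 1.  The affine function
  \<open>t = 3 * ratio - 1\<close> turns into \<open>1 - t\<close> when the two components are exchanged, and it is nonpositive
  when the ratio is at most 1/3, which includes the cone where the result has to vanish.\<close>

lemma flat_at_0_cutoff_liftable:
  assumes h: "flat_at_0 h" "cube_invariant h"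
  shows "liftable (\<lambda>z. h z * smooth_step (3 * (first_sq z * inverse (z \<bullet> z)) - 1))"
proof -
  let ?\<omega> = "\<lambda>z :: complex \<times> complex. z \<bullet> z"
  let ?r = "\<lambda>z. 3 * (first_sq z * inverse (z \<bullet> z)) + (-1)"
  have r1: "tame ?\<omega> ?r"
    by (intro tame.add tame.mult tame.inverse tame.smooth smooth_on_const smooth_on_first_sq)
  have r2: "?r \<in> O[nhds x](\<lambda>_. 1)" for x
  proof (rule bigoI[where c = 2])
    have "0 \<le> first_sq z * inverse (z \<bullet> z) \<and> first_sq z * inverse (z \<bullet> z) \<le> 1" for z
    proof (cases "z = 0")
      case False
      then have "z \<bullet> z > 0" by simp
      moreover have "first_sq z \<le> z \<bullet> z" by (simp add: inner_prod_def)
      ultimately show ?thesis by (simp add: field_simps)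
    qed simp
    moreover have "\<bar>3 * t + (-1)\<bar> \<le> 2" if "0 \<le> t \<and> t \<le> 1" for t :: real using that by linarith
    ultimately show "\<forall>\<^sub>F z in nhds x. norm (?r z) \<le> 2 * norm (1::real)"
      by (intro always_eventually allI) (simp only: real_norm_def abs_one mult_1_right)
  qed
  have "tame ?\<omega> (\<lambda>z. smooth_step (?r z))"
    by (rule tame.compose[OF r1 r2 smooth_step_smooth])
  from flat_at_0_times_tame[OF h(1) this] have "flat_at_0 (\<lambda>z. h z * smooth_step (?r z))" .
  moreover have "cube_invariant (\<lambda>z. h z * smooth_step (?r z))"
    unfolding cube_invariant_def
  proof (intro allI impI)
    fix \<zeta> :: complex and z assume \<zeta>: "\<zeta> ^ 3 = 1"
    have "cmod \<zeta> ^ 3 = 1" using \<zeta> by (metis norm_one norm_power)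
    then have "cmod \<zeta> = 1" using power_eq_imp_eq_base[of "cmod \<zeta>" 3 1] by simp
    then have "first_sq (scale2 \<zeta> z) = first_sq z" "scale2 \<zeta> z \<bullet> scale2 \<zeta> z = z \<bullet> z"
      by (simp_all add: scale2_def inner_prod_def dot_square_norm norm_mult)
    then show "h (scale2 \<zeta> z) * smooth_step (?r (scale2 \<zeta> z)) = h z * smooth_step (?r z)"
      using h(2) \<zeta> unfolding cube_invariant_def by metis
  qed
  moreover have "h z * smooth_step (?r z) = 0" if "cmod (snd z) > 2 * cmod (fst z)" for z
  proof -
    have "(2 * cmod (fst z))\<^sup>2 \<le> (cmod (snd z))\<^sup>2" using that by (intro power_mono) auto
    then have "4 * (cmod (fst z))\<^sup>2 \<le> (cmod (snd z))\<^sup>2" by (simp add: power_mult_distrib)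
    then have "3 * first_sq z \<le> z \<bullet> z"
      using zero_le_power2[of "cmod (fst z)"] unfolding inner_prod_def dot_square_norm by linarith
    moreover have "z \<bullet> z > 0" using that by (auto simp: prod_eq_iff)
    ultimately have "?r z \<le> 0" by (simp add: field_simps)
    then show ?thesis by (simp add: smooth_step_eq_0)
  qed
  ultimately show ?thesis by (simp add: liftable_def)
qed

text \<open>The two cutoffs, for the components in either order, add up to one, and each of the two parts factors
  through the two invariants built from the component that bounds the norm on its support.\<close>

theorem flat_invariant_factors:
  assumes h: "flat_at_0 h" "cube_invariant h"
  obtains F G where "smooth_on UNIV F" "smooth_on UNIV G"
    "\<And>z. h z = F (fst z ^ 3, fst z ^ 2 * snd z) + G (snd z ^ 3, snd z ^ 2 * fst z)"
proof -
  define swap where "swap z = (snd z, fst z)" for z :: "complex \<times> complex"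
  have swap: "bounded_linear swap"
    unfolding swap_def[abs_def] by (intro bounded_linear_Pair bounded_linear_fst bounded_linear_snd)
  have inner_swap: "swap z \<bullet> swap z = z \<bullet> z" for z by (simp add: swap_def inner_prod_def)
  have swap_swap: "swap (swap z) = z" for z by (simp add: swap_def)
  have norm_swap: "norm (swap z) = norm z" for z by (simp add: norm_eq_sqrt_inner inner_swap)
  define k where "k z = h (swap z)" for z
  have "flat_at_0 k"
    unfolding flat_at_0_def
  proof (intro conjI allI)
    show "smooth_on UNIV k" unfolding k_def[abs_def]
      by (rule smooth_bounded_linear_compose[OF _ swap]) (use h(1) in \<open>simp add: flat_at_0_def\<close>)
    fix n
    have "swap 0 = 0" by (simp add: swap_def zero_prod_def)
    moreover have "isCont swap 0" by (rule linear_continuous_at[OF swap])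
    ultimately have lim: "filterlim swap (nhds 0) (nhds 0)"
      unfolding isCont_def tendsto_at_iff_tendsto_nhds by simp
    have "h \<in> O[nhds 0](\<lambda>x. norm x ^ n)" using h(1) by (simp add: flat_at_0_def)
    from landau_o.big.compose[OF this lim]
    have "(\<lambda>z. h (swap z)) \<in> O[nhds 0](\<lambda>z. norm (swap z) ^ n)" .
    then show "k \<in> O[nhds 0](\<lambda>x. norm x ^ n)" by (simp add: k_def[abs_def] norm_swap)
  qed
  moreover have "cube_invariant k"
    using h(2) by (auto simp: cube_invariant_def k_def swap_def scale2_def)
  ultimately have k: "flat_at_0 k" "cube_invariant k" .
  let ?cut = "\<lambda>h z. h z * smooth_step (3 * (first_sq z * inverse (z \<bullet> z)) - 1)"
  note lh = flat_at_0_cutoff_liftable[OF h] and lk = flat_at_0_cutoff_liftable[OF k]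
  show thesis
  proof (rule that[OF lift_smooth[OF lh] lift_smooth[OF lk]])
    fix z
    have "h z = ?cut h z + ?cut k (swap z)"
    proof (cases "z = 0")
      case True
      have "k (swap z) = 0" using flat_at_0_zero[OF h(1)] True by (simp only: k_def swap_swap)
      then show ?thesis using flat_at_0_zero[OF h(1)] True by simp
    next
      case False
      let ?t = "3 * (first_sq z * inverse (z \<bullet> z)) - 1"
      have zz: "z \<bullet> z \<noteq> 0" using False by simp
      have "3 * (first_sq (swap z) * inverse (swap z \<bullet> swap z)) - 1 = 1 - ?t"
        using zz unfolding inner_swap by (simp add: swap_def inner_prod_def field_simps)
      then have "?cut h z + ?cut k (swap z) = h z * (smooth_step ?t + smooth_step (1 - ?t))"
        by (simp add: k_def swap_def distrib_left)
      then show ?thesis unfolding smooth_step_reflect by simp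
    qed
    then show "h z = lift (?cut h) (fst z ^ 3, fst z ^ 2 * snd z) + lift (?cut k) (snd z ^ 3, snd z ^ 2 * fst z)"
      using lift_eq[OF lh, of z] lift_eq[OF lk, of "swap z"] by (simp add: swap_def)
  qed
qed

section \<open>A table of polynomial brackets\<close>

text \<open>Names for the 28 coordinates.  The first twelve are the generating invariants: with \<open>a\<^sub>1, a\<^sub>2\<close> the
  two complex coordinates, \<open>Q\<close> stands for the products \<open>a\<^sub>i * cnj a\<^sub>j\<close>, \<open>C\<close> for the cubic monomials in
  \<open>a\<^sub>1, a\<^sub>2\<close> and \<open>D\<close> for their conjugates.  On the embedded quotient \<open>Y\<close> takes the values of twice
  the monomials of bidegree \<open>(2, 2)\<close>, and \<open>Z\<close>, \<open>Zb\<close> and \<open>W\<close> vanish.\<close>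

datatype coord = Q11 | Q12 | Q21 | Q22 | C0 | C1 | C2 | C3 | D0 | D1 | D2 | D3 | Y00 | Y01
  | Y02 | Y10 | Y11 | Y12 | Y20 | Y21 | Y22 | Z0 | Z1 | Zb0 | Zb1 | W00 | W01 | W10


type_synonym 'v polynomial = "(int \<times> 'v list) list"
text \<open>The brackets of the coordinates, each unordered pair once: the entry for \<open>j\<close> in the row of \<open>i\<close>
  is the polynomial \<open>{i, j}\<close>, and pairs that are missing in both orders commute.\<close>

primrec row :: "coord \<Rightarrow> (coord \<times> coord polynomial) list" where
  "row Q11 =
    [(Q12,[(-2,[Q12])]),
     (Q21,[(2,[Q21])]),
     (C0,[(-6,[C0])]),
     (C1,[(-4,[C1])]),
     (C2,[(-2,[C2])]),
     (D0,[(6,[D0])]),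
     (D1,[(4,[D1])]),
     (D2,[(2,[D2])]),
     (Y01,[(-2,[Y01])]),
     (Y02,[(-4,[Y02])]),
     (Y10,[(2,[Y10])]),
     (Y12,[(-2,[Y12])]),
     (Y20,[(4,[Y20])]),
     (Y21,[(2,[Y21])]),
     (Z0,[(-4,[Z0])]),
     (Z1,[(-2,[Z1])]),
     (Zb0,[(4,[Zb0])]),
     (Zb1,[(2,[Zb1])]),
     (W01,[(-2,[W01])]),
     (W10,[(2,[W10])])]"
| "row Q12 =
    [(Q21,[(-2,[Q11]),(2,[Q22])]),
     (Q22,[(-2,[Q12])]),
     (C1,[(-2,[C0])]),
     (C2,[(-4,[C1])]),
     (C3,[(-6,[C2])]),
     (D0,[(6,[D1])]),
     (D1,[(4,[D2])]),
     (D2,[(2,[D3])]),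
     (Y00,[(4,[Y01])]),
     (Y01,[(2,[Y02])]),
     (Y10,[(-2,[Y00]),(4,[Y11])]),
     (Y11,[(-2,[Y01]),(2,[Y12])]),
     (Y12,[(-2,[Y02])]),
     (Y20,[(-4,[Y10]),(4,[Y21])]),
     (Y21,[(-4,[Y11]),(2,[Y22])]),
     (Y22,[(-4,[Y12])]),
     (Z1,[(-2,[Z0])]),
     (Zb0,[(2,[Zb1])]),
     (W00,[(2,[W01])]),
     (W10,[(-4,[W00])])]"
| "row Q21 =
    [(Q22,[(2,[Q21])]),
     (C0,[(-6,[C1])]),
     (C1,[(-4,[C2])]),
     (C2,[(-2,[C3])]),
     (D1,[(2,[D0])]),
     (D2,[(4,[D1])]),
     (D3,[(6,[D2])]),
     (Y00,[(-4,[Y10])]),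
     (Y01,[(2,[Y00]),(-4,[Y11])]),
     (Y02,[(4,[Y01]),(-4,[Y12])]),
     (Y10,[(-2,[Y20])]),
     (Y11,[(2,[Y10]),(-2,[Y21])]),
     (Y12,[(4,[Y11]),(-2,[Y22])]),
     (Y21,[(2,[Y20])]),
     (Y22,[(4,[Y21])]),
     (Z0,[(-2,[Z1])]),
     (Zb1,[(2,[Zb0])]),
     (W00,[(-2,[W10])]),
     (W01,[(4,[W00])])]"
| "row Q22 =
    [(C1,[(-2,[C1])]),
     (C2,[(-4,[C2])]),
     (C3,[(-6,[C3])]),
     (D1,[(2,[D1])]),
     (D2,[(4,[D2])]),
     (D3,[(6,[D3])]),
     (Y01,[(2,[Y01])]),
     (Y02,[(4,[Y02])]),
     (Y10,[(-2,[Y10])]),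
     (Y12,[(2,[Y12])]),
     (Y20,[(-4,[Y20])]),
     (Y21,[(-2,[Y21])]),
     (Z0,[(-2,[Z0])]),
     (Z1,[(-4,[Z1])]),
     (Zb0,[(2,[Zb0])]),
     (Zb1,[(4,[Zb1])]),
     (W01,[(2,[W01])]),
     (W10,[(-2,[W10])])]"
| "row C0 =
    [(D0,[(9,[Y00])]),
     (D1,[(6,[Y01])]),
     (D2,[(3,[Y02])]),
     (Y00,[(24,[Q11,C0])]),
     (Y01,[(12,[Q12,C0])]),
     (Y10,[(18,[Q11,C1]),(6,[Q21,C0])]),
     (Y11,[(9,[Q12,C1]),(3,[Q22,C0])]),
     (Y20,[(12,[Q11,C2]),(12,[Q21,C1]),(-6,[Z1])]),
     (Y21,[(6,[Q12,C2]),(6,[Q22,C1]),(3,[Z0])]),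
     (Z1,[(-12,[C0,C2]),(12,[C1,C1])]),
     (Zb0,[(12,[Q21,Y02]),(-12,[Q22,Y01]),(6,[W01])]),
     (Zb1,[(-12,[Q11,Y02]),(12,[Q12,Y01])]),
     (W00,[(18,[Q11,Q22,C0]),(-18,[Q12,Q21,C0]),(12,[C0,Y11]),(-6,[C0,Y22]),(-12,[C1,Y01]),
       (6,[C2,Y02])]),
     (W01,[(24,[C0,Y12]),(-24,[C1,Y02])]),
     (W10,[(36,[Q11,Q22,C1]),(18,[Q11,Z0]),(-36,[Q12,Q21,C1]),(18,[Q12,Z1]),(12,[C0,Y21]),
       (-12,[C2,Y01])])]"
| "row C1 =
    [(D0,[(6,[Y10])]),
     (D1,[(1,[Y00]),(4,[Y11])]),
     (D2,[(2,[Y01]),(2,[Y12])]),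
     (D3,[(3,[Y02])]),
     (Y00,[(12,[Q11,C1]),(4,[Q21,C0])]),
     (Y01,[(4,[Q11,C0]),(6,[Q12,C1]),(2,[Q22,C0])]),
     (Y02,[(8,[Q12,C0])]),
     (Y10,[(8,[Q11,C2]),(8,[Q21,C1]),(2,[Z1])]),
     (Y11,[(3,[Q11,C1]),(4,[Q12,C2]),(1,[Q21,C0]),(4,[Q22,C1]),(-1,[Z0])]),
     (Y12,[(6,[Q12,C1]),(2,[Q22,C0])]),
     (Y20,[(4,[Q11,C3]),(12,[Q21,C2])]),
     (Y21,[(2,[Q11,C2]),(2,[Q12,C3]),(2,[Q21,C1]),(6,[Q22,C2]),(-1,[Z1])]),
     (Y22,[(4,[Q12,C2]),(4,[Q22,C1]),(2,[Z0])]),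
     (Z0,[(4,[C0,C2]),(-4,[C1,C1])]),
     (Z1,[(-4,[C0,C3]),(4,[C1,C2])]),
     (Zb0,[(-4,[Q21,Y01]),(8,[Q21,Y12]),(4,[Q22,Y00]),(-8,[Q22,Y11]),(-4,[W00])]),
     (Zb1,[(4,[Q11,Y01]),(-8,[Q11,Y12]),(-4,[Q12,Y00]),(8,[Q12,Y11]),(2,[W01])]),
     (W00,[(6,[Q11,Q22,C1]),(-6,[Q11,Z0]),(-6,[Q12,Q21,C1]),(-6,[Q12,Z1]),(-4,[C0,Y10]),(4,[C0,Y21]),
       (4,[C1,Y00]),(4,[C1,Y11]),(-6,[C1,Y22]),(-8,[C2,Y01]),(4,[C2,Y12]),(2,[C3,Y02])]),
     (W01,[(12,[Q11,Q22,C0]),(-12,[Q12,Q21,C0]),(-8,[C0,Y11]),(4,[C0,Y22]),(8,[C1,Y01]),(8,[C1,Y12]),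
       (-12,[C2,Y02])]),
     (W10,[(24,[Q11,Q22,C2]),(-24,[Q12,Q21,C2]),(6,[Q21,Z0]),(6,[Q22,Z1]),(-4,[C0,Y20]),(12,[C1,Y21]),
       (4,[C2,Y00]),(-8,[C2,Y11]),(-4,[C3,Y01])])]"
| "row C2 =
    [(D0,[(3,[Y20])]),
     (D1,[(2,[Y10]),(2,[Y21])]),
     (D2,[(4,[Y11]),(1,[Y22])]),
     (D3,[(6,[Y12])]),
     (Y00,[(4,[Q11,C2]),(4,[Q21,C1]),(-2,[Z1])]),
     (Y01,[(6,[Q11,C1]),(2,[Q12,C2]),(2,[Q21,C0]),(2,[Q22,C1]),(1,[Z0])]),
     (Y02,[(12,[Q12,C1]),(4,[Q22,C0])]),
     (Y10,[(2,[Q11,C3]),(6,[Q21,C2])]),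
     (Y11,[(4,[Q11,C2]),(1,[Q12,C3]),(4,[Q21,C1]),(3,[Q22,C2]),(1,[Z1])]),
     (Y12,[(8,[Q12,C2]),(8,[Q22,C1]),(-2,[Z0])]),
     (Y20,[(8,[Q21,C3])]),
     (Y21,[(2,[Q11,C3]),(6,[Q21,C2]),(4,[Q22,C3])]),
     (Y22,[(4,[Q12,C3]),(12,[Q22,C2])]),
     (Z0,[(4,[C0,C3]),(-4,[C1,C2])]),
     (Z1,[(-4,[C1,C3]),(4,[C2,C2])]),
     (Zb0,[(-8,[Q21,Y11]),(4,[Q21,Y22]),(8,[Q22,Y10]),(-4,[Q22,Y21]),(-2,[W10])]),
     (Zb1,[(8,[Q11,Y11]),(-4,[Q11,Y22]),(-8,[Q12,Y10]),(4,[Q12,Y21]),(-4,[W00])]),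
     (W00,[(-6,[Q11,Q22,C2]),(6,[Q12,Q21,C2]),(-6,[Q21,Z0]),(-6,[Q22,Z1]),(-2,[C0,Y20]),(-4,[C1,Y10]),
       (8,[C1,Y21]),(6,[C2,Y00]),(-4,[C2,Y11]),(-4,[C2,Y22]),(-4,[C3,Y01]),(4,[C3,Y12])]),
     (W01,[(24,[Q11,Q22,C1]),(-6,[Q11,Z0]),(-24,[Q12,Q21,C1]),(-6,[Q12,Z1]),(-4,[C0,Y21]),
       (-8,[C1,Y11]),(4,[C1,Y22]),(12,[C2,Y01]),(-4,[C3,Y02])]),
     (W10,[(12,[Q11,Q22,C3]),(-12,[Q12,Q21,C3]),(-12,[C1,Y20]),(8,[C2,Y10]),(8,[C2,Y21]),(4,[C3,Y00]),
       (-8,[C3,Y11])])]"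
| "row C3 =
    [(D1,[(3,[Y20])]),
     (D2,[(6,[Y21])]),
     (D3,[(9,[Y22])]),
     (Y01,[(6,[Q11,C2]),(6,[Q21,C1]),(-3,[Z1])]),
     (Y02,[(12,[Q12,C2]),(12,[Q22,C1]),(6,[Z0])]),
     (Y11,[(3,[Q11,C3]),(9,[Q21,C2])]),
     (Y12,[(6,[Q12,C3]),(18,[Q22,C2])]),
     (Y21,[(12,[Q21,C3])]),
     (Y22,[(24,[Q22,C3])]),
     (Z0,[(12,[C1,C3]),(-12,[C2,C2])]),
     (Zb0,[(-12,[Q21,Y21]),(12,[Q22,Y20])]),
     (Zb1,[(12,[Q11,Y21]),(-12,[Q12,Y20]),(-6,[W10])]),
     (W00,[(-18,[Q11,Q22,C3]),(18,[Q12,Q21,C3]),(-6,[C1,Y20]),(12,[C2,Y21]),(6,[C3,Y00]),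
       (-12,[C3,Y11])]),
     (W01,[(36,[Q11,Q22,C2]),(-36,[Q12,Q21,C2]),(-18,[Q21,Z0]),(-18,[Q22,Z1]),(-12,[C1,Y21]),
       (12,[C3,Y01])]),
     (W10,[(-24,[C2,Y20]),(24,[C3,Y10])])]"
| "row D0 =
    [(Y00,[(-24,[Q11,D0])]),
     (Y01,[(-18,[Q11,D1]),(-6,[Q12,D0])]),
     (Y02,[(-12,[Q11,D2]),(-12,[Q12,D1]),(6,[Zb1])]),
     (Y10,[(-12,[Q21,D0])]),
     (Y11,[(-9,[Q21,D1]),(-3,[Q22,D0])]),
     (Y12,[(-6,[Q21,D2]),(-6,[Q22,D1]),(-3,[Zb0])]),
     (Z0,[(-12,[Q12,Y20]),(12,[Q22,Y10]),(-6,[W10])]),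
     (Z1,[(12,[Q11,Y20]),(-12,[Q21,Y10])]),
     (Zb1,[(12,[D0,D2]),(-12,[D1,D1])]),
     (W00,[(-18,[Q11,Q22,D0]),(18,[Q12,Q21,D0]),(-12,[D0,Y11]),(6,[D0,Y22]),(12,[D1,Y10]),
       (-6,[D2,Y20])]),
     (W01,[(-36,[Q11,Q22,D1]),(-18,[Q11,Zb0]),(36,[Q12,Q21,D1]),(-18,[Q21,Zb1]),(-12,[D0,Y12]),
       (12,[D2,Y10])]),
     (W10,[(-24,[D0,Y21]),(24,[D1,Y20])])]"
| "row D1 =
    [(Y00,[(-12,[Q11,D1]),(-4,[Q12,D0])]),
     (Y01,[(-8,[Q11,D2]),(-8,[Q12,D1]),(-2,[Zb1])]),
     (Y02,[(-4,[Q11,D3]),(-12,[Q12,D2])]),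
     (Y10,[(-4,[Q11,D0]),(-6,[Q21,D1]),(-2,[Q22,D0])]),
     (Y11,[(-3,[Q11,D1]),(-1,[Q12,D0]),(-4,[Q21,D2]),(-4,[Q22,D1]),(1,[Zb0])]),
     (Y12,[(-2,[Q11,D2]),(-2,[Q12,D1]),(-2,[Q21,D3]),(-6,[Q22,D2]),(1,[Zb1])]),
     (Y20,[(-8,[Q21,D0])]),
     (Y21,[(-6,[Q21,D1]),(-2,[Q22,D0])]),
     (Y22,[(-4,[Q21,D2]),(-4,[Q22,D1]),(-2,[Zb0])]),
     (Z0,[(4,[Q12,Y10]),(-8,[Q12,Y21]),(-4,[Q22,Y00]),(8,[Q22,Y11]),(4,[W00])]),
     (Z1,[(-4,[Q11,Y10]),(8,[Q11,Y21]),(4,[Q21,Y00]),(-8,[Q21,Y11]),(-2,[W10])]),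
     (Zb0,[(-4,[D0,D2]),(4,[D1,D1])]),
     (Zb1,[(4,[D0,D3]),(-4,[D1,D2])]),
     (W00,[(-6,[Q11,Q22,D1]),(6,[Q11,Zb0]),(6,[Q12,Q21,D1]),(6,[Q21,Zb1]),(4,[D0,Y01]),(-4,[D0,Y12]),
       (-4,[D1,Y00]),(-4,[D1,Y11]),(6,[D1,Y22]),(8,[D2,Y10]),(-4,[D2,Y21]),(-2,[D3,Y20])]),
     (W01,[(-24,[Q11,Q22,D2]),(24,[Q12,Q21,D2]),(-6,[Q12,Zb0]),(-6,[Q22,Zb1]),(4,[D0,Y02]),
       (-12,[D1,Y12]),(-4,[D2,Y00]),(8,[D2,Y11]),(4,[D3,Y10])]),
     (W10,[(-12,[Q11,Q22,D0]),(12,[Q12,Q21,D0]),(8,[D0,Y11]),(-4,[D0,Y22]),(-8,[D1,Y10]),(-8,[D1,Y21]),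
       (12,[D2,Y20])])]"
| "row D2 =
    [(Y00,[(-4,[Q11,D2]),(-4,[Q12,D1]),(2,[Zb1])]),
     (Y01,[(-2,[Q11,D3]),(-6,[Q12,D2])]),
     (Y02,[(-8,[Q12,D3])]),
     (Y10,[(-6,[Q11,D1]),(-2,[Q12,D0]),(-2,[Q21,D2]),(-2,[Q22,D1]),(-1,[Zb0])]),
     (Y11,[(-4,[Q11,D2]),(-4,[Q12,D1]),(-1,[Q21,D3]),(-3,[Q22,D2]),(-1,[Zb1])]),
     (Y12,[(-2,[Q11,D3]),(-6,[Q12,D2]),(-4,[Q22,D3])]),
     (Y20,[(-12,[Q21,D1]),(-4,[Q22,D0])]),
     (Y21,[(-8,[Q21,D2]),(-8,[Q22,D1]),(2,[Zb0])]),
     (Y22,[(-4,[Q21,D3]),(-12,[Q22,D2])]),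
     (Z0,[(8,[Q12,Y11]),(-4,[Q12,Y22]),(-8,[Q22,Y01]),(4,[Q22,Y12]),(2,[W01])]),
     (Z1,[(-8,[Q11,Y11]),(4,[Q11,Y22]),(8,[Q21,Y01]),(-4,[Q21,Y12]),(4,[W00])]),
     (Zb0,[(-4,[D0,D3]),(4,[D1,D2])]),
     (Zb1,[(4,[D1,D3]),(-4,[D2,D2])]),
     (W00,[(6,[Q11,Q22,D2]),(-6,[Q12,Q21,D2]),(6,[Q12,Zb0]),(6,[Q22,Zb1]),(2,[D0,Y02]),(4,[D1,Y01]),
       (-8,[D1,Y12]),(-6,[D2,Y00]),(4,[D2,Y11]),(4,[D2,Y22]),(4,[D3,Y10]),(-4,[D3,Y21])]),
     (W01,[(-12,[Q11,Q22,D3]),(12,[Q12,Q21,D3]),(12,[D1,Y02]),(-8,[D2,Y01]),(-8,[D2,Y12]),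
       (-4,[D3,Y00]),(8,[D3,Y11])]),
     (W10,[(-24,[Q11,Q22,D1]),(6,[Q11,Zb0]),(24,[Q12,Q21,D1]),(6,[Q21,Zb1]),(4,[D0,Y12]),(8,[D1,Y11]),
       (-4,[D1,Y22]),(-12,[D2,Y10]),(4,[D3,Y20])])]"
| "row D3 =
    [(Y10,[(-6,[Q11,D2]),(-6,[Q12,D1]),(3,[Zb1])]),
     (Y11,[(-3,[Q11,D3]),(-9,[Q12,D2])]),
     (Y12,[(-12,[Q12,D3])]),
     (Y20,[(-12,[Q21,D2]),(-12,[Q22,D1]),(-6,[Zb0])]),
     (Y21,[(-6,[Q21,D3]),(-18,[Q22,D2])]),
     (Y22,[(-24,[Q22,D3])]),
     (Z0,[(12,[Q12,Y12]),(-12,[Q22,Y02])]),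
     (Z1,[(-12,[Q11,Y12]),(12,[Q21,Y02]),(6,[W01])]),
     (Zb0,[(-12,[D1,D3]),(12,[D2,D2])]),
     (W00,[(18,[Q11,Q22,D3]),(-18,[Q12,Q21,D3]),(6,[D1,Y02]),(-12,[D2,Y12]),(-6,[D3,Y00]),
       (12,[D3,Y11])]),
     (W01,[(24,[D2,Y02]),(-24,[D3,Y01])]),
     (W10,[(-36,[Q11,Q22,D2]),(36,[Q12,Q21,D2]),(18,[Q12,Zb0]),(18,[Q22,Zb1]),(12,[D1,Y12]),
       (-12,[D3,Y10])])]"
| "row Y00 =
    [(Y01,[(-12,[Q11,Y01]),(6,[Q12,Y00]),(-4,[C0,D1])]),
     (Y02,[(-12,[Q11,Y02]),(-8,[C0,D2])]),
     (Y10,[(12,[Q11,Y10]),(-6,[Q21,Y00]),(4,[C1,D0])]),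
     (Y11,[(6,[Q12,Y10]),(-6,[Q21,Y01])]),
     (Y12,[(-6,[Q21,Y02]),(-4,[C1,D2]),(-2,[W01])]),
     (Y20,[(12,[Q11,Y20]),(8,[C2,D0])]),
     (Y21,[(6,[Q12,Y20]),(4,[C2,D1]),(2,[W10])]),
     (Z0,[(-16,[Q11,Q12,C2]),(-12,[Q11,Z0]),(8,[Q12,Q21,C1]),(-4,[Q12,Z1]),(8,[Q21,Q22,C0]),
       (-8,[C0,Y21]),(8,[C2,Y01])]),
     (Z1,[(16,[Q11,Q11,C2]),(-8,[Q11,Q21,C1]),(-8,[Q11,Z1]),(-8,[Q21,Q21,C0]),(4,[C0,Y20]),
       (8,[C1,Y10]),(-12,[C2,Y00])]),
     (Zb0,[(16,[Q11,Q21,D2]),(12,[Q11,Zb0]),(-8,[Q12,Q21,D1]),(-8,[Q12,Q22,D0]),(4,[Q21,Zb1]),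
       (8,[D0,Y12]),(-8,[D2,Y10])]),
     (Zb1,[(-16,[Q11,Q11,D2]),(8,[Q11,Q12,D1]),(8,[Q11,Zb1]),(8,[Q12,Q12,D0]),(-4,[D0,Y02]),
       (-8,[D1,Y01]),(12,[D2,Y00])]),
     (W00,[(-8,[Q12,C1,D0]),(8,[Q12,C2,D1]),(8,[Q21,C0,D1]),(-8,[Q21,C1,D2]),(-4,[C2,Zb1]),
       (4,[D2,Z1])]),
     (W01,[(-8,[Q11,C1,D2]),(-12,[Q11,W01]),(-8,[Q12,C1,D1]),(24,[Q21,C0,D2]),(-8,[Q22,C0,D1]),
       (-4,[C0,Zb0]),(4,[C1,Zb1]),(12,[Y00,Y12]),(-12,[Y02,Y10])]),
     (W10,[(8,[Q11,C2,D1]),(12,[Q11,W10]),(-24,[Q12,C2,D0]),(8,[Q21,C1,D1]),(8,[Q22,C1,D0]),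
       (4,[D0,Z0]),(-4,[D1,Z1]),(-12,[Y00,Y21]),(12,[Y01,Y20])])]"
| "row Y01 =
    [(Y02,[(-6,[Q12,Y02]),(-4,[C0,D3])]),
     (Y10,[(-3,[Q11,Y00]),(12,[Q11,Y11]),(-3,[Q22,Y00]),(-2,[C0,D0]),(6,[C1,D1])]),
     (Y11,[(-3,[Q11,Y01]),(6,[Q12,Y11]),(-3,[Q22,Y01]),(-2,[C0,D1]),(2,[C1,D2]),(1,[W01])]),
     (Y12,[(-3,[Q11,Y02]),(-3,[Q22,Y02]),(-2,[C0,D2]),(-2,[C1,D3])]),
     (Y20,[(12,[Q11,Y21]),(-6,[Q21,Y00]),(-4,[C1,D0]),(8,[C2,D1]),(-2,[W10])]),
     (Y21,[(6,[Q12,Y21]),(-6,[Q21,Y01]),(-4,[C1,D1]),(4,[C2,D2]),(-2,[W00])]),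
     (Y22,[(-6,[Q21,Y02]),(-4,[C1,D2]),(-2,[W01])]),
     (Z0,[(12,[Q11,Q12,C1]),(-4,[Q11,Q22,C0]),(-8,[Q12,Q12,C2]),(-8,[Q12,Q21,C0]),(4,[Q12,Q22,C1]),
       (-4,[Q12,Z0]),(4,[Q22,Q22,C0]),(8,[C0,Y11]),(-4,[C0,Y22]),(-8,[C1,Y01]),(4,[C2,Y02])]),
     (Z1,[(-12,[Q11,Q11,C1]),(8,[Q11,Q12,C2]),(12,[Q11,Q21,C0]),(-4,[Q11,Q22,C1]),(-2,[Q11,Z0]),
       (-6,[Q12,Z1]),(-4,[Q21,Q22,C0]),(-8,[C0,Y10]),(8,[C1,Y00]),(8,[C1,Y11]),(-8,[C2,Y01])]),
     (Zb0,[(8,[Q11,Q21,D3]),(8,[Q11,Q22,D2]),(-16,[Q12,Q22,D1]),(6,[Q12,Zb0]),(2,[Q22,Zb1]),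
       (-2,[D0,Y02]),(4,[D1,Y01]),(12,[D1,Y12]),(-2,[D2,Y00]),(-8,[D2,Y11]),(-4,[D3,Y10])]),
     (Zb1,[(-8,[Q11,Q11,D3]),(-8,[Q11,Q12,D2]),(16,[Q12,Q12,D1]),(4,[Q12,Zb1]),(-10,[D1,Y02]),
       (4,[D2,Y01]),(6,[D3,Y00])]),
     (W00,[(-4,[Q11,C0,D1]),(8,[Q11,C1,D2]),(6,[Q11,W01]),(4,[Q12,C0,D0]),(-16,[Q12,C1,D1]),
       (8,[Q12,C2,D2]),(-4,[Q21,C1,D3]),(8,[Q22,C0,D1]),(-4,[Q22,C1,D2]),(2,[C0,Zb0]),
       (2,[C1,Zb1]),(-2,[D2,Z0]),(2,[D3,Z1]),(-6,[Y00,Y12]),(6,[Y02,Y10])]),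
     (W01,[(-8,[Q11,C0,D2]),(-4,[Q11,C1,D3]),(8,[Q12,C0,D1]),(-12,[Q12,C1,D2]),(-6,[Q12,W01]),
       (12,[Q21,C0,D3]),(4,[Q22,C0,D2]),(-4,[C0,Zb1]),(12,[Y01,Y12]),(-12,[Y02,Y11])]),
     (W10,[(-12,[Q11,C1,D1]),(8,[Q11,C2,D2]),(-12,[Q11,W00]),(12,[Q12,C1,D0]),(-24,[Q12,C2,D1]),
       (6,[Q12,W10]),(4,[Q21,C0,D1]),(-4,[Q22,C0,D0]),(16,[Q22,C1,D1]),(-4,[C2,Zb1]),(8,[D1,Z0]),
       (12,[Y00,Y11]),(-6,[Y00,Y22]),(-12,[Y01,Y10]),(6,[Y02,Y20])])]"
| "row Y02 =
    [(Y10,[(12,[Q11,Y12]),(-6,[Q12,Y00]),(-4,[C0,D1]),(8,[C1,D2]),(-2,[W01])]),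
     (Y11,[(-6,[Q12,Y01]),(6,[Q12,Y12]),(-4,[C0,D2]),(4,[C1,D3])]),
     (Y12,[(-6,[Q12,Y02]),(-4,[C0,D3])]),
     (Y20,[(12,[Q11,Y22]),(-12,[Q22,Y00]),(-8,[C1,D1]),(8,[C2,D2]),(8,[W00])]),
     (Y21,[(6,[Q12,Y22]),(-12,[Q22,Y01]),(-8,[C1,D2]),(4,[C2,D3]),(2,[W01])]),
     (Y22,[(-12,[Q22,Y02]),(-8,[C1,D3])]),
     (Z0,[(24,[Q12,Q12,C1]),(-24,[Q12,Q22,C0]),(16,[C0,Y12]),(-16,[C1,Y02])]),
     (Z1,[(-24,[Q11,Q12,C1]),(16,[Q11,Q22,C0]),(8,[Q12,Q21,C0]),(-16,[C0,Y11]),(-4,[C0,Y22]),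
       (16,[C1,Y01]),(8,[C1,Y12]),(-4,[C2,Y02])]),
     (Zb0,[(16,[Q11,Q22,D3]),(8,[Q12,Q21,D3]),(-24,[Q12,Q22,D2]),(-4,[D1,Y02]),(8,[D2,Y01]),
       (16,[D2,Y12]),(-4,[D3,Y00]),(-16,[D3,Y11])]),
     (Zb1,[(-24,[Q11,Q12,D3]),(24,[Q12,Q12,D2]),(-16,[D2,Y02]),(16,[D3,Y01])]),
     (W00,[(-8,[Q11,C0,D2]),(16,[Q11,C1,D3]),(8,[Q12,C0,D1]),(-24,[Q12,C1,D2]),(8,[Q12,C2,D3]),
       (12,[Q12,W01]),(-8,[Q21,C0,D3]),(16,[Q22,C0,D2]),(-8,[Q22,C1,D3]),(4,[C0,Zb1]),
       (-4,[D3,Z0]),(-24,[Y01,Y12]),(24,[Y02,Y11])]),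
     (W01,[(-16,[Q11,C0,D3]),(16,[Q12,C0,D2]),(-16,[Q12,C1,D3]),(16,[Q22,C0,D3])]),
     (W10,[(-24,[Q11,C1,D2]),(8,[Q11,C2,D3]),(24,[Q12,C1,D1]),(-24,[Q12,C2,D2]),(-24,[Q12,W00]),
       (8,[Q21,C0,D2]),(-8,[Q21,C1,D3]),(-8,[Q22,C0,D1]),(24,[Q22,C1,D2]),(4,[C0,Zb0]),
       (12,[C1,Zb1]),(12,[D2,Z0]),(4,[D3,Z1]),(12,[Y00,Y12]),(-12,[Y01,Y22]),(-12,[Y02,Y10]),
       (12,[Y02,Y21])])]"
| "row Y10 =
    [(Y11,[(3,[Q11,Y10]),(-6,[Q21,Y11]),(3,[Q22,Y10]),(2,[C1,D0]),(-2,[C2,D1]),(-1,[W10])]),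
     (Y12,[(6,[Q12,Y10]),(-6,[Q21,Y12]),(4,[C1,D1]),(-4,[C2,D2]),(2,[W00])]),
     (Y20,[(6,[Q21,Y20]),(4,[C3,D0])]),
     (Y21,[(3,[Q11,Y20]),(3,[Q22,Y20]),(2,[C2,D0]),(2,[C3,D1])]),
     (Y22,[(6,[Q12,Y20]),(4,[C2,D1]),(2,[W10])]),
     (Z0,[(-8,[Q11,Q12,C3]),(-8,[Q11,Q22,C2]),(16,[Q21,Q22,C1]),(-6,[Q21,Z0]),(-2,[Q22,Z1]),
       (2,[C0,Y20]),(-4,[C1,Y10]),(-12,[C1,Y21]),(2,[C2,Y00]),(8,[C2,Y11]),(4,[C3,Y01])]),
     (Z1,[(8,[Q11,Q11,C3]),(8,[Q11,Q21,C2]),(-16,[Q21,Q21,C1]),(-4,[Q21,Z1]),(10,[C1,Y20]),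
       (-4,[C2,Y10]),(-6,[C3,Y00])]),
     (Zb0,[(-12,[Q11,Q21,D1]),(4,[Q11,Q22,D0]),(8,[Q12,Q21,D0]),(8,[Q21,Q21,D2]),(-4,[Q21,Q22,D1]),
       (4,[Q21,Zb0]),(-4,[Q22,Q22,D0]),(-8,[D0,Y11]),(4,[D0,Y22]),(8,[D1,Y10]),(-4,[D2,Y20])]),
     (Zb1,[(12,[Q11,Q11,D1]),(-12,[Q11,Q12,D0]),(-8,[Q11,Q21,D2]),(4,[Q11,Q22,D1]),(2,[Q11,Zb0]),
       (4,[Q12,Q22,D0]),(6,[Q21,Zb1]),(8,[D0,Y01]),(-8,[D1,Y00]),(-8,[D1,Y11]),(8,[D2,Y10])]),
     (W00,[(4,[Q11,C1,D0]),(-8,[Q11,C2,D1]),(-6,[Q11,W10]),(4,[Q12,C3,D1]),(-4,[Q21,C0,D0]),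
       (16,[Q21,C1,D1]),(-8,[Q21,C2,D2]),(-8,[Q22,C1,D0]),(4,[Q22,C2,D1]),(2,[C2,Zb0]),
       (-2,[C3,Zb1]),(-2,[D0,Z0]),(-2,[D1,Z1]),(6,[Y00,Y21]),(-6,[Y01,Y20])]),
     (W01,[(12,[Q11,C1,D1]),(-8,[Q11,C2,D2]),(12,[Q11,W00]),(-4,[Q12,C1,D0]),(-12,[Q21,C0,D1]),
       (24,[Q21,C1,D2]),(-6,[Q21,W01]),(4,[Q22,C0,D0]),(-16,[Q22,C1,D1]),(-8,[C1,Zb0]),
       (4,[D2,Z1]),(-12,[Y00,Y11]),(6,[Y00,Y22]),(12,[Y01,Y10]),(-6,[Y02,Y20])]),
     (W10,[(8,[Q11,C2,D0]),(4,[Q11,C3,D1]),(-12,[Q12,C3,D0]),(-8,[Q21,C1,D0]),(12,[Q21,C2,D1]),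
       (6,[Q21,W10]),(-4,[Q22,C2,D0]),(4,[D0,Z1]),(-12,[Y10,Y21]),(12,[Y11,Y20])])]"
| "row Y11 =
    [(Y12,[(-3,[Q11,Y12]),(6,[Q12,Y11]),(-3,[Q22,Y12]),(2,[C1,D2]),(-2,[C2,D3]),(1,[W01])]),
     (Y20,[(-6,[Q21,Y10]),(6,[Q21,Y21]),(-4,[C2,D0]),(4,[C3,D1])]),
     (Y21,[(3,[Q11,Y21]),(-6,[Q21,Y11]),(3,[Q22,Y21]),(-2,[C2,D1]),(2,[C3,D2]),(-1,[W10])]),
     (Y22,[(6,[Q12,Y21]),(-6,[Q21,Y12])]),
     (Z0,[(8,[Q11,Q12,C2]),(-3,[Q11,Z0]),(-4,[Q12,Q12,C3]),(-4,[Q12,Q21,C1]),(-4,[Q12,Q22,C2]),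
       (-1,[Q12,Z1]),(-4,[Q21,Q22,C0]),(8,[Q22,Q22,C1]),(-2,[Q22,Z0]),(4,[C0,Y21]),(-6,[C1,Y22]),
       (-4,[C2,Y01]),(4,[C2,Y12]),(2,[C3,Y02])]),
     (Z1,[(-8,[Q11,Q11,C2]),(4,[Q11,Q12,C3]),(4,[Q11,Q21,C1]),(-2,[Q11,Z1]),(4,[Q12,Q21,C2]),
       (4,[Q21,Q21,C0]),(-8,[Q21,Q22,C1]),(-1,[Q21,Z0]),(-3,[Q22,Z1]),(-2,[C0,Y20]),(-4,[C1,Y10]),
       (4,[C1,Y21]),(6,[C2,Y00]),(-4,[C3,Y01])]),
     (Zb0,[(-8,[Q11,Q21,D2]),(3,[Q11,Zb0]),(4,[Q12,Q21,D1]),(4,[Q12,Q22,D0]),(4,[Q21,Q21,D3]),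
       (4,[Q21,Q22,D2]),(1,[Q21,Zb1]),(-8,[Q22,Q22,D1]),(2,[Q22,Zb0]),(-4,[D0,Y12]),(6,[D1,Y22]),
       (4,[D2,Y10]),(-4,[D2,Y21]),(-2,[D3,Y20])]),
     (Zb1,[(8,[Q11,Q11,D2]),(-4,[Q11,Q12,D1]),(-4,[Q11,Q21,D3]),(2,[Q11,Zb1]),(-4,[Q12,Q12,D0]),
       (-4,[Q12,Q21,D2]),(8,[Q12,Q22,D1]),(1,[Q12,Zb0]),(3,[Q22,Zb1]),(2,[D0,Y02]),(4,[D1,Y01]),
       (-4,[D1,Y12]),(-6,[D2,Y00]),(4,[D3,Y10])]),
     (W00,[(4,[Q12,C1,D0]),(-8,[Q12,C2,D1]),(4,[Q12,C3,D2]),(-3,[Q12,W10]),(-4,[Q21,C0,D1]),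
       (8,[Q21,C1,D2]),(-4,[Q21,C2,D3]),(3,[Q21,W01]),(2,[C1,Zb0]),(2,[C2,Zb1]),(-2,[D1,Z0]),
       (-2,[D2,Z1])]),
     (W01,[(4,[Q11,C1,D2]),(-4,[Q11,C2,D3]),(3,[Q11,W01]),(4,[Q12,C1,D1]),(-4,[Q12,C2,D2]),
       (6,[Q12,W00]),(-12,[Q21,C0,D2]),(12,[Q21,C1,D3]),(4,[Q22,C0,D1]),(-4,[Q22,C1,D2]),
       (-3,[Q22,W01]),(2,[C0,Zb0]),(-2,[C1,Zb1]),(-2,[D2,Z0]),(2,[D3,Z1]),(-6,[Y00,Y12]),
       (6,[Y01,Y22]),(6,[Y02,Y10]),(-6,[Y02,Y21])]),
     (W10,[(-4,[Q11,C2,D1]),(4,[Q11,C3,D2]),(-3,[Q11,W10]),(12,[Q12,C2,D0]),(-12,[Q12,C3,D1]),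
       (-4,[Q21,C1,D1]),(4,[Q21,C2,D2]),(-6,[Q21,W00]),(-4,[Q22,C1,D0]),(4,[Q22,C2,D1]),
       (3,[Q22,W10]),(2,[C2,Zb0]),(-2,[C3,Zb1]),(-2,[D0,Z0]),(2,[D1,Z1]),(6,[Y00,Y21]),
       (-6,[Y01,Y20]),(-6,[Y10,Y22]),(6,[Y12,Y20])])]"
| "row Y12 =
    [(Y20,[(6,[Q21,Y22]),(-12,[Q22,Y10]),(-8,[C2,D1]),(4,[C3,D2]),(2,[W10])]),
     (Y21,[(3,[Q11,Y22]),(-12,[Q22,Y11]),(3,[Q22,Y22]),(-6,[C2,D2]),(2,[C3,D3])]),
     (Y22,[(6,[Q12,Y22]),(-12,[Q22,Y12]),(-4,[C2,D3])]),
     (Z0,[(16,[Q12,Q12,C2]),(-8,[Q12,Q22,C1]),(-4,[Q12,Z0]),(-8,[Q22,Q22,C0]),(6,[C0,Y22]),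
       (4,[C1,Y12]),(-10,[C2,Y02])]),
     (Z1,[(-16,[Q11,Q12,C2]),(8,[Q11,Q22,C1]),(-2,[Q11,Z0]),(-6,[Q12,Z1]),(8,[Q21,Q22,C0]),
       (-4,[C0,Y21]),(-8,[C1,Y11]),(-2,[C1,Y22]),(12,[C2,Y01]),(4,[C2,Y12]),(-2,[C3,Y02])]),
     (Zb0,[(-4,[Q11,Q21,D3]),(-4,[Q11,Q22,D2]),(8,[Q12,Q22,D1]),(6,[Q12,Zb0]),(12,[Q21,Q22,D3]),
       (-12,[Q22,Q22,D2]),(2,[Q22,Zb1]),(-8,[D1,Y12]),(8,[D2,Y11]),(8,[D2,Y22]),(-8,[D3,Y21])]),
     (Zb1,[(4,[Q11,Q11,D3]),(4,[Q11,Q12,D2]),(-4,[Q11,Q22,D3]),(-8,[Q12,Q12,D1]),(-8,[Q12,Q21,D3]),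
       (12,[Q12,Q22,D2]),(4,[Q12,Zb1]),(4,[D1,Y02]),(-8,[D2,Y12]),(-4,[D3,Y00]),(8,[D3,Y11])]),
     (W00,[(-4,[Q11,C1,D2]),(8,[Q11,C2,D3]),(8,[Q12,C1,D1]),(-16,[Q12,C2,D2]),(4,[Q12,C3,D3]),
       (-4,[Q21,C0,D2]),(8,[Q22,C1,D2]),(-4,[Q22,C2,D3]),(6,[Q22,W01]),(-2,[C0,Zb0]),(2,[C1,Zb1]),
       (-2,[D2,Z0]),(-2,[D3,Z1]),(-6,[Y01,Y22]),(6,[Y02,Y21])]),
     (W01,[(-4,[Q11,C1,D3]),(12,[Q12,C1,D2]),(-8,[Q12,C2,D3]),(6,[Q12,W01]),(-12,[Q21,C0,D3]),
       (4,[Q22,C0,D2]),(8,[Q22,C1,D3]),(-4,[D3,Z0]),(-12,[Y01,Y12]),(12,[Y02,Y11])]),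
     (W10,[(-16,[Q11,C2,D2]),(4,[Q11,C3,D3]),(24,[Q12,C2,D1]),(-12,[Q12,C3,D2]),(-6,[Q12,W10]),
       (-4,[Q21,C2,D3]),(-8,[Q22,C1,D1]),(12,[Q22,C2,D2]),(-12,[Q22,W00]),(8,[C2,Zb1]),
       (-4,[D1,Z0]),(6,[Y00,Y22]),(-6,[Y02,Y20]),(-12,[Y11,Y22]),(12,[Y12,Y21])])]"
| "row Y20 =
    [(Y21,[(6,[Q21,Y20]),(4,[C3,D0])]),
     (Y22,[(12,[Q22,Y20]),(8,[C3,D1])]),
     (Z0,[(-16,[Q11,Q22,C3]),(-8,[Q12,Q21,C3]),(24,[Q21,Q22,C2]),(4,[C1,Y20]),(-8,[C2,Y10]),
       (-16,[C2,Y21]),(4,[C3,Y00]),(16,[C3,Y11])]),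
     (Z1,[(24,[Q11,Q21,C3]),(-24,[Q21,Q21,C2]),(16,[C2,Y20]),(-16,[C3,Y10])]),
     (Zb0,[(-24,[Q21,Q21,D1]),(24,[Q21,Q22,D0]),(-16,[D0,Y21]),(16,[D1,Y20])]),
     (Zb1,[(24,[Q11,Q21,D1]),(-16,[Q11,Q22,D0]),(-8,[Q12,Q21,D0]),(16,[D0,Y11]),(4,[D0,Y22]),
       (-16,[D1,Y10]),(-8,[D1,Y21]),(4,[D2,Y20])]),
     (W00,[(8,[Q11,C2,D0]),(-16,[Q11,C3,D1]),(8,[Q12,C3,D0]),(-8,[Q21,C1,D0]),(24,[Q21,C2,D1]),
       (-8,[Q21,C3,D2]),(-12,[Q21,W10]),(-16,[Q22,C2,D0]),(8,[Q22,C3,D1]),(4,[C3,Zb0]),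
       (-4,[D0,Z1]),(24,[Y10,Y21]),(-24,[Y11,Y20])]),
     (W01,[(24,[Q11,C2,D1]),(-8,[Q11,C3,D2]),(-8,[Q12,C2,D0]),(8,[Q12,C3,D1]),(-24,[Q21,C1,D1]),
       (24,[Q21,C2,D2]),(24,[Q21,W00]),(8,[Q22,C1,D0]),(-24,[Q22,C2,D1]),(-12,[C2,Zb0]),
       (-4,[C3,Zb1]),(-4,[D0,Z0]),(-12,[D1,Z1]),(-12,[Y00,Y21]),(12,[Y01,Y20]),(12,[Y10,Y22]),
       (-12,[Y12,Y20])]),
     (W10,[(16,[Q11,C3,D0]),(-16,[Q21,C2,D0]),(16,[Q21,C3,D1]),(-16,[Q22,C3,D0])])]"
| "row Y21 =
    [(Y22,[(-6,[Q21,Y22]),(12,[Q22,Y21]),(4,[C3,D2])]),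
     (Z0,[(4,[Q11,Q12,C3]),(4,[Q11,Q22,C2]),(-12,[Q12,Q22,C3]),(-8,[Q21,Q22,C1]),(-6,[Q21,Z0]),
       (12,[Q22,Q22,C2]),(-2,[Q22,Z1]),(8,[C1,Y21]),(-8,[C2,Y11]),(-8,[C2,Y22]),(8,[C3,Y12])]),
     (Z1,[(-4,[Q11,Q11,C3]),(-4,[Q11,Q21,C2]),(4,[Q11,Q22,C3]),(8,[Q12,Q21,C3]),(8,[Q21,Q21,C1]),
       (-12,[Q21,Q22,C2]),(-4,[Q21,Z1]),(-4,[C1,Y20]),(8,[C2,Y21]),(4,[C3,Y00]),(-8,[C3,Y11])]),
     (Zb0,[(-16,[Q21,Q21,D2]),(8,[Q21,Q22,D1]),(4,[Q21,Zb0]),(8,[Q22,Q22,D0]),(-6,[D0,Y22]),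
       (-4,[D1,Y21]),(10,[D2,Y20])]),
     (Zb1,[(16,[Q11,Q21,D2]),(-8,[Q11,Q22,D1]),(2,[Q11,Zb0]),(-8,[Q12,Q22,D0]),(6,[Q21,Zb1]),
       (4,[D0,Y12]),(8,[D1,Y11]),(2,[D1,Y22]),(-12,[D2,Y10]),(-4,[D2,Y21]),(2,[D3,Y20])]),
     (W00,[(4,[Q11,C2,D1]),(-8,[Q11,C3,D2]),(4,[Q12,C2,D0]),(-8,[Q21,C1,D1]),(16,[Q21,C2,D2]),
       (-4,[Q21,C3,D3]),(-8,[Q22,C2,D1]),(4,[Q22,C3,D2]),(-6,[Q22,W10]),(2,[C2,Zb0]),(2,[C3,Zb1]),
       (2,[D0,Z0]),(-2,[D1,Z1]),(6,[Y10,Y22]),(-6,[Y12,Y20])]),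
     (W01,[(16,[Q11,C2,D2]),(-4,[Q11,C3,D3]),(4,[Q12,C3,D2]),(-24,[Q21,C1,D2]),(12,[Q21,C2,D3]),
       (6,[Q21,W01]),(8,[Q22,C1,D1]),(-12,[Q22,C2,D2]),(12,[Q22,W00]),(4,[C1,Zb0]),(-8,[D2,Z1]),
       (-6,[Y00,Y22]),(6,[Y02,Y20]),(12,[Y11,Y22]),(-12,[Y12,Y21])]),
     (W10,[(4,[Q11,C3,D1]),(12,[Q12,C3,D0]),(-12,[Q21,C2,D1]),(8,[Q21,C3,D2]),(-6,[Q21,W10]),
       (-4,[Q22,C2,D0]),(-8,[Q22,C3,D1]),(4,[C3,Zb0]),(12,[Y10,Y21]),(-12,[Y11,Y20])])]"
| "row Y22 =
    [(Z0,[(8,[Q12,Q12,C3]),(8,[Q12,Q22,C2]),(-16,[Q22,Q22,C1]),(-8,[Q22,Z0]),(12,[C1,Y22]),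
       (-8,[C2,Y12]),(-4,[C3,Y02])]),
     (Z1,[(-8,[Q11,Q12,C3]),(-8,[Q12,Q21,C2]),(16,[Q21,Q22,C1]),(-4,[Q21,Z0]),(-12,[Q22,Z1]),
       (-8,[C1,Y21]),(8,[C3,Y01])]),
     (Zb0,[(-8,[Q21,Q21,D3]),(-8,[Q21,Q22,D2]),(16,[Q22,Q22,D1]),(8,[Q22,Zb0]),(-12,[D1,Y22]),
       (8,[D2,Y21]),(4,[D3,Y20])]),
     (Zb1,[(8,[Q11,Q21,D3]),(8,[Q12,Q21,D2]),(-16,[Q12,Q22,D1]),(4,[Q12,Zb0]),(12,[Q22,Zb1]),
       (8,[D1,Y12]),(-8,[D3,Y10])]),
     (W00,[(8,[Q12,C2,D1]),(-8,[Q12,C3,D2]),(-8,[Q21,C1,D2]),(8,[Q21,C2,D3]),(-4,[C1,Zb0]),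
       (4,[D1,Z0])]),
     (W01,[(8,[Q11,C2,D3]),(8,[Q12,C2,D2]),(-24,[Q21,C1,D3]),(8,[Q22,C1,D2]),(12,[Q22,W01]),
       (4,[D2,Z0]),(-4,[D3,Z1]),(-12,[Y01,Y22]),(12,[Y02,Y21])]),
     (W10,[(-8,[Q11,C3,D2]),(24,[Q12,C3,D1]),(-8,[Q21,C2,D2]),(-8,[Q22,C2,D1]),(-12,[Q22,W10]),
       (-4,[C2,Zb0]),(4,[C3,Zb1]),(12,[Y10,Y22]),(-12,[Y12,Y20])])]"
| "row Z0 =
    [(Z1,[(8,[Q11,C0,C3]),(-8,[Q11,C1,C2]),(16,[Q12,C1,C3]),(-16,[Q12,C2,C2]),(-16,[Q21,C0,C2]),
       (16,[Q21,C1,C1]),(-8,[Q22,C0,C3]),(8,[Q22,C1,C2])]),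
     (Zb0,[(8,[Q11,C2,D2]),(8,[Q11,C3,D3]),(16,[Q12,Q21,Y11]),(16,[Q12,Q21,Y22]),(-16,[Q12,Q22,Y10]),
       (-16,[Q12,Q22,Y21]),(-8,[Q12,C2,D1]),(-8,[Q12,C3,D2]),(4,[Q12,W10]),(-16,[Q21,Q22,Y01]),
       (-16,[Q21,Q22,Y12]),(-8,[Q21,C1,D2]),(-8,[Q21,C2,D3]),(4,[Q21,W01]),(16,[Q22,Q22,Y00]),
       (16,[Q22,Q22,Y11]),(8,[Q22,C1,D1]),(8,[Q22,C2,D2]),(-8,[Q22,W00]),(-4,[C1,Zb0]),
       (-4,[C2,Zb1]),(-4,[D1,Z0]),(-4,[D2,Z1]),(-6,[Y00,Y22]),(6,[Y02,Y20]),(-24,[Y11,Y22]),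
       (24,[Y12,Y21])]),
     (Zb1,[(-16,[Q11,Q12,Y11]),(-16,[Q11,Q12,Y22]),(16,[Q11,Q22,Y01]),(16,[Q11,Q22,Y12]),
       (-8,[Q11,C1,D2]),(-8,[Q11,C2,D3]),(-4,[Q11,W01]),(16,[Q12,Q12,Y10]),(16,[Q12,Q12,Y21]),
       (-16,[Q12,Q22,Y00]),(-16,[Q12,Q22,Y11]),(8,[Q12,C1,D1]),(8,[Q12,C2,D2]),(8,[Q21,C0,D2]),
       (8,[Q21,C1,D3]),(-8,[Q22,C0,D1]),(-8,[Q22,C1,D2]),(-4,[Q22,W01]),(4,[C0,Zb0]),(4,[C1,Zb1]),
       (-4,[D2,Z0]),(-4,[D3,Z1]),(12,[Y00,Y12]),(12,[Y01,Y22]),(-12,[Y02,Y10]),(-12,[Y02,Y21])]),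
     (W00,[(48,[Q11,Q12,Q22,C2]),(-48,[Q11,Q22,Q22,C1]),(-6,[Q11,Q22,Z0]),(36,[Q11,C1,Y22]),
       (-24,[Q11,C2,Y12]),(-12,[Q11,C3,Y02]),(-48,[Q12,Q12,Q21,C2]),(48,[Q12,Q21,Q22,C1]),
       (-6,[Q12,Q21,Z0]),(-12,[Q12,Q22,Z1]),(-8,[Q12,C0,Y20]),(8,[Q12,C1,Y10]),(-40,[Q12,C1,Y21]),
       (32,[Q12,C2,Y11]),(8,[Q12,C2,Y22]),(8,[Q12,C3,Y01]),(-8,[Q12,C3,Y12]),(-12,[Q21,C0,Y22]),
       (-24,[Q21,C1,Y12]),(36,[Q21,C2,Y02]),(8,[Q22,C0,Y10]),(16,[Q22,C0,Y21]),(-8,[Q22,C1,Y00]),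
       (16,[Q22,C1,Y11]),(-32,[Q22,C2,Y01]),(-8,[Q22,C2,Y12]),(8,[Q22,C3,Y02]),(8,[C0,C2,D1]),
       (-4,[C0,W10]),(-8,[C1,C1,D1]),(-8,[C1,C3,D3]),(8,[C1,W00]),(8,[C2,C2,D3]),(4,[C2,W01]),
       (6,[Y00,Z0]),(12,[Y11,Z0]),(12,[Y12,Z1]),(-6,[Y22,Z0])]),
     (W01,[(-48,[Q11,Q12,Q22,C1]),(12,[Q11,Q12,Z0]),(48,[Q11,Q22,Q22,C0]),(-24,[Q11,C0,Y22]),
       (24,[Q11,C2,Y02]),(48,[Q12,Q12,Q21,C1]),(12,[Q12,Q12,Z1]),(-48,[Q12,Q21,Q22,C0]),
       (8,[Q12,C0,Y21]),(16,[Q12,C1,Y11]),(-20,[Q12,C1,Y22]),(-24,[Q12,C2,Y01]),(24,[Q12,C2,Y12]),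
       (-4,[Q12,C3,Y02]),(48,[Q21,C0,Y12]),(-48,[Q21,C1,Y02]),(-32,[Q22,C0,Y11]),(4,[Q22,C0,Y22]),
       (32,[Q22,C1,Y01]),(8,[Q22,C1,Y12]),(-12,[Q22,C2,Y02]),(16,[C0,C2,D2]),(8,[C0,C3,D3]),
       (-16,[C1,C1,D2]),(-8,[C1,C2,D3]),(-12,[Y02,Z1]),(12,[Y12,Z0])]),
     (W10,[(48,[Q11,Q12,Q22,C3]),(-48,[Q11,Q22,Q22,C2]),(48,[Q11,C2,Y22]),(-48,[Q11,C3,Y12]),
       (-48,[Q12,Q12,Q21,C3]),(48,[Q12,Q21,Q22,C2]),(-12,[Q12,C1,Y20]),(8,[Q12,C2,Y10]),
       (-64,[Q12,C2,Y21]),(4,[Q12,C3,Y00]),(64,[Q12,C3,Y11]),(-12,[Q21,Q22,Z0]),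
       (-24,[Q21,C1,Y22]),(24,[Q21,C3,Y02]),(-12,[Q22,Q22,Z1]),(-4,[Q22,C0,Y20]),
       (24,[Q22,C1,Y10]),(24,[Q22,C1,Y21]),(-20,[Q22,C2,Y00]),(16,[Q22,C2,Y11]),
       (-40,[Q22,C3,Y01]),(8,[C0,C3,D1]),(-8,[C1,C2,D1]),(16,[C1,C3,D2]),(-8,[C1,W10]),
       (-16,[C2,C2,D2]),(16,[C2,W00]),(8,[C3,W01]),(12,[Y10,Z0]),(24,[Y21,Z0]),(12,[Y22,Z1])])]"
| "row Z1 =
    [(Zb0,[(-16,[Q11,Q21,Y11]),(-16,[Q11,Q21,Y22]),(16,[Q11,Q22,Y10]),(16,[Q11,Q22,Y21]),
       (-8,[Q11,C2,D1]),(-8,[Q11,C3,D2]),(-4,[Q11,W10]),(8,[Q12,C2,D0]),(8,[Q12,C3,D1]),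
       (16,[Q21,Q21,Y01]),(16,[Q21,Q21,Y12]),(-16,[Q21,Q22,Y00]),(-16,[Q21,Q22,Y11]),
       (8,[Q21,C1,D1]),(8,[Q21,C2,D2]),(-8,[Q22,C1,D0]),(-8,[Q22,C2,D1]),(-4,[Q22,W10]),
       (-4,[C2,Zb0]),(-4,[C3,Zb1]),(4,[D0,Z0]),(4,[D1,Z1]),(12,[Y00,Y21]),(-12,[Y01,Y20]),
       (12,[Y10,Y22]),(-12,[Y12,Y20])]),
     (Zb1,[(16,[Q11,Q11,Y11]),(16,[Q11,Q11,Y22]),(-16,[Q11,Q12,Y10]),(-16,[Q11,Q12,Y21]),
       (-16,[Q11,Q21,Y01]),(-16,[Q11,Q21,Y12]),(8,[Q11,C1,D1]),(8,[Q11,C2,D2]),(8,[Q11,W00]),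
       (16,[Q12,Q21,Y00]),(16,[Q12,Q21,Y11]),(-8,[Q12,C1,D0]),(-8,[Q12,C2,D1]),(4,[Q12,W10]),
       (-8,[Q21,C0,D1]),(-8,[Q21,C1,D2]),(4,[Q21,W01]),(8,[Q22,C0,D0]),(8,[Q22,C1,D1]),
       (4,[C1,Zb0]),(4,[C2,Zb1]),(4,[D1,Z0]),(4,[D2,Z1]),(-24,[Y00,Y11]),(-6,[Y00,Y22]),
       (24,[Y01,Y10]),(6,[Y02,Y20])]),
     (W00,[(-48,[Q11,Q11,Q22,C2]),(48,[Q11,Q12,Q21,C2]),(48,[Q11,Q21,Q22,C1]),(12,[Q11,Q21,Z0]),
       (6,[Q11,Q22,Z1]),(8,[Q11,C0,Y20]),(-8,[Q11,C1,Y10]),(-32,[Q11,C1,Y21]),(16,[Q11,C2,Y11]),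
       (-8,[Q11,C2,Y22]),(16,[Q11,C3,Y01]),(8,[Q11,C3,Y12]),(-48,[Q12,Q21,Q21,C1]),
       (6,[Q12,Q21,Z1]),(36,[Q12,C1,Y20]),(-24,[Q12,C2,Y10]),(-12,[Q12,C3,Y00]),(-8,[Q21,C0,Y10]),
       (8,[Q21,C0,Y21]),(8,[Q21,C1,Y00]),(32,[Q21,C1,Y11]),(-40,[Q21,C2,Y01]),(8,[Q21,C2,Y12]),
       (-8,[Q21,C3,Y02]),(-12,[Q22,C0,Y20]),(-24,[Q22,C1,Y10]),(36,[Q22,C2,Y00]),(-8,[C0,C2,D0]),
       (8,[C1,C1,D0]),(8,[C1,C3,D2]),(4,[C1,W10]),(-8,[C2,C2,D2]),(-8,[C2,W00]),(-4,[C3,W01]),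
       (6,[Y00,Z1]),(-12,[Y10,Z0]),(-12,[Y11,Z1]),(-6,[Y22,Z1])]),
     (W01,[(48,[Q11,Q11,Q22,C1]),(-12,[Q11,Q11,Z0]),(-48,[Q11,Q12,Q21,C1]),(-12,[Q11,Q12,Z1]),
       (-48,[Q11,Q21,Q22,C0]),(40,[Q11,C0,Y21]),(-16,[Q11,C1,Y11]),(20,[Q11,C1,Y22]),
       (-24,[Q11,C2,Y01]),(-24,[Q11,C2,Y12]),(4,[Q11,C3,Y02]),(48,[Q12,Q21,Q21,C0]),
       (-24,[Q12,C0,Y20]),(24,[Q12,C2,Y00]),(-64,[Q21,C0,Y11]),(-4,[Q21,C0,Y22]),
       (64,[Q21,C1,Y01]),(-8,[Q21,C1,Y12]),(12,[Q21,C2,Y02]),(48,[Q22,C0,Y10]),(-48,[Q22,C1,Y00]),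
       (-16,[C0,C2,D1]),(-8,[C0,C3,D2]),(-8,[C0,W10]),(16,[C1,C1,D1]),(8,[C1,C2,D2]),
       (16,[C1,W00]),(8,[C2,W01]),(12,[Y00,Z0]),(24,[Y01,Z1]),(12,[Y12,Z1])]),
     (W10,[(-48,[Q11,Q11,Q22,C3]),(48,[Q11,Q12,Q21,C3]),(48,[Q11,Q21,Q22,C2]),(12,[Q11,C1,Y20]),
       (-8,[Q11,C2,Y10]),(-32,[Q11,C2,Y21]),(-4,[Q11,C3,Y00]),(32,[Q11,C3,Y11]),
       (-48,[Q12,Q21,Q21,C2]),(48,[Q12,C2,Y20]),(-48,[Q12,C3,Y10]),(12,[Q21,Q21,Z0]),
       (12,[Q21,Q22,Z1]),(4,[Q21,C0,Y20]),(-24,[Q21,C1,Y10]),(24,[Q21,C1,Y21]),(20,[Q21,C2,Y00]),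
       (-16,[Q21,C2,Y11]),(-8,[Q21,C3,Y01]),(-24,[Q22,C1,Y20]),(24,[Q22,C3,Y00]),(-8,[C0,C3,D0]),
       (8,[C1,C2,D0]),(-16,[C1,C3,D1]),(16,[C2,C2,D1]),(12,[Y10,Z1]),(-12,[Y20,Z0])])]"
| "row Zb0 =
    [(Zb1,[(-8,[Q11,D0,D3]),(8,[Q11,D1,D2]),(16,[Q12,D0,D2]),(-16,[Q12,D1,D1]),(-16,[Q21,D1,D3]),
       (16,[Q21,D2,D2]),(8,[Q22,D0,D3]),(-8,[Q22,D1,D2])]),
     (W00,[(-48,[Q11,Q21,Q22,D2]),(48,[Q11,Q22,Q22,D1]),(6,[Q11,Q22,Zb0]),(-36,[Q11,D1,Y22]),
       (24,[Q11,D2,Y21]),(12,[Q11,D3,Y20]),(48,[Q12,Q21,Q21,D2]),(-48,[Q12,Q21,Q22,D1]),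
       (6,[Q12,Q21,Zb0]),(12,[Q12,D0,Y22]),(24,[Q12,D1,Y21]),(-36,[Q12,D2,Y20]),
       (12,[Q21,Q22,Zb1]),(8,[Q21,D0,Y02]),(-8,[Q21,D1,Y01]),(40,[Q21,D1,Y12]),(-32,[Q21,D2,Y11]),
       (-8,[Q21,D2,Y22]),(-8,[Q21,D3,Y10]),(8,[Q21,D3,Y21]),(-8,[Q22,D0,Y01]),(-16,[Q22,D0,Y12]),
       (8,[Q22,D1,Y00]),(-16,[Q22,D1,Y11]),(32,[Q22,D2,Y10]),(8,[Q22,D2,Y21]),(-8,[Q22,D3,Y20]),
       (-8,[C1,D0,D2]),(8,[C1,D1,D1]),(8,[C3,D1,D3]),(-8,[C3,D2,D2]),(4,[D0,W01]),(-8,[D1,W00]),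
       (-4,[D2,W10]),(-6,[Y00,Zb0]),(-12,[Y11,Zb0]),(-12,[Y21,Zb1]),(6,[Y22,Zb0])]),
     (W01,[(-48,[Q11,Q21,Q22,D3]),(48,[Q11,Q22,Q22,D2]),(-48,[Q11,D2,Y22]),(48,[Q11,D3,Y21]),
       (48,[Q12,Q21,Q21,D3]),(-48,[Q12,Q21,Q22,D2]),(12,[Q12,Q22,Zb0]),(24,[Q12,D1,Y22]),
       (-24,[Q12,D3,Y20]),(12,[Q21,D1,Y02]),(-8,[Q21,D2,Y01]),(64,[Q21,D2,Y12]),(-4,[Q21,D3,Y00]),
       (-64,[Q21,D3,Y11]),(12,[Q22,Q22,Zb1]),(4,[Q22,D0,Y02]),(-24,[Q22,D1,Y01]),
       (-24,[Q22,D1,Y12]),(20,[Q22,D2,Y00]),(-16,[Q22,D2,Y11]),(40,[Q22,D3,Y10]),(-8,[C1,D0,D3]),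
       (8,[C1,D1,D2]),(-16,[C2,D1,D3]),(16,[C2,D2,D2]),(8,[D1,W01]),(-16,[D2,W00]),(-8,[D3,W10]),
       (-12,[Y01,Zb0]),(-24,[Y12,Zb0]),(-12,[Y22,Zb1])]),
     (W10,[(48,[Q11,Q21,Q22,D1]),(-12,[Q11,Q21,Zb0]),(-48,[Q11,Q22,Q22,D0]),(24,[Q11,D0,Y22]),
       (-24,[Q11,D2,Y20]),(-48,[Q12,Q21,Q21,D1]),(48,[Q12,Q21,Q22,D0]),(-48,[Q12,D0,Y21]),
       (48,[Q12,D1,Y20]),(-12,[Q21,Q21,Zb1]),(-8,[Q21,D0,Y12]),(-16,[Q21,D1,Y11]),
       (20,[Q21,D1,Y22]),(24,[Q21,D2,Y10]),(-24,[Q21,D2,Y21]),(4,[Q21,D3,Y20]),(32,[Q22,D0,Y11]),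
       (-4,[Q22,D0,Y22]),(-32,[Q22,D1,Y10]),(-8,[Q22,D1,Y21]),(12,[Q22,D2,Y20]),(-16,[C2,D0,D2]),
       (16,[C2,D1,D1]),(-8,[C3,D0,D3]),(8,[C3,D1,D2]),(12,[Y20,Zb1]),(-12,[Y21,Zb0])])]"
| "row Zb1 =
    [(W00,[(48,[Q11,Q11,Q22,D2]),(-48,[Q11,Q12,Q21,D2]),(-48,[Q11,Q12,Q22,D1]),(-12,[Q11,Q12,Zb0]),
       (-6,[Q11,Q22,Zb1]),(-8,[Q11,D0,Y02]),(8,[Q11,D1,Y01]),(32,[Q11,D1,Y12]),(-16,[Q11,D2,Y11]),
       (8,[Q11,D2,Y22]),(-16,[Q11,D3,Y10]),(-8,[Q11,D3,Y21]),(48,[Q12,Q12,Q21,D1]),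
       (-6,[Q12,Q21,Zb1]),(8,[Q12,D0,Y01]),(-8,[Q12,D0,Y12]),(-8,[Q12,D1,Y00]),(-32,[Q12,D1,Y11]),
       (40,[Q12,D2,Y10]),(-8,[Q12,D2,Y21]),(8,[Q12,D3,Y20]),(-36,[Q21,D1,Y02]),(24,[Q21,D2,Y01]),
       (12,[Q21,D3,Y00]),(12,[Q22,D0,Y02]),(24,[Q22,D1,Y01]),(-36,[Q22,D2,Y00]),(8,[C0,D0,D2]),
       (-8,[C0,D1,D1]),(-8,[C2,D1,D3]),(8,[C2,D2,D2]),(-4,[D1,W01]),(8,[D2,W00]),(4,[D3,W10]),
       (-6,[Y00,Zb1]),(12,[Y01,Zb0]),(12,[Y11,Zb1]),(6,[Y22,Zb1])]),
     (W01,[(48,[Q11,Q11,Q22,D3]),(-48,[Q11,Q12,Q21,D3]),(-48,[Q11,Q12,Q22,D2]),(-12,[Q11,D1,Y02]),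
       (8,[Q11,D2,Y01]),(32,[Q11,D2,Y12]),(4,[Q11,D3,Y00]),(-32,[Q11,D3,Y11]),
       (48,[Q12,Q12,Q21,D2]),(-12,[Q12,Q12,Zb0]),(-12,[Q12,Q22,Zb1]),(-4,[Q12,D0,Y02]),
       (24,[Q12,D1,Y01]),(-24,[Q12,D1,Y12]),(-20,[Q12,D2,Y00]),(16,[Q12,D2,Y11]),(8,[Q12,D3,Y10]),
       (-48,[Q21,D2,Y02]),(48,[Q21,D3,Y01]),(24,[Q22,D1,Y02]),(-24,[Q22,D3,Y00]),(8,[C0,D0,D3]),
       (-8,[C0,D1,D2]),(16,[C1,D1,D3]),(-16,[C1,D2,D2]),(-12,[Y01,Zb1]),(12,[Y02,Zb0])]),
     (W10,[(-48,[Q11,Q11,Q22,D1]),(12,[Q11,Q11,Zb0]),(48,[Q11,Q12,Q21,D1]),(48,[Q11,Q12,Q22,D0]),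
       (12,[Q11,Q21,Zb1]),(-40,[Q11,D0,Y12]),(16,[Q11,D1,Y11]),(-20,[Q11,D1,Y22]),
       (24,[Q11,D2,Y10]),(24,[Q11,D2,Y21]),(-4,[Q11,D3,Y20]),(-48,[Q12,Q12,Q21,D0]),
       (64,[Q12,D0,Y11]),(4,[Q12,D0,Y22]),(-64,[Q12,D1,Y10]),(8,[Q12,D1,Y21]),(-12,[Q12,D2,Y20]),
       (24,[Q21,D0,Y02]),(-24,[Q21,D2,Y00]),(-48,[Q22,D0,Y01]),(48,[Q22,D1,Y00]),(16,[C1,D0,D2]),
       (-16,[C1,D1,D1]),(8,[C2,D0,D3]),(-8,[C2,D1,D2]),(8,[D0,W01]),(-16,[D1,W00]),(-8,[D2,W10]),
       (-12,[Y00,Zb0]),(-24,[Y10,Zb1]),(-12,[Y21,Zb1])])]"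
| "row W00 =
    [(W01,[(-24,[Q11,Q11,C2,D3]),(48,[Q11,Q12,C2,D2]),(48,[Q11,Q21,C1,D3]),(-48,[Q11,Q22,C1,D2]),
       (-36,[Q11,Q22,W01]),(12,[Q11,C0,Zb0]),(12,[Q11,D3,Z1]),(36,[Q11,Y01,Y22]),
       (-36,[Q11,Y02,Y21]),(-24,[Q12,Q12,C2,D1]),(-48,[Q12,Q21,C1,D2]),(36,[Q12,Q21,W01]),
       (48,[Q12,Q22,C1,D1]),(24,[Q12,C1,Zb0]),(12,[Q12,C2,Zb1]),(-12,[Q12,D1,Z0]),
       (-24,[Q12,D2,Z1]),(-18,[Q12,Y00,Y22]),(18,[Q12,Y02,Y20]),(-24,[Q21,Q21,C0,D3]),
       (48,[Q21,Q22,C0,D2]),(12,[Q21,C0,Zb1]),(-12,[Q21,D3,Z0]),(-72,[Q21,Y01,Y12]),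
       (72,[Q21,Y02,Y11]),(-24,[Q22,Q22,C0,D1]),(-12,[Q22,C0,Zb0]),(-12,[Q22,D3,Z1]),
       (36,[Q22,Y00,Y12]),(-36,[Q22,Y02,Y10]),(-8,[C0,D0,Y12]),(16,[C0,D1,Y11]),(4,[C0,D1,Y22]),
       (-8,[C0,D2,Y10]),(-4,[C0,D3,Y20]),(8,[C1,D0,Y02]),(-16,[C1,D1,Y01]),(-16,[C1,D1,Y12]),
       (8,[C1,D2,Y00]),(16,[C1,D2,Y11]),(8,[C1,D2,Y22]),(-8,[C1,D3,Y21]),(12,[C2,D1,Y02]),
       (-16,[C2,D2,Y01]),(-16,[C2,D2,Y12]),(4,[C2,D3,Y00]),(16,[C2,D3,Y11]),(8,[C3,D2,Y02]),
       (-8,[C3,D3,Y01]),(6,[Z0,Zb1])]),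
     (W10,[(24,[Q11,Q11,C3,D2]),(-48,[Q11,Q12,C3,D1]),(-48,[Q11,Q21,C2,D2]),(48,[Q11,Q22,C2,D1]),
       (36,[Q11,Q22,W10]),(-12,[Q11,C3,Zb1]),(-12,[Q11,D0,Z0]),(-36,[Q11,Y10,Y22]),
       (36,[Q11,Y12,Y20]),(24,[Q12,Q12,C3,D0]),(48,[Q12,Q21,C2,D1]),(-36,[Q12,Q21,W10]),
       (-48,[Q12,Q22,C2,D0]),(12,[Q12,C3,Zb0]),(-12,[Q12,D0,Z1]),(72,[Q12,Y10,Y21]),
       (-72,[Q12,Y11,Y20]),(24,[Q21,Q21,C1,D2]),(-48,[Q21,Q22,C1,D1]),(12,[Q21,C1,Zb0]),
       (24,[Q21,C2,Zb1]),(-24,[Q21,D1,Z0]),(-12,[Q21,D2,Z1]),(18,[Q21,Y00,Y22]),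
       (-18,[Q21,Y02,Y20]),(24,[Q22,Q22,C1,D0]),(12,[Q22,C3,Zb1]),(12,[Q22,D0,Z0]),
       (-36,[Q22,Y00,Y21]),(36,[Q22,Y01,Y20]),(8,[C0,D0,Y21]),(-8,[C0,D1,Y20]),(-16,[C1,D0,Y11]),
       (-4,[C1,D0,Y22]),(16,[C1,D1,Y10]),(16,[C1,D1,Y21]),(-12,[C1,D2,Y20]),(8,[C2,D0,Y01]),
       (-8,[C2,D1,Y00]),(-16,[C2,D1,Y11]),(-8,[C2,D1,Y22]),(16,[C2,D2,Y10]),(16,[C2,D2,Y21]),
       (-8,[C2,D3,Y20]),(4,[C3,D0,Y02]),(8,[C3,D1,Y12]),(-4,[C3,D2,Y00]),(-16,[C3,D2,Y11]),
       (8,[C3,D3,Y10]),(-6,[Z1,Zb0])])]"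
| "row W01 =
    [(W10,[(-24,[Q11,Q11,C2,D2]),(24,[Q11,Q11,C3,D3]),(48,[Q11,Q12,C2,D1]),(-48,[Q11,Q12,C3,D2]),
       (48,[Q11,Q21,C1,D2]),(-48,[Q11,Q21,C2,D3]),(-48,[Q11,Q22,C1,D1]),(48,[Q11,Q22,C2,D2]),
       (-72,[Q11,Q22,W00]),(-12,[Q11,C1,Zb0]),(12,[Q11,C2,Zb1]),(-12,[Q11,D1,Z0]),
       (12,[Q11,D2,Z1]),(18,[Q11,Y00,Y22]),(-18,[Q11,Y02,Y20]),(-72,[Q11,Y11,Y22]),
       (72,[Q11,Y12,Y21]),(-24,[Q12,Q12,C2,D0]),(24,[Q12,Q12,C3,D1]),(-48,[Q12,Q21,C1,D1]),
       (48,[Q12,Q21,C2,D2]),(72,[Q12,Q21,W00]),(48,[Q12,Q22,C1,D0]),(-48,[Q12,Q22,C2,D1]),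
       (-36,[Q12,C2,Zb0]),(-12,[Q12,C3,Zb1]),(-12,[Q12,D0,Z0]),(-36,[Q12,D1,Z1]),
       (-36,[Q12,Y00,Y21]),(36,[Q12,Y01,Y20]),(36,[Q12,Y10,Y22]),(-36,[Q12,Y12,Y20]),
       (-24,[Q21,Q21,C0,D2]),(24,[Q21,Q21,C1,D3]),(48,[Q21,Q22,C0,D1]),(-48,[Q21,Q22,C1,D2]),
       (-12,[Q21,C0,Zb0]),(-36,[Q21,C1,Zb1]),(-36,[Q21,D2,Z0]),(-12,[Q21,D3,Z1]),
       (-36,[Q21,Y00,Y12]),(36,[Q21,Y01,Y22]),(36,[Q21,Y02,Y10]),(-36,[Q21,Y02,Y21]),
       (-24,[Q22,Q22,C0,D0]),(24,[Q22,Q22,C1,D1]),(12,[Q22,C1,Zb0]),(-12,[Q22,C2,Zb1]),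
       (12,[Q22,D1,Z0]),(-12,[Q22,D2,Z1]),(72,[Q22,Y00,Y11]),(-18,[Q22,Y00,Y22]),
       (-72,[Q22,Y01,Y10]),(18,[Q22,Y02,Y20]),(12,[C0,D0,Y22]),(-8,[C0,D1,Y21]),(-4,[C0,D2,Y20]),
       (-8,[C1,D0,Y12]),(-16,[C1,D1,Y11]),(20,[C1,D1,Y22]),(24,[C1,D2,Y10]),(-24,[C1,D2,Y21]),
       (4,[C1,D3,Y20]),(-4,[C2,D0,Y02]),(24,[C2,D1,Y01]),(-24,[C2,D1,Y12]),(-20,[C2,D2,Y00]),
       (16,[C2,D2,Y11]),(8,[C2,D3,Y10]),(4,[C3,D1,Y02]),(8,[C3,D2,Y01]),(-12,[C3,D3,Y00]),
       (6,[Z0,Zb0]),(-6,[Z1,Zb1])])]"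
| "row W10 =
    []"

primrec monomial_val :: "('v \<Rightarrow> 'r::comm_ring_1) \<Rightarrow> 'v list \<Rightarrow> 'r" where
  "monomial_val x [] = 1"
| "monomial_val x (i # m) = x i * monomial_val x m"

fun peval :: "('v \<Rightarrow> 'r::comm_ring_1) \<Rightarrow> 'v polynomial \<Rightarrow> 'r" where
  "peval x [] = 0"
| "peval x ((c, m) # p) = of_int c * monomial_val x m + peval x p"

text \<open>Here \<open>d v\<close> is the derivative of the variable \<open>v\<close>, so this is the product rule for a derivation
  determined by its values on the variables.\<close>

primrec mder :: "('v \<Rightarrow> 'r::comm_ring_1) \<Rightarrow> ('v \<Rightarrow> 'r) \<Rightarrow> 'v list \<Rightarrow> 'r" where
  "mder d x [] = 0"
| "mder d x (i # m) = d i * monomial_val x m + x i * mder d x m"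

fun pder :: "('v \<Rightarrow> 'r::comm_ring_1) \<Rightarrow> ('v \<Rightarrow> 'r) \<Rightarrow> 'v polynomial \<Rightarrow> 'r" where
  "pder d x [] = 0"
| "pder d x ((c, m) # p) = of_int c * mder d x m + pder d x p"

fun look :: "coord \<Rightarrow> (coord \<times> coord polynomial) list \<Rightarrow> coord polynomial" where
  "look j [] = []"
| "look j ((i, p) # r) = (if i = j then p else look j r)"

definition entry :: "(coord \<Rightarrow> 'r::comm_ring_1) \<Rightarrow> coord \<Rightarrow> coord \<Rightarrow> 'r" where
  "entry x i j = peval x (look j (row i)) - peval x (look i (row j))"

definition dentry ::
  "(coord \<Rightarrow> 'r::comm_ring_1) \<Rightarrow> (coord \<Rightarrow> 'r) \<Rightarrow> coord \<Rightarrow> coord \<Rightarrow> 'r" where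
  "dentry d x i j = pder d x (look j (row i)) - pder d x (look i (row j))"

text \<open>Substituting \<open>d = entry x i\<close> differentiates along the Hamiltonian vector field of the coordinate \<open>i\<close>,
  so each summand is an iterated bracket of coordinates.\<close>

definition jac :: "(coord \<Rightarrow> 'r::comm_ring_1) \<Rightarrow> coord \<Rightarrow> coord \<Rightarrow> coord \<Rightarrow> 'r" where
  "jac x i j k = dentry (entry x i) x j k + dentry (entry x j) x k i + dentry (entry x k) x i j"

text \<open>Complex conjugation exchanges the coordinates in this way, hence the real points are those with
  \<open>cnj (x i) = x (bar i)\<close>.\<close>

primrec bar :: "coord \<Rightarrow> coord" where
  "bar Q11 = Q11" | "bar Q12 = Q21" | "bar Q21 = Q12" | "bar Q22 = Q22" | "bar C0 = D0"
| "bar C1 = D1" | "bar C2 = D2" | "bar C3 = D3" | "bar D0 = C0" | "bar D1 = C1" | "bar D2 = C2"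
| "bar D3 = C3" | "bar Y00 = Y00" | "bar Y01 = Y10" | "bar Y02 = Y20" | "bar Y10 = Y01"
| "bar Y11 = Y11" | "bar Y12 = Y21" | "bar Y20 = Y02" | "bar Y21 = Y12" | "bar Y22 = Y22"
| "bar Z0 = Zb0" | "bar Z1 = Zb1" | "bar Zb0 = Z0" | "bar Zb1 = Z1" | "bar W00 = W00"
| "bar W01 = W10" | "bar W10 = W01"

text \<open>\<open>A1\<close> and \<open>A2\<close> are the complex coordinates of the symplectic vector space, \<open>B1\<close> and \<open>B2\<close> their
  conjugates.\<close>

datatype phase = A1 | A2 | B1 | B2

primrec inv_poly :: "coord \<Rightarrow> phase polynomial" where
  "inv_poly Q11 = [(1,[A1,B1])]" | "inv_poly Q12 = [(1,[A1,B2])]"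
| "inv_poly Q21 = [(1,[A2,B1])]" | "inv_poly Q22 = [(1,[A2,B2])]"
| "inv_poly C0 = [(1,[A1,A1,A1])]" | "inv_poly C1 = [(1,[A1,A1,A2])]"
| "inv_poly C2 = [(1,[A1,A2,A2])]" | "inv_poly C3 = [(1,[A2,A2,A2])]"
| "inv_poly D0 = [(1,[B1,B1,B1])]" | "inv_poly D1 = [(1,[B1,B1,B2])]"
| "inv_poly D2 = [(1,[B1,B2,B2])]" | "inv_poly D3 = [(1,[B2,B2,B2])]"
| "inv_poly Y00 = [(2,[A1,A1,B1,B1])]" | "inv_poly Y01 = [(2,[A1,A1,B1,B2])]"
| "inv_poly Y02 = [(2,[A1,A1,B2,B2])]" | "inv_poly Y10 = [(2,[A1,A2,B1,B1])]"
| "inv_poly Y11 = [(2,[A1,A2,B1,B2])]" | "inv_poly Y12 = [(2,[A1,A2,B2,B2])]"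
| "inv_poly Y20 = [(2,[A2,A2,B1,B1])]" | "inv_poly Y21 = [(2,[A2,A2,B1,B2])]"
| "inv_poly Y22 = [(2,[A2,A2,B2,B2])]" | "inv_poly Z0 = []" | "inv_poly Z1 = []"
| "inv_poly Zb0 = []" | "inv_poly Zb1 = []" | "inv_poly W00 = []" | "inv_poly W01 = []"
| "inv_poly W10 = []"

lemmas table_simps = jac_def dentry_def entry_def row.simps look.simps if_True if_False refl
  coord.distinct phase.distinct HOL.simp_thms pder.simps peval.simps mder.simps monomial_val.simps of_int_numeral
  of_int_neg_numeral of_int_1 of_int_minus mult_1_right mult_1_left mult_zero_left
  mult_zero_right add_0_right add_0_left diff_0_right diff_0

text \<open>For each fixed pair of coordinates the claim is an identity between explicit polynomials.\<close>

lemma jac_Q11: "jac x Q11 j k = (0::complex)"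
  by (induction j; induction k; simp only: table_simps; algebra?)

lemma jac_Q12: "jac x Q12 j k = (0::complex)"
  by (induction j; induction k; simp only: table_simps; algebra?)

lemma jac_Q21: "jac x Q21 j k = (0::complex)"
  by (induction j; induction k; simp only: table_simps; algebra?)

lemma jac_Q22: "jac x Q22 j k = (0::complex)"
  by (induction j; induction k; simp only: table_simps; algebra?)

lemma jac_C0: "jac x C0 j k = (0::complex)"
  by (induction j; induction k; simp only: table_simps; algebra?)

lemma jac_D0: "jac x D0 j k = (0::complex)"
  by (induction j; induction k; simp only: table_simps; algebra?)

text \<open>The sign means that the bracket multiplied by \<open>\<i>\<close> is real.\<close>

lemma entry_bar: "entry (\<lambda>i. x (bar i)) i j = - (entry x (bar i) (bar j) :: complex)"
  by (induction i; induction j; simp only: bar.simps table_simps; algebra?)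

text \<open>The real coordinate directions of the symplectic vector space, in the order \<open>x\<^sub>1, y\<^sub>1, x\<^sub>2, y\<^sub>2\<close>.\<close>

definition e1 :: "phase \<Rightarrow> complex" where "e1 p = (case p of A1 \<Rightarrow> 1 | A2 \<Rightarrow> 0 | B1 \<Rightarrow> 1 | B2 \<Rightarrow> 0)"
definition e2 :: "phase \<Rightarrow> complex" where "e2 p = (case p of A1 \<Rightarrow> \<i> | A2 \<Rightarrow> 0 | B1 \<Rightarrow> - \<i> | B2 \<Rightarrow> 0)"
definition e3 :: "phase \<Rightarrow> complex" where "e3 p = (case p of A1 \<Rightarrow> 0 | A2 \<Rightarrow> 1 | B1 \<Rightarrow> 0 | B2 \<Rightarrow> 1)"
definition e4 :: "phase \<Rightarrow> complex" where "e4 p = (case p of A1 \<Rightarrow> 0 | A2 \<Rightarrow> \<i> | B1 \<Rightarrow> 0 | B2 \<Rightarrow> - \<i>)"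

text \<open>The table restricted to the image of the invariants is the standard bracket of the invariants, up
  to the factor \<open>- \<i>\<close> that makes the bracket of real functions real.\<close>

lemma entry_invariants:
  "pder e1 x (inv_poly i) * pder e2 x (inv_poly j) - pder e2 x (inv_poly i) * pder e1 x (inv_poly j) +
   pder e3 x (inv_poly i) * pder e4 x (inv_poly j) - pder e4 x (inv_poly i) * pder e3 x (inv_poly j) =
   - \<i> * entry (\<lambda>i. peval x (inv_poly i)) i j"
  by (induction i; induction j; simp only: inv_poly.simps table_simps e1_def e2_def e3_def e4_def phase.case; algebra?)

section \<open>Taylor expansion and the theorem of Schwarz\<close>

text \<open>The \<open>d\<close>-th derivative at \<open>x\<close>, applied to \<open>d\<close> copies of \<open>v\<close>.\<close>

primrec taylor_form :: "nat \<Rightarrow> ('a::euclidean_space \<Rightarrow> real) \<Rightarrow> 'a \<Rightarrow> 'a \<Rightarrow> real" where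
  "taylor_form 0 f x v = f x"
| "taylor_form (Suc d) f x v = (\<Sum>b\<in>Basis. (v \<bullet> b) * taylor_form d (ddir b f) x v)"

lemma taylor_form_line_derivative:
  fixes f :: "'a::euclidean_space \<Rightarrow> real"
  assumes "smooth_on UNIV f"
  shows "((\<lambda>t. taylor_form d f (t *\<^sub>R v) v) has_real_derivative taylor_form (Suc d) f (t *\<^sub>R v) v) (at t)"
  using assms
proof (induction d arbitrary: f)
  case 0
  have "linear (frechet_derivative f (at (t *\<^sub>R v)))"
    using smooth_on_has_derivative[OF 0] has_derivative_linear by blast
  from linear_component_sum[OF this, of v]
  show ?case using smooth_on_line_derivative[OF 0, of 0 v t] by simp
next
  case (Suc d)
  have "((\<lambda>t. \<Sum>b\<in>Basis. (v \<bullet> b) * taylor_form d (ddir b f) (t *\<^sub>R v) v) has_real_derivative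
      (\<Sum>b\<in>Basis. (v \<bullet> b) * taylor_form (Suc d) (ddir b f) (t *\<^sub>R v) v)) (at t)"
    by (intro DERIV_sum DERIV_cmult Suc.IH smooth_on_ddir Suc.prems)
  then show ?case by (simp del: taylor_form.simps(2) add: taylor_form.simps(2)[of "Suc d"] taylor_form.simps(2)[of d f])
qed

lemma taylor_form_bounded:
  fixes f :: "'a::euclidean_space \<Rightarrow> real"
  assumes "smooth_on UNIV f"
  shows "\<exists>C\<ge>0. \<forall>x v. norm x \<le> 1 \<longrightarrow> \<bar>taylor_form d f x v\<bar> \<le> C * norm v ^ d"
  using assms
proof (induction d arbitrary: f)
  case 0
  have "continuous_on (cball 0 1) f"
    by (intro continuous_at_imp_continuous_on ballI smooth_on_isCont[OF 0]) simp
  from compact_imp_bounded[OF compact_continuous_image[OF this compact_cball]]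
  obtain C where C: "\<forall>y\<in>f ` cball 0 1. norm y \<le> C" unfolding bounded_iff by blast
  then have "\<bar>f x\<bar> \<le> C" if "norm x \<le> 1" for x using that by simp
  moreover from this[of 0] have "C \<ge> 0" by simp
  ultimately show ?case by auto
next
  case (Suc d)
  have "\<exists>C\<ge>0. \<forall>x v. norm x \<le> 1 \<longrightarrow> \<bar>taylor_form d (ddir b f) x v\<bar> \<le> C * norm v ^ d" for b
    by (rule Suc.IH[OF smooth_on_ddir[OF Suc.prems]])
  then obtain C where C: "\<And>b. C b \<ge> 0"
    "\<And>b x v. norm x \<le> 1 \<Longrightarrow> \<bar>taylor_form d (ddir b f) x v\<bar> \<le> C b * norm v ^ d" by metis
  have "\<bar>taylor_form (Suc d) f x v\<bar> \<le> (\<Sum>b\<in>Basis. C b) * norm v ^ Suc d" if "norm x \<le> 1" for x v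
  proof -
    have "\<bar>taylor_form (Suc d) f x v\<bar> \<le> (\<Sum>b\<in>Basis. norm v * (C b * norm v ^ d))"
      unfolding taylor_form.simps real_norm_def[symmetric]
    proof (rule sum_norm_le)
      fix b :: 'a assume "b \<in> Basis"
      then show "norm ((v \<bullet> b) * taylor_form d (ddir b f) x v) \<le> norm v * (C b * norm v ^ d)"
        unfolding real_norm_def abs_mult using C(2)[OF that] Basis_le_norm[of b v] by (intro mult_mono) auto
    qed
    then show ?thesis by (simp add: sum_distrib_right sum_distrib_left mult_ac)
  qed
  moreover have "(\<Sum>b\<in>Basis. C b) \<ge> 0" by (intro sum_nonneg C)
  ultimately show ?case by blast
qed

lemma taylor_expansion:
  fixes f :: "'a::euclidean_space \<Rightarrow> real"
  assumes f: "smooth_on UNIV f"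
  shows "(\<lambda>v. f v - (\<Sum>d<n. taylor_form d f 0 v / fact d)) \<in> O[nhds 0](\<lambda>v. norm v ^ n)"
proof -
  obtain C where C: "C \<ge> 0" "\<And>x v. norm x \<le> 1 \<Longrightarrow> \<bar>taylor_form n f x v\<bar> \<le> C * norm v ^ n"
    using taylor_form_bounded[OF f] by blast
  have bnd: "\<bar>f v - (\<Sum>d<n. taylor_form d f 0 v / fact d)\<bar> \<le> C * norm v ^ n" if v: "norm v \<le> 1" for v
  proof -
    have "\<exists>t. \<bar>t\<bar> \<le> \<bar>1\<bar> \<and> (\<lambda>t. f (t *\<^sub>R v)) 1 =
      (\<Sum>m<n. taylor_form m f (0 *\<^sub>R v) v / fact m * 1 ^ m) + taylor_form n f (t *\<^sub>R v) v / fact n * 1 ^ n"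
      by (rule Maclaurin_all_le) (use taylor_form_line_derivative[OF f] in auto)
    then obtain t where t: "\<bar>t\<bar> \<le> 1" "f v = (\<Sum>m<n. taylor_form m f 0 v / fact m) + taylor_form n f (t *\<^sub>R v) v / fact n"
      by auto
    have "norm (t *\<^sub>R v) \<le> 1" using t(1) v by (simp add: mult_le_one)
    from C(2)[OF this] have "\<bar>taylor_form n f (t *\<^sub>R v) v\<bar> \<le> C * norm v ^ n" .
    moreover have "\<bar>taylor_form n f (t *\<^sub>R v) v / fact n\<bar> \<le> \<bar>taylor_form n f (t *\<^sub>R v) v\<bar> / 1"
      unfolding abs_divide by (intro divide_left_mono) (auto simp: fact_ge_1)
    ultimately show ?thesis using t(2) by simp
  qed
  have "\<forall>\<^sub>F v in nhds 0. v \<in> ball (0::'a) 1" by (intro eventually_nhds_in_open) auto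
  then have "\<forall>\<^sub>F v in nhds 0. norm (f v - (\<Sum>d<n. taylor_form d f 0 v / fact d)) \<le> C * norm (norm v ^ n)"
    by eventually_elim (use bnd in simp)
  then show ?thesis by (rule bigoI)
qed

lemma cube_invariantD: "cube_invariant h \<Longrightarrow> \<zeta> ^ 3 = 1 \<Longrightarrow> h (scale2 \<zeta> z) = h z"
  unfolding cube_invariant_def by blast

text \<open>The forms are the successive derivatives of \<open>t \<mapsto> f (t v)\<close>, so uniqueness of derivatives transports
  the invariance of \<open>f\<close>.\<close>

lemma taylor_form_cube_invariant:
  assumes f: "smooth_on UNIV f" "cube_invariant f"
  shows "cube_invariant (taylor_form d f 0)"
  unfolding cube_invariant_def
proof (intro allI impI)
  fix \<zeta> z assume \<zeta>: "(\<zeta>::complex) ^ 3 = 1"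
  have "taylor_form d f (t *\<^sub>R scale2 \<zeta> z) (scale2 \<zeta> z) = taylor_form d f (t *\<^sub>R z) z" for t
  proof (induction d arbitrary: t)
    case 0
    have "t *\<^sub>R scale2 \<zeta> z = scale2 \<zeta> (t *\<^sub>R z)" by (simp add: scale2_def)
    then show ?case using cube_invariantD[OF f(2) \<zeta>] by simp
  next
    case (Suc d)
    have "((\<lambda>t. taylor_form d f (t *\<^sub>R z) z) has_real_derivative
       taylor_form (Suc d) f (t *\<^sub>R scale2 \<zeta> z) (scale2 \<zeta> z)) (at t)"
      using taylor_form_line_derivative[OF f(1), of d "scale2 \<zeta> z" t] unfolding Suc.IH .
    then show ?case using taylor_form_line_derivative[OF f(1), of d z t] by (rule DERIV_unique)
  qed
  from this[of 0] show "taylor_form d f 0 (scale2 \<zeta> z) = taylor_form d f 0 z" by simp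
qed

text \<open>Homogeneous polynomial functions on the real space are sums of monomials in the complex
  coordinates and their conjugates, on which the cyclic group acts diagonally.\<close>

definition monom2 :: "nat \<Rightarrow> nat \<Rightarrow> nat \<Rightarrow> nat \<Rightarrow> complex \<times> complex \<Rightarrow> complex" where
  "monom2 a b c e z = fst z ^ a * cnj (fst z) ^ b * snd z ^ c * cnj (snd z) ^ e"

inductive hpoly :: "nat \<Rightarrow> (complex \<times> complex \<Rightarrow> complex) \<Rightarrow> bool" where
  monom: "a + b + c + e = d \<Longrightarrow> hpoly d (\<lambda>z. k * monom2 a b c e z)"
| add: "hpoly d p \<Longrightarrow> hpoly d q \<Longrightarrow> hpoly d (\<lambda>z. p z + q z)"

lemma hpoly_mult:
  assumes "hpoly d p" "hpoly d' q" shows "hpoly (d + d') (\<lambda>z. p z * q z)"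
  using assms
proof (induction arbitrary: q)
  case (monom a b c e d k)
  show ?case using monom(2)
  proof induction
    case (monom a' b' c' e' d' k')
    have "hpoly (d + d') (\<lambda>z. (k * k') * monom2 (a + a') (b + b') (c + c') (e + e') z)"
      by (rule hpoly.monom) (use monom \<open>a + b + c + e = d\<close> in simp)
    then show ?case by (simp add: monom2_def power_add mult_ac)
  next
    case (add d' p q)
    then show ?case using hpoly.add[OF add.IH] by (simp add: distrib_left)
  qed
next
  case (add d p p')
  then show ?case using hpoly.add[OF add.IH(1,2)[OF add.prems]] by (simp add: distrib_right)
qed

lemma hpoly_zero: "hpoly d (\<lambda>z. 0)"
  using hpoly.monom[of d 0 0 0 d 0] by simp

lemma hpoly_sum: "finite I \<Longrightarrow> (\<And>i. i \<in> I \<Longrightarrow> hpoly d (p i)) \<Longrightarrow> hpoly d (\<lambda>z. \<Sum>i\<in>I. p i z)"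
  by (induction I rule: finite_induct) (auto intro: hpoly.add hpoly_zero)

lemma hpoly_coordinate:
  assumes "b \<in> Basis" shows "hpoly 1 (\<lambda>z. complex_of_real (z \<bullet> b))"
proof -
  have lin: "hpoly 1 (\<lambda>z. k1 * fst z + k2 * cnj (fst z) + k3 * snd z + k4 * cnj (snd z))" for k1 k2 k3 k4
    using hpoly.add[OF hpoly.add[OF hpoly.add[OF hpoly.monom[of 1 0 0 0 1 k1] hpoly.monom[of 0 1 0 0 1 k2]]
        hpoly.monom[of 0 0 1 0 1 k3]] hpoly.monom[of 0 0 0 1 1 k4]]
    by (simp add: monom2_def)
  have Re: "complex_of_real (Re w) = 1/2 * w + 1/2 * cnj w" for w by (simp add: complex_eq_iff)
  have Im: "complex_of_real (Im w) = - \<i>/2 * w + \<i>/2 * cnj w" for w by (simp add: complex_eq_iff)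
  consider "b = (1, 0)" | "b = (\<i>, 0)" | "b = (0, 1)" | "b = (0, \<i>)"
    using assms by (auto simp: Basis_prod_def Basis_complex_def)
  then show ?thesis
    using lin[of "1/2" "1/2" 0 0] lin[of "- \<i>/2" "\<i>/2" 0 0] lin[of 0 0 "1/2" "1/2"] lin[of 0 0 "- \<i>/2" "\<i>/2"]
    by cases (simp_all add: inner_prod_def inner_complex_def Re Im)
qed

lemma hpoly_taylor_form: "hpoly d (\<lambda>v. complex_of_real (taylor_form d f x v))"
proof (induction d arbitrary: f)
  case 0
  show ?case using hpoly.monom[of 0 0 0 0 0 "of_real (f x)"] by (simp add: monom2_def)
next
  case (Suc d)
  have "hpoly (1 + d) (\<lambda>v. \<Sum>b\<in>Basis. complex_of_real (v \<bullet> b) * of_real (taylor_form d (ddir b f) x v))"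
    by (intro hpoly_sum hpoly_mult hpoly_coordinate Suc.IH finite_Basis)
  then show ?case by simp
qed

definition \<omega>3 :: complex where "\<omega>3 = Complex (- 1 / 2) (sqrt 3 / 2)"

lemma \<omega>3: "\<omega>3 ^ 3 = 1" "cnj \<omega>3 = \<omega>3 ^ 2" "1 + \<omega>3 + \<omega>3 ^ 2 = 0"
proof -
  show 2: "cnj \<omega>3 = \<omega>3 ^ 2" "1 + \<omega>3 + \<omega>3 ^ 2 = 0"
    by (simp_all add: \<omega>3_def complex_eq_iff power2_eq_square)
  have "\<omega>3 ^ 3 - 1 = (\<omega>3 - 1) * (1 + \<omega>3 + \<omega>3 ^ 2)"
    by (simp add: power2_eq_square power3_eq_cube algebra_simps)
  then show "\<omega>3 ^ 3 = 1" unfolding 2 by simp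
qed

text \<open>The projection onto the invariants of the cyclic group.\<close>

definition average :: "(complex \<times> complex \<Rightarrow> complex) \<Rightarrow> complex \<times> complex \<Rightarrow> complex" where
  "average p z = (p z + p (scale2 \<omega>3 z) + p (scale2 (\<omega>3 ^ 2) z)) / 3"

text \<open>A monomial is an eigenvector of the group, and the sum of the powers of a nontrivial cube root of
  unity vanishes.  As \<open>cnj \<omega>3 = \<omega>3\<^sup>2\<close>, the exponents of the conjugates count twice.\<close>

lemma average_monom2:
  "average (\<lambda>z. k * monom2 a b c e z) z =
     (if 3 dvd (a + 2 * b + c + 2 * e) then k * monom2 a b c e z else 0)"
proof -
  let ?s = "a + 2 * b + c + 2 * e"
  have sc: "monom2 a b c e (scale2 (\<omega>3 ^ j) z) = (\<omega>3 ^ ?s) ^ j * monom2 a b c e z" for j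
    by (simp add: monom2_def scale2_def power_mult_distrib \<omega>3(2) power_add mult_ac flip: power_mult)
  have per: "\<omega>3 ^ ?s = \<omega>3 ^ (?s mod 3)"
    by (metis \<omega>3(1) div_mult_mod_eq mult.commute mult_1 power_add power_mult power_one)
  have *: "average (\<lambda>z. k * monom2 a b c e z) z =
      (1 + \<omega>3 ^ ?s + (\<omega>3 ^ ?s) ^ 2) / 3 * (k * monom2 a b c e z)"
    unfolding average_def using sc[of 1] sc[of 2] by (simp add: field_simps)
  consider "?s mod 3 = 0" | "?s mod 3 = 1" | "?s mod 3 = 2" by linarith
  then show ?thesis
  proof cases
    case 1
    then have "\<omega>3 ^ ?s = 1" using per by simp
    then show ?thesis unfolding * using 1 by (simp add: dvd_eq_mod_eq_0)
  next
    case 2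
    then have "\<omega>3 ^ ?s = \<omega>3" using per by simp
    then show ?thesis unfolding * using 2 \<omega>3(3) by (simp add: dvd_eq_mod_eq_0)
  next
    case 3
    then have "\<omega>3 ^ ?s = \<omega>3 ^ 2" using per by simp
    moreover have "(\<omega>3 ^ 2) ^ 2 = \<omega>3 ^ 3 * \<omega>3" by (simp add: power2_eq_square power3_eq_cube)
    then have "(\<omega>3 ^ 2) ^ 2 = \<omega>3" by (simp add: \<omega>3(1))
    ultimately have "1 + \<omega>3 ^ ?s + (\<omega>3 ^ ?s) ^ 2 = 0" using \<omega>3(3) by (simp add: add_ac)
    then show ?thesis unfolding * using 3 by (simp add: dvd_eq_mod_eq_0)
  qed
qed

text \<open>The degree of the generating invariants in the original variables; weight 0 marks the coordinates
  that do not belong to the generators.\<close>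

primrec weight :: "coord \<Rightarrow> nat" where
  "weight Q11 = 2" | "weight Q12 = 2" | "weight Q21 = 2" | "weight Q22 = 2"
| "weight C0 = 3" | "weight C1 = 3" | "weight C2 = 3" | "weight C3 = 3"
| "weight D0 = 3" | "weight D1 = 3" | "weight D2 = 3" | "weight D3 = 3"
| "weight Y00 = 0" | "weight Y01 = 0" | "weight Y02 = 0" | "weight Y10 = 0" | "weight Y11 = 0"
| "weight Y12 = 0" | "weight Y20 = 0" | "weight Y21 = 0" | "weight Y22 = 0"
| "weight Z0 = 0" | "weight Z1 = 0" | "weight Zb0 = 0" | "weight Zb1 = 0"
| "weight W00 = 0" | "weight W01 = 0" | "weight W10 = 0"

definition phase_val :: "complex \<times> complex \<Rightarrow> phase \<Rightarrow> complex" where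
  "phase_val z p = (case p of A1 \<Rightarrow> fst z | A2 \<Rightarrow> snd z | B1 \<Rightarrow> cnj (fst z) | B2 \<Rightarrow> cnj (snd z))"

definition inv_at :: "coord \<Rightarrow> complex \<times> complex \<Rightarrow> complex" where
  "inv_at A z = peval (phase_val z) (inv_poly A)"

lemma inv_at_bound: "weight A > 0 \<Longrightarrow> cmod (inv_at A z) \<le> norm z ^ weight A"
proof -
  assume A: "weight A > 0"
  have 1: "cmod (fst z) \<le> norm z" and 2: "cmod (snd z) \<le> norm z"
    using norm_fst_le[of "fst z" "snd z"] norm_snd_le[of "snd z" "fst z"] by simp_all
  have m: "x * y \<le> norm z * norm z" if "0 \<le> x" "x \<le> norm z" "0 \<le> y" "y \<le> norm z" for x y
    using that by (intro mult_mono) auto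
  have m3: "x * (x * y) \<le> norm z * (norm z * norm z)" "x * (y * y) \<le> norm z * (norm z * norm z)" if "0 \<le> x" "x \<le> norm z" "0 \<le> y" "y \<le> norm z" for x y
    using that by (auto intro!: mult_mono)
  show ?thesis using A 1 2
    by (cases A) (auto simp: inv_at_def phase_val_def norm_mult power2_eq_square power3_eq_cube mult.assoc intro!: m m3)
qed

text \<open>A smooth map that records the generating invariants, in the sense that each of them is a linear
  function of the value.\<close>

locale invariant_map =
  fixes \<Phi> :: "complex \<times> complex \<Rightarrow> 'e::euclidean_space" and L :: "coord \<Rightarrow> 'e \<Rightarrow> complex"
  assumes linear_L: "bounded_linear (L A)"
    and L_\<Phi>: "L A (\<Phi> z) = inv_at A z"
    and smooth_\<Phi>: "b \<in> Basis \<Longrightarrow> smooth_on UNIV (\<lambda>z. \<Phi> z \<bullet> b)"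
    and \<Phi>_bigo: "(\<lambda>z. norm (\<Phi> z)) \<in> O[nhds 0](norm)"
    and \<Phi>_0: "\<Phi> 0 = 0"
    and \<Phi>_invariant: "\<zeta> ^ 3 = 1 \<Longrightarrow> \<Phi> (scale2 \<zeta> z) = \<Phi> z"
begin

text \<open>Polynomials in the generators, graded twice: \<open>d\<close> is the degree in the original variables and \<open>m\<close> the
  number of generators in each product, which is the degree on the target space.\<close>

inductive gpoly :: "nat \<Rightarrow> nat \<Rightarrow> ('e \<Rightarrow> complex) \<Rightarrow> bool" where
  const: "gpoly 0 0 (\<lambda>x. k)"
| gen: "weight A > 0 \<Longrightarrow> gpoly d m g \<Longrightarrow> gpoly (weight A + d) (Suc m) (\<lambda>x. L A x * g x)"
| zero: "gpoly d m (\<lambda>x. 0)"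
| add: "gpoly d m g \<Longrightarrow> gpoly d m h \<Longrightarrow> gpoly d m (\<lambda>x. g x + h x)"

lemma gpoly_homogeneous: "gpoly d m g \<Longrightarrow> g (c *\<^sub>R x) = of_real c ^ m * g x"
proof (induction rule: gpoly.induct)
  case (gen A d m g)
  have "L A (c *\<^sub>R x) = of_real c * L A x"
    using linear_L[of A] by (simp add: linear_simps scaleR_conv_of_real)
  with gen show ?case by simp
qed (auto simp: algebra_simps)

lemma gpoly_smooth:
  "gpoly d m g \<Longrightarrow> smooth_on UNIV (\<lambda>x. Re (g x)) \<and> smooth_on UNIV (\<lambda>x. Im (g x))"
proof (induction rule: gpoly.induct)
  case (gen A d m g)
  have "smooth_on UNIV (\<lambda>x. Re (L A x))" "smooth_on UNIV (\<lambda>x. Im (L A x))"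
    using linear_L by (auto intro!: smooth_on_linear bounded_linear_compose[OF bounded_linear_Re]
        bounded_linear_compose[OF bounded_linear_Im])
  with gen show ?case by (auto intro!: smooth_on_add smooth_on_diff smooth_on_mult)
qed (auto intro: smooth_on_const smooth_on_add)

lemma gpoly_bound: "gpoly d m g \<Longrightarrow> \<exists>C\<ge>0. \<forall>z. cmod (g (\<Phi> z)) \<le> C * norm z ^ d"
proof (induction rule: gpoly.induct)
  case (const k)
  show ?case by (intro exI[of _ "cmod k"]) simp
next
  case (gen A d m g)
  then obtain C where C: "C \<ge> 0" "\<And>z. cmod (g (\<Phi> z)) \<le> C * norm z ^ d" by blast
  have "cmod (L A (\<Phi> z) * g (\<Phi> z)) \<le> norm z ^ weight A * (C * norm z ^ d)" for z
    unfolding norm_mult L_\<Phi> using inv_at_bound[OF gen(1)] C by (intro mult_mono) auto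
  with C(1) show ?case by (intro exI[of _ C]) (simp add: power_add mult_ac)
next
  case (add d m g h)
  then obtain C D where "C \<ge> 0" "\<And>z. cmod (g (\<Phi> z)) \<le> C * norm z ^ d"
    "D \<ge> 0" "\<And>z. cmod (h (\<Phi> z)) \<le> D * norm z ^ d" by metis
  then show ?case
    by (intro exI[of _ "C + D"]) (auto simp: distrib_right intro!: order_trans[OF norm_triangle_ineq add_mono])
qed auto

lemma gpoly_scale: "gpoly d m g \<Longrightarrow> gpoly d m (\<lambda>x. k * g x)"
proof (induction rule: gpoly.induct)
  case (gen A d m g)
  then show ?case using gpoly.gen[OF gen(1,3)] by (simp add: mult_ac)
next
  case (add d m g h)
  then show ?case using gpoly.add[OF add.IH] by (simp add: distrib_left)
qed (use gpoly.const gpoly.zero in auto)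

text \<open>An invariant monomial contains a product of a variable and a conjugate variable, or it contains only
  variables or only conjugates and then at least three of them.  Split off that generator and repeat.
  As generators have degree two or three, the number of factors is between a third and a half of the
  degree.\<close>

lemma invariant_monomial_factors:
  assumes "3 dvd (a + 2 * b + c + 2 * e)"
  shows "\<exists>m g. gpoly (a + b + c + e) m g \<and> 2 * m \<le> a + b + c + e \<and> a + b + c + e \<le> 3 * m \<and>
     (\<forall>z. g (\<Phi> z) = monom2 a b c e z)"
  using assms
proof (induction "a + b + c + e" arbitrary: a b c e rule: less_induct)
  case less
  have step: ?case if A: "weight A > 0" and eq: "a' + b' + c' + e' + weight A = a + b + c + e"
    and dv: "3 dvd (a' + 2 * b' + c' + 2 * e')"
    and fac: "\<And>z. inv_at A z * monom2 a' b' c' e' z = monom2 a b c e z" for A a' b' c' e'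
  proof -
    have "\<exists>m g. gpoly (a' + b' + c' + e') m g \<and> 2 * m \<le> a' + b' + c' + e' \<and> a' + b' + c' + e' \<le> 3 * m \<and>
       (\<forall>z. g (\<Phi> z) = monom2 a' b' c' e' z)"
      by (rule less(1)[OF _ dv]) (use A eq in linarith)
    then obtain m g where g: "gpoly (a' + b' + c' + e') m g" "2 * m \<le> a' + b' + c' + e'" "a' + b' + c' + e' \<le> 3 * m"
       "\<And>z. g (\<Phi> z) = monom2 a' b' c' e' z" by blast
    have "weight A = 2 \<or> weight A = 3" using A by (cases A) auto
    moreover have "gpoly (a + b + c + e) (Suc m) (\<lambda>x. L A x * g x)"
      using gpoly.gen[OF A g(1)] eq by (simp add: add.commute)
    ultimately show ?thesis using g eq fac by (intro exI[of _ "Suc m"] exI[of _ "\<lambda>x. L A x * g x"]) (auto simp: L_\<Phi>)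
  qed
  have red: "3 dvd y" if "3 dvd x" "x = y + 3 \<or> x = y + 6" for x y :: nat using that by presburger
  note defs = inv_at_def phase_val_def monom2_def power2_eq_square power3_eq_cube mult_ac
  consider "a > 0" "b > 0" | "a > 0" "e > 0" | "c > 0" "b > 0" | "c > 0" "e > 0"
    | "b = 0" "e = 0" "a + c > 0" | "a = 0" "c = 0" "b + e > 0" | "a = 0" "b = 0" "c = 0" "e = 0"
    by linarith
  then show ?case
  proof cases
    case 1
    then obtain a' b' where "a = Suc a'" "b = Suc b'" by (metis gr0_implies_Suc)
    with less(2) show ?thesis by (intro step[of Q11 a' b' c e] red[OF less(2)]) (auto simp: defs)
  next
    case 2
    then obtain a' e' where "a = Suc a'" "e = Suc e'" by (metis gr0_implies_Suc)
    with less(2) show ?thesis by (intro step[of Q12 a' b c e'] red[OF less(2)]) (auto simp: defs)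
  next
    case 3
    then obtain c' b' where "c = Suc c'" "b = Suc b'" by (metis gr0_implies_Suc)
    with less(2) show ?thesis by (intro step[of Q21 a b' c' e] red[OF less(2)]) (auto simp: defs)
  next
    case 4
    then obtain c' e' where "c = Suc c'" "e = Suc e'" by (metis gr0_implies_Suc)
    with less(2) show ?thesis by (intro step[of Q22 a b c' e'] red[OF less(2)]) (auto simp: defs)
  next
    case 5
    then have "a + c \<ge> 3" using less(2) by (intro dvd_imp_le) auto
    then consider "a \<ge> 3" | "a = 2" "c \<ge> 1" | "a = 1" "c \<ge> 2" | "a = 0" "c \<ge> 3" by linarith
    then show ?thesis
    proof cases
      case 1
      then obtain a' where "a = a' + 3" by (metis add.commute le_Suc_ex)
      with less(2) show ?thesis by (intro step[of C0 a' b c e] red[OF less(2)]) (auto simp: defs power_add)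
    next
      case 2
      then obtain c' where "c = c' + 1" by (metis add.commute le_Suc_ex)
      with 2 less(2) show ?thesis by (intro step[of C1 0 b c' e] red[OF less(2)]) (auto simp: defs power_add)
    next
      case 3
      then obtain c' where "c = c' + 2" by (metis add.commute le_Suc_ex)
      with 3 less(2) show ?thesis by (intro step[of C2 0 b c' e] red[OF less(2)]) (auto simp: defs power_add)
    next
      case 4
      then obtain c' where "c = c' + 3" by (metis add.commute le_Suc_ex)
      with less(2) show ?thesis by (intro step[of C3 a b c' e] red[OF less(2)]) (auto simp: defs power_add)
    qed
  next
    case 6
    then have "3 dvd 2 * (b + e)" using less(2) by simp
    then have "3 dvd (b + e)" by presburger
    then have "b + e \<ge> 3" using 6 by (intro dvd_imp_le) auto
    then consider "b \<ge> 3" | "b = 2" "e \<ge> 1" | "b = 1" "e \<ge> 2" | "b = 0" "e \<ge> 3" by linarith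
    then show ?thesis
    proof cases
      case 1
      then obtain b' where "b = b' + 3" by (metis add.commute le_Suc_ex)
      with less(2) show ?thesis by (intro step[of D0 a b' c e] red[OF less(2)]) (auto simp: defs power_add)
    next
      case 2
      then obtain e' where "e = e' + 1" by (metis add.commute le_Suc_ex)
      with 2 less(2) show ?thesis by (intro step[of D1 a 0 c e'] red[OF less(2)]) (auto simp: defs power_add)
    next
      case 3
      then obtain e' where "e = e' + 2" by (metis add.commute le_Suc_ex)
      with 3 less(2) show ?thesis by (intro step[of D2 a 0 c e'] red[OF less(2)]) (auto simp: defs power_add)
    next
      case 4
      then obtain e' where "e = e' + 3" by (metis add.commute le_Suc_ex)
      with less(2) show ?thesis by (intro step[of D3 a b c e'] red[OF less(2)]) (auto simp: defs power_add)
    qed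
  next
    case 7
    then show ?thesis by (intro exI[of _ 0] exI[of _ "\<lambda>_. 1"]) (auto simp: monom2_def intro: gpoly.const)
  qed
qed

lemma average_hpoly_factors:
  assumes "hpoly d p"
  shows "\<exists>g. (\<forall>m. gpoly d m (g m)) \<and> (\<forall>m. \<not> (2 * m \<le> d \<and> d \<le> 3 * m) \<longrightarrow> g m = (\<lambda>x. 0)) \<and>
     (\<forall>z. average p z = (\<Sum>m\<le>d. g m (\<Phi> z)))"
  using assms
proof induction
  case (monom a b c e d k)
  show ?case
  proof (cases "3 dvd (a + 2 * b + c + 2 * e)")
    case True
    from invariant_monomial_factors[OF this] obtain m g where
      g: "gpoly d m g" "2 * m \<le> d" "d \<le> 3 * m" "\<And>z. g (\<Phi> z) = monom2 a b c e z"
      unfolding monom by blast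
    define G where "G n = (if n = m then (\<lambda>x. k * g x) else (\<lambda>x. 0))" for n
    have "gpoly d n (G n)" for n using g(1) by (auto simp: G_def intro: gpoly_scale gpoly.zero)
    moreover have "average (\<lambda>z. k * monom2 a b c e z) z = (\<Sum>n\<le>d. G n (\<Phi> z))" for z
    proof -
      have "(\<Sum>n\<le>d. G n (\<Phi> z)) = (\<Sum>n\<le>d. if n = m then k * g (\<Phi> z) else 0)"
        by (rule sum.cong) (auto simp: G_def)
      also have "\<dots> = k * g (\<Phi> z)" using g(2) by (simp add: sum.delta)
      finally show ?thesis using True g(4) by (simp add: average_monom2)
    qed
    ultimately show ?thesis using g(2,3) by (intro exI[of _ G]) (auto simp: G_def)
  next
    case False
    then show ?thesis
      by (intro exI[of _ "\<lambda>m x. 0"]) (auto simp: average_monom2 gpoly.zero)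
  qed
next
  case (add d p q)
  then obtain g h where
    g: "\<And>m. gpoly d m (g m)" "\<And>m. \<not> (2 * m \<le> d \<and> d \<le> 3 * m) \<Longrightarrow> g m = (\<lambda>x. 0)"
      "\<And>z. average p z = (\<Sum>m\<le>d. g m (\<Phi> z))" and
    h: "\<And>m. gpoly d m (h m)" "\<And>m. \<not> (2 * m \<le> d \<and> d \<le> 3 * m) \<Longrightarrow> h m = (\<lambda>x. 0)"
      "\<And>z. average q z = (\<Sum>m\<le>d. h m (\<Phi> z))"
    by metis
  have "average (\<lambda>z. p z + q z) z = average p z + average q z" for z
    by (simp add: average_def field_simps)
  then show ?case using g h
    by (intro exI[of _ "\<lambda>m x. g m x + h m x"]) (auto simp: sum.distrib intro: gpoly.add)
qed

text \<open>The theorem of Schwarz for the cyclic group of order three.  The inequalities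
  \<open>2 * m \<le> d \<le> 3 * m\<close> make the two gradings comparable: only finitely many Taylor terms contribute
  to each homogeneous part \<open>G m\<close> on the target, and the order of vanishing can be compared on both
  sides.\<close>

theorem invariant_factors:
  assumes f: "smooth_on UNIV f" "cube_invariant f"
  obtains F where "smooth_on UNIV F" "\<And>z. F (\<Phi> z) = f z"
proof -
  define t where "t d z = taylor_form d f 0 z / fact d" for d z
  have "\<exists>g. (\<forall>m. gpoly d m (g m)) \<and> (\<forall>m. \<not> (2 * m \<le> d \<and> d \<le> 3 * m) \<longrightarrow> g m = (\<lambda>x. 0)) \<and>
     (\<forall>z. t d z = (\<Sum>m\<le>d. Re (g m (\<Phi> z))))" for d
  proof -
    have hp: "hpoly d (\<lambda>z. complex_of_real (t d z))"
      using hpoly_mult[OF hpoly.monom[of 0 0 0 0 0 "1 / fact d"] hpoly_taylor_form[of d f 0]]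
      by (simp add: t_def monom2_def)
    have "cube_invariant (t d)"
      using taylor_form_cube_invariant[OF f, of d] by (simp add: cube_invariant_def t_def)
    moreover have "(\<omega>3 ^ 2) ^ 3 = 1" using \<omega>3(1) by (metis mult.commute power_mult power_one)
    ultimately have "t d (scale2 \<omega>3 z) = t d z" "t d (scale2 (\<omega>3 ^ 2) z) = t d z" for z
      using \<omega>3(1) cube_invariantD by blast+
    then have "average (\<lambda>z. complex_of_real (t d z)) z = of_real (t d z)" for z
      by (simp add: average_def)
    with average_hpoly_factors[OF hp] obtain g where g: "\<And>m. gpoly d m (g m)"
      "\<And>m. \<not> (2 * m \<le> d \<and> d \<le> 3 * m) \<Longrightarrow> g m = (\<lambda>x. 0)" "\<And>z. of_real (t d z) = (\<Sum>m\<le>d. g m (\<Phi> z))"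
      by metis
    have "t d z = (\<Sum>m\<le>d. Re (g m (\<Phi> z)))" for z
      using arg_cong[OF g(3)[of z], of Re] by simp
    with g(1,2) show ?thesis by blast
  qed
  then obtain g where g: "\<And>d m. gpoly d m (g d m)"
    "\<And>d m. \<not> (2 * m \<le> d \<and> d \<le> 3 * m) \<Longrightarrow> g d m = (\<lambda>x. 0)"
    "\<And>d z. t d z = (\<Sum>m\<le>d. Re (g d m (\<Phi> z)))" by metis
  define G where "G m x = (\<Sum>d\<le>3 * m. Re (g d m x))" for m x
  have G: "smooth_on UNIV (G m)" for m unfolding G_def[abs_def]
    using gpoly_smooth[OF g(1)] by (intro smooth_on_sum) auto
  have hom: "G m (c *\<^sub>R x) = c ^ m * G m x" for m c x
    unfolding G_def gpoly_homogeneous[OF g(1)] sum_distrib_left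
    by (rule sum.cong) (simp_all flip: of_real_power)
  from borel_homogeneous[OF G hom] obtain F0 where F0: "smooth_on UNIV F0"
    "\<And>n. (\<lambda>x. F0 x - (\<Sum>m<n. G m x)) \<in> O[nhds 0](\<lambda>x. norm x ^ n)" by blast
  have sF0: "smooth_on UNIV (\<lambda>z. F0 (\<Phi> z))"
    by (rule smooth_on_compose[OF open_UNIV smooth_\<Phi> _ F0(1)]) auto
  have small: "(\<lambda>z::complex \<times> complex. norm z ^ n) \<in> O[nhds 0](\<lambda>z. norm z ^ k)" if "k \<le> n" for n k
  proof (rule bigoI[where c = 1])
    have "\<forall>\<^sub>F z in nhds 0. z \<in> ball (0 :: complex \<times> complex) 1" by (intro eventually_nhds_in_open) auto
    then show "\<forall>\<^sub>F z in nhds 0. norm (norm (z :: complex \<times> complex) ^ n) \<le> 1 * norm (norm z ^ k)"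
      by eventually_elim (use that in \<open>auto intro!: power_decreasing\<close>)
  qed
  have e_bigo: "(\<lambda>z. Re (g d m (\<Phi> z))) \<in> O[nhds 0](\<lambda>z. norm z ^ d)" for d m
  proof -
    obtain C where C: "C \<ge> 0" "\<And>z. cmod (g d m (\<Phi> z)) \<le> C * norm z ^ d"
      using gpoly_bound[OF g(1)] by blast
    have "\<bar>Re (g d m (\<Phi> z))\<bar> \<le> C * norm z ^ d" for z
      using C(2)[of z] abs_Re_le_cmod[of "g d m (\<Phi> z)"] by linarith
    then show ?thesis by (intro bigoI[where c = C] always_eventually) auto
  qed
  define r where "r z = f z - F0 (\<Phi> z)" for z
  have "flat_at_0 r"
    unfolding flat_at_0_def
  proof (intro conjI allI)
    show "smooth_on UNIV r" unfolding r_def[abs_def] by (intro smooth_on_diff f sF0 open_UNIV)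
    fix n
    have lim: "filterlim \<Phi> (nhds 0) (nhds 0)"
    proof -
      have "isCont \<Phi> 0"
        using componentwise_has_derivative[OF smooth_on_has_derivative[OF smooth_\<Phi>], of 0]
          has_derivative_continuous by (metis (no_types, lifting) UNIV_I)
      then show ?thesis using tendsto_at_iff_tendsto_nhds[of \<Phi> 0] by (simp add: isCont_def \<Phi>_0)
    qed
    have "(\<lambda>z. F0 (\<Phi> z) - (\<Sum>m<n. G m (\<Phi> z))) \<in> O[nhds 0](\<lambda>z. norm (\<Phi> z) ^ n)"
      by (rule landau_o.big.compose[OF F0(2) lim])
    also have "(\<lambda>z. norm (\<Phi> z) ^ n) \<in> O[nhds 0](\<lambda>z. norm z ^ n)"
      by (rule landau_o.big_power[OF \<Phi>_bigo])
    finally have 1: "(\<lambda>z. F0 (\<Phi> z) - (\<Sum>m<n. G m (\<Phi> z))) \<in> O[nhds 0](\<lambda>z. norm z ^ n)" .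
    have "(\<lambda>z. f z - (\<Sum>d<2 * n. t d z)) \<in> O[nhds 0](\<lambda>z. norm z ^ (2 * n))"
      unfolding t_def by (rule taylor_expansion[OF f(1)])
    also have "(\<lambda>z::complex \<times> complex. norm z ^ (2 * n)) \<in> O[nhds 0](\<lambda>z. norm z ^ n)" by (rule small) simp
    finally have 2: "(\<lambda>z. f z - (\<Sum>d<2 * n. t d z)) \<in> O[nhds 0](\<lambda>z. norm z ^ n)" .
    have 3: "(\<lambda>z. \<Sum>m<n. \<Sum>d\<in>{2 * n..<3 * n}. Re (g d m (\<Phi> z))) \<in> O[nhds 0](\<lambda>z. norm z ^ n)"
    proof (intro big_sum_in_bigo)
      fix m d assume "d \<in> {2 * n..<3 * n}"
      then have "(\<lambda>z::complex \<times> complex. norm z ^ d) \<in> O[nhds 0](\<lambda>z. norm z ^ n)" by (intro small) auto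
      then show "(\<lambda>z. Re (g d m (\<Phi> z))) \<in> O[nhds 0](\<lambda>z. norm z ^ n)"
        using e_bigo landau_o.big_trans by blast
    qed
    \<comment> \<open>The homogeneous parts below \<open>n\<close> contain all Taylor terms of degree below \<open>2 * n\<close>, and otherwise
      only terms of degree at least \<open>2 * n\<close>.\<close>
    have split: "(\<Sum>m<n. G m (\<Phi> z)) =
        (\<Sum>d<2 * n. t d z) + (\<Sum>m<n. \<Sum>d\<in>{2 * n..<3 * n}. Re (g d m (\<Phi> z)))" for z
    proof -
      have "(\<Sum>m<n. G m (\<Phi> z)) = (\<Sum>m<n. \<Sum>d<3 * n. Re (g d m (\<Phi> z)))"
        unfolding G_def by (intro sum.cong sum.mono_neutral_left) (auto simp: g(2))
      also have "\<dots> = (\<Sum>m<n. (\<Sum>d<2 * n. Re (g d m (\<Phi> z))) + (\<Sum>d\<in>{2 * n..<3 * n}. Re (g d m (\<Phi> z))))"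
        by (intro sum.cong refl, subst sum.union_disjoint[symmetric]) (auto intro!: sum.cong)
      also have "(\<Sum>m<n. (\<Sum>d<2 * n. Re (g d m (\<Phi> z))) + (\<Sum>d\<in>{2 * n..<3 * n}. Re (g d m (\<Phi> z)))) =
          (\<Sum>d<2 * n. \<Sum>m<n. Re (g d m (\<Phi> z))) + (\<Sum>m<n. \<Sum>d\<in>{2 * n..<3 * n}. Re (g d m (\<Phi> z)))"
        by (simp add: sum.distrib sum.swap[of _ "{..<n}" "{..<2 * n}"])
      also have "(\<Sum>d<2 * n. \<Sum>m<n. Re (g d m (\<Phi> z))) = (\<Sum>d<2 * n. t d z)"
      proof (rule sum.cong)
        fix d assume d: "d \<in> {..<2 * n}"
        have "(\<Sum>m<n. Re (g d m (\<Phi> z))) = (\<Sum>m<n + d + 1. Re (g d m (\<Phi> z)))"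
          using d by (intro sum.mono_neutral_left) (auto simp: g(2))
        also have "\<dots> = (\<Sum>m\<le>d. Re (g d m (\<Phi> z)))"
          by (intro sum.mono_neutral_right) (auto simp: g(2))
        finally show "(\<Sum>m<n. Re (g d m (\<Phi> z))) = t d z" using g(3) by simp
      qed simp
      finally show ?thesis .
    qed
    have "r z = (f z - (\<Sum>d<2 * n. t d z)) - (F0 (\<Phi> z) - (\<Sum>m<n. G m (\<Phi> z))) -
        (\<Sum>m<n. \<Sum>d\<in>{2 * n..<3 * n}. Re (g d m (\<Phi> z)))" for z
      unfolding r_def split by simp
    then show "r \<in> O[nhds 0](\<lambda>x. norm x ^ n)"
      using sum_in_bigo(2)[OF sum_in_bigo(2)[OF 2 1] 3] by presburger
  qed
  moreover have "cube_invariant r"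
    using f(2) \<Phi>_invariant unfolding cube_invariant_def r_def by simp
  ultimately obtain F1 F2 where F: "smooth_on UNIV F1" "smooth_on UNIV F2"
    "\<And>z. r z = F1 (fst z ^ 3, fst z ^ 2 * snd z) + F2 (snd z ^ 3, snd z ^ 2 * fst z)"
    using flat_invariant_factors by blast
  show thesis
  proof (rule that)
    have "smooth_on UNIV (\<lambda>x. F1 (L C0 x, L C1 x))" "smooth_on UNIV (\<lambda>x. F2 (L C3 x, L C2 x))"
      by (rule smooth_bounded_linear_compose[OF F(1)] smooth_bounded_linear_compose[OF F(2)],
          intro bounded_linear_Pair linear_L)+
    then show "smooth_on UNIV (\<lambda>x. F0 x + F1 (L C0 x, L C1 x) + F2 (L C3 x, L C2 x))"
      by (intro smooth_on_add F0(1) open_UNIV)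
    show "F0 (\<Phi> z) + F1 (L C0 (\<Phi> z), L C1 (\<Phi> z)) + F2 (L C3 (\<Phi> z), L C2 (\<Phi> z)) = f z" for z
      using F(3)[of z] by (simp add: L_\<Phi> inv_at_def phase_val_def r_def power2_eq_square power3_eq_cube mult_ac)
  qed
qed

end

section \<open>Brackets built from commuting derivations\<close>

lemma sum3_rotate: "(\<Sum>i\<in>I. \<Sum>j\<in>J. \<Sum>k\<in>K. F i j k) = (\<Sum>j\<in>J. \<Sum>k\<in>K. \<Sum>i\<in>I. F i j k)"
proof -
  have "(\<Sum>i\<in>I. \<Sum>j\<in>J. \<Sum>k\<in>K. F i j k) = (\<Sum>j\<in>J. \<Sum>i\<in>I. \<Sum>k\<in>K. F i j k)" by (rule sum.swap)
  also have "\<dots> = (\<Sum>j\<in>J. \<Sum>k\<in>K. \<Sum>i\<in>I. F i j k)" by (rule sum.cong[OF refl], rule sum.swap)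
  finally show ?thesis .
qed

lemma sum4_reverse: "(\<Sum>i\<in>I. \<Sum>a\<in>A. \<Sum>j\<in>J. \<Sum>k\<in>K. F i a j k) = (\<Sum>k\<in>K. \<Sum>j\<in>J. \<Sum>a\<in>A. \<Sum>i\<in>I. F i a j k)"
proof -
  have "(\<Sum>i\<in>I. \<Sum>a\<in>A. \<Sum>j\<in>J. \<Sum>k\<in>K. F i a j k) = (\<Sum>a\<in>A. \<Sum>j\<in>J. \<Sum>i\<in>I. \<Sum>k\<in>K. F i a j k)"
    by (rule sum3_rotate)
  also have "\<dots> = (\<Sum>a\<in>A. \<Sum>j\<in>J. \<Sum>k\<in>K. \<Sum>i\<in>I. F i a j k)"
    by (rule sum.cong[OF refl], rule sum.cong[OF refl], rule sum.swap)
  also have "\<dots> = (\<Sum>j\<in>J. \<Sum>k\<in>K. \<Sum>a\<in>A. \<Sum>i\<in>I. F i a j k)" by (rule sum3_rotate)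
  also have "\<dots> = (\<Sum>k\<in>K. \<Sum>j\<in>J. \<Sum>a\<in>A. \<Sum>i\<in>I. F i a j k)" by (rule sum.swap)
  finally show ?thesis .
qed

text \<open>The algebra is given as a subset of a ring, since smooth functions form a subset of the ring of all
  functions and the derivations behave only there.\<close>

locale commuting_derivations =
  fixes A :: "'r::comm_ring_1 set" and D :: "'i::finite \<Rightarrow> 'r \<Rightarrow> 'r" and P :: "'i \<Rightarrow> 'i \<Rightarrow> 'r"
  assumes one_closed: "1 \<in> A" and uminus_closed: "f \<in> A \<Longrightarrow> - f \<in> A"
    and add_closed: "f \<in> A \<Longrightarrow> g \<in> A \<Longrightarrow> f + g \<in> A"
    and mult_closed: "f \<in> A \<Longrightarrow> g \<in> A \<Longrightarrow> f * g \<in> A"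
    and D_closed: "f \<in> A \<Longrightarrow> D i f \<in> A"
    and D_add: "f \<in> A \<Longrightarrow> g \<in> A \<Longrightarrow> D i (f + g) = D i f + D i g"
    and D_mult: "f \<in> A \<Longrightarrow> g \<in> A \<Longrightarrow> D i (f * g) = f * D i g + D i f * g"
    and D_commute: "f \<in> A \<Longrightarrow> D i (D j f) = D j (D i f)"
    and P_closed: "P i j \<in> A" and P_antisym: "P i j = - P j i"
begin

definition bracket :: "'r \<Rightarrow> 'r \<Rightarrow> 'r" where
  "bracket f g = (\<Sum>i\<in>UNIV. \<Sum>j\<in>UNIV. P i j * (D i f * D j g))"

lemma zero_closed: "0 \<in> A"
  using add_closed[OF one_closed uminus_closed[OF one_closed]] by simp

lemma sum_closed: "finite I \<Longrightarrow> (\<And>i. i \<in> I \<Longrightarrow> f i \<in> A) \<Longrightarrow> (\<Sum>i\<in>I. f i) \<in> A"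
  by (induction I rule: finite_induct) (auto intro: zero_closed add_closed)

lemma bracket_closed: "f \<in> A \<Longrightarrow> g \<in> A \<Longrightarrow> bracket f g \<in> A"
  unfolding bracket_def by (intro sum_closed mult_closed D_closed P_closed finite)

lemma D_0: "D i 0 = 0"
  using D_add[OF zero_closed zero_closed, of i] by simp

lemma D_1: "D i 1 = 0"
  using D_mult[OF one_closed one_closed, of i] by simp

lemma D_uminus: "f \<in> A \<Longrightarrow> D i (- f) = - D i f"
  using D_add[OF _ uminus_closed, of f f i] D_0 by (simp add: eq_neg_iff_add_eq_0 add.commute)

lemma D_sum: "finite I \<Longrightarrow> (\<And>k. k \<in> I \<Longrightarrow> f k \<in> A) \<Longrightarrow> D i (\<Sum>k\<in>I. f k) = (\<Sum>k\<in>I. D i (f k))"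
  by (induction I rule: finite_induct) (auto simp: D_0 D_add sum_closed)

lemma bracket_antisym: "bracket g f = - bracket f g"
proof -
  have "bracket g f = (\<Sum>j\<in>UNIV. \<Sum>i\<in>UNIV. P i j * (D i g * D j f))"
    unfolding bracket_def by (rule sum.swap)
  also have "\<dots> = (\<Sum>j\<in>UNIV. \<Sum>i\<in>UNIV. - (P j i * (D j f * D i g)))"
    by (intro sum.cong refl) (subst P_antisym, simp add: mult_ac)
  finally show ?thesis by (simp add: bracket_def sum_negf)
qed

lemma bracket_add_right: "f \<in> A \<Longrightarrow> g \<in> A \<Longrightarrow> h \<in> A \<Longrightarrow> bracket f (g + h) = bracket f g + bracket f h"
  by (simp add: bracket_def D_add distrib_left sum.distrib)

lemma bracket_add_left: "f \<in> A \<Longrightarrow> g \<in> A \<Longrightarrow> h \<in> A \<Longrightarrow> bracket (f + g) h = bracket f h + bracket g h"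
  by (simp add: bracket_def D_add distrib_left distrib_right sum.distrib)

lemma bracket_uminus_right: "f \<in> A \<Longrightarrow> g \<in> A \<Longrightarrow> bracket f (- g) = - bracket f g"
  by (simp add: bracket_def D_uminus sum_negf)

lemma bracket_mult_left:
  "f \<in> A \<Longrightarrow> g \<in> A \<Longrightarrow> h \<in> A \<Longrightarrow> bracket (f * g) h = f * bracket g h + bracket f h * g"
  by (simp add: bracket_def D_mult sum_distrib_left sum_distrib_right sum.distrib algebra_simps)

definition jacobiator :: "'r \<Rightarrow> 'r \<Rightarrow> 'r \<Rightarrow> 'r" where
  "jacobiator f g h = bracket f (bracket g h) + bracket g (bracket h f) + bracket h (bracket f g)"

text \<open>The Jacobi identity for the structure functions, as for a bivector field in coordinates.\<close>

definition structure_jacobiator :: "'i \<Rightarrow> 'i \<Rightarrow> 'i \<Rightarrow> 'r" where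
  "structure_jacobiator i j k =
     (\<Sum>a\<in>UNIV. P i a * D a (P j k) + P j a * D a (P k i) + P k a * D a (P i j))"

definition second_order_part :: "'r \<Rightarrow> 'r \<Rightarrow> 'r \<Rightarrow> 'r" where
  "second_order_part f g h = (\<Sum>i\<in>UNIV. \<Sum>a\<in>UNIV. \<Sum>j\<in>UNIV. \<Sum>k\<in>UNIV.
     P i a * P j k * D i f * D a (D j g) * D k h)"

definition first_order_part :: "'r \<Rightarrow> 'r \<Rightarrow> 'r \<Rightarrow> 'r" where
  "first_order_part f g h = (\<Sum>i\<in>UNIV. \<Sum>j\<in>UNIV. \<Sum>k\<in>UNIV.
     (\<Sum>a\<in>UNIV. P i a * D a (P j k)) * (D i f * D j g * D k h))"

text \<open>Exchanging the roles of the outer indices uses that the derivations commute, and two signs from the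
  antisymmetry of \<open>P\<close> cancel.\<close>

lemma second_order_part_sym:
  assumes "f \<in> A" "g \<in> A" "h \<in> A"
  shows "second_order_part f g h = second_order_part h g f"
proof -
  have "second_order_part f g h = (\<Sum>k\<in>UNIV. \<Sum>j\<in>UNIV. \<Sum>a\<in>UNIV. \<Sum>i\<in>UNIV.
     P i a * P j k * D i f * D a (D j g) * D k h)"
    unfolding second_order_part_def by (rule sum4_reverse)
  also have "\<dots> = second_order_part h g f"
    unfolding second_order_part_def
  proof (intro sum.cong refl)
    fix k j a i
    have "P i a * P j k = P k j * P a i" using P_antisym[of i a] P_antisym[of j k] by simp
    moreover have "D a (D j g) = D j (D a g)" by (rule D_commute[OF assms(2)])
    ultimately show "P i a * P j k * D i f * D a (D j g) * D k h = P k j * P a i * D k h * D j (D a g) * D i f"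
      by (simp add: mult_ac)
  qed
  finally show ?thesis .
qed

text \<open>The product rule applied to the coefficient and to either factor of \<open>{g, h}\<close>.\<close>

lemma bracket_bracket:
  assumes "f \<in> A" "g \<in> A" "h \<in> A"
  shows "bracket f (bracket g h) =
    first_order_part f g h + second_order_part f g h - second_order_part f h g"
proof -
  have D_br: "D a (bracket g h) = (\<Sum>j\<in>UNIV. \<Sum>k\<in>UNIV. D a (P j k) * (D j g * D k h) +
      (P j k * (D a (D j g) * D k h) + P j k * (D j g * D a (D k h))))" for a
    unfolding bracket_def
    by (simp add: D_sum sum_closed mult_closed D_closed P_closed assms D_mult distrib_left
        add_ac mult_ac)
  have sw: "(\<Sum>i\<in>UNIV. \<Sum>a\<in>UNIV. \<Sum>j\<in>UNIV. \<Sum>k\<in>UNIV. P i a * D i f * (P j k * (D j g * D a (D k h)))) =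
      - second_order_part f h g"
  proof -
    have "(\<Sum>j\<in>UNIV. \<Sum>k\<in>UNIV. P i a * D i f * (P j k * (D j g * D a (D k h)))) =
        (\<Sum>j\<in>UNIV. \<Sum>k\<in>UNIV. - (P i a * P j k * D i f * D a (D j h) * D k g))" for i a
      by (subst sum.swap, intro sum.cong refl, subst P_antisym) (simp add: mult_ac)
    then show ?thesis by (simp add: second_order_part_def sum_negf)
  qed
  have fo: "(\<Sum>i\<in>UNIV. \<Sum>a\<in>UNIV. \<Sum>j\<in>UNIV. \<Sum>k\<in>UNIV. P i a * D i f * (D a (P j k) * (D j g * D k h))) =
      first_order_part f g h"
  proof -
    have "(\<Sum>a\<in>UNIV. \<Sum>j\<in>UNIV. \<Sum>k\<in>UNIV. P i a * D i f * (D a (P j k) * (D j g * D k h))) =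
        (\<Sum>j\<in>UNIV. \<Sum>k\<in>UNIV. (\<Sum>a\<in>UNIV. P i a * D a (P j k)) * (D i f * D j g * D k h))" for i
      by (subst sum3_rotate, intro sum.cong refl)
         (simp add: sum_distrib_right sum_distrib_left mult_ac)
    then show ?thesis by (simp add: first_order_part_def)
  qed
  have "bracket f (bracket g h) = (\<Sum>i\<in>UNIV. \<Sum>a\<in>UNIV. P i a * D i f * D a (bracket g h))"
    unfolding bracket_def[of f] by (simp add: mult.assoc)
  also have "\<dots> = (\<Sum>i\<in>UNIV. \<Sum>a\<in>UNIV. \<Sum>j\<in>UNIV. \<Sum>k\<in>UNIV.
      P i a * D i f * (D a (P j k) * (D j g * D k h)) +
      (P i a * D i f * (P j k * (D a (D j g) * D k h)) + P i a * D i f * (P j k * (D j g * D a (D k h)))))"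
    unfolding D_br sum_distrib_left distrib_left ..
  also have "\<dots> = first_order_part f g h + ((\<Sum>i\<in>UNIV. \<Sum>a\<in>UNIV. \<Sum>j\<in>UNIV. \<Sum>k\<in>UNIV.
      P i a * D i f * (P j k * (D a (D j g) * D k h))) - second_order_part f h g)"
    unfolding sum.distrib sw fo by simp
  also have "(\<Sum>i\<in>UNIV. \<Sum>a\<in>UNIV. \<Sum>j\<in>UNIV. \<Sum>k\<in>UNIV. P i a * D i f * (P j k * (D a (D j g) * D k h))) =
      second_order_part f g h"
    unfolding second_order_part_def by (intro sum.cong refl) (simp add: mult_ac)
  finally show ?thesis by simp
qed

text \<open>The second order terms cancel, so the Jacobiator is a first order operator in each argument.\<close>

lemma jacobiator_eq:
  assumes "f \<in> A" "g \<in> A" "h \<in> A"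
  shows "jacobiator f g h = (\<Sum>i\<in>UNIV. \<Sum>j\<in>UNIV. \<Sum>k\<in>UNIV.
     structure_jacobiator i j k * (D i f * D j g * D k h))"
proof -
  have 2: "first_order_part g h f = (\<Sum>i\<in>UNIV. \<Sum>j\<in>UNIV. \<Sum>k\<in>UNIV.
      (\<Sum>a\<in>UNIV. P j a * D a (P k i)) * (D i f * D j g * D k h))"
  proof -
    have "first_order_part g h f = (\<Sum>j\<in>UNIV. \<Sum>k\<in>UNIV. \<Sum>i\<in>UNIV.
        (\<Sum>a\<in>UNIV. P j a * D a (P k i)) * (D j g * D k h * D i f))"
      unfolding first_order_part_def ..
    also have "\<dots> = (\<Sum>i\<in>UNIV. \<Sum>j\<in>UNIV. \<Sum>k\<in>UNIV.
        (\<Sum>a\<in>UNIV. P j a * D a (P k i)) * (D j g * D k h * D i f))"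
      by (rule sum3_rotate[symmetric])
    finally show ?thesis by (simp add: mult_ac)
  qed
  have 3: "first_order_part h f g = (\<Sum>i\<in>UNIV. \<Sum>j\<in>UNIV. \<Sum>k\<in>UNIV.
      (\<Sum>a\<in>UNIV. P k a * D a (P i j)) * (D i f * D j g * D k h))"
  proof -
    have "first_order_part h f g = (\<Sum>k\<in>UNIV. \<Sum>i\<in>UNIV. \<Sum>j\<in>UNIV.
        (\<Sum>a\<in>UNIV. P k a * D a (P i j)) * (D k h * D i f * D j g))"
      unfolding first_order_part_def ..
    also have "\<dots> = (\<Sum>i\<in>UNIV. \<Sum>j\<in>UNIV. \<Sum>k\<in>UNIV.
        (\<Sum>a\<in>UNIV. P k a * D a (P i j)) * (D k h * D i f * D j g))"
      by (rule sum3_rotate)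
    finally show ?thesis by (simp add: mult_ac)
  qed
  have "jacobiator f g h = first_order_part f g h + first_order_part g h f + first_order_part h f g"
    unfolding jacobiator_def bracket_bracket[OF assms] bracket_bracket[OF assms(2,3,1)]
      bracket_bracket[OF assms(3,1,2)]
    using second_order_part_sym[OF assms] second_order_part_sym[OF assms(2,3,1)]
      second_order_part_sym[OF assms(3,1,2)] by simp
  also have "\<dots> = (\<Sum>i\<in>UNIV. \<Sum>j\<in>UNIV. \<Sum>k\<in>UNIV.
     structure_jacobiator i j k * (D i f * D j g * D k h))"
    unfolding 2 3 unfolding first_order_part_def structure_jacobiator_def
    by (simp add: sum.distrib distrib_right)
  finally show ?thesis .
qed

text \<open>An element is balanced if its Hamiltonian vector field is a derivation of the bracket.\<close>

definition balanced :: "'r \<Rightarrow> bool" where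
  "balanced f \<longleftrightarrow> f \<in> A \<and> (\<forall>g\<in>A. \<forall>h\<in>A. jacobiator f g h = 0)"

lemma jacobiator_derivation_form:
  assumes "f \<in> A" "g \<in> A" "h \<in> A"
  shows "jacobiator f g h = bracket f (bracket g h) - (bracket (bracket f g) h + bracket g (bracket f h))"
proof -
  have "bracket g (bracket h f) = - bracket g (bracket f h)"
    unfolding bracket_antisym[of h f] by (rule bracket_uminus_right[OF assms(2) bracket_closed[OF assms(1,3)]])
  moreover have "bracket h (bracket f g) = - bracket (bracket f g) h" by (rule bracket_antisym)
  ultimately show ?thesis by (simp add: jacobiator_def)
qed

lemma balancedD:
  "balanced f \<Longrightarrow> g \<in> A \<Longrightarrow> h \<in> A \<Longrightarrow>
     bracket f (bracket g h) = bracket (bracket f g) h + bracket g (bracket f h)"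
  using jacobiator_derivation_form[of f g h] by (simp add: balanced_def)

text \<open>The Hamiltonian vector field of a bracket is the commutator of the two Hamiltonian vector fields when
  one of them is a derivation of the bracket, and a commutator of derivations is a derivation.\<close>

lemma balanced_bracket:
  assumes f: "balanced f" and g: "balanced g"
  shows "balanced (bracket f g)"
proof -
  have fA: "f \<in> A" and gA: "g \<in> A" using f g by (auto simp: balanced_def)
  let ?F = "bracket f g"
  have F: "bracket ?F m = bracket f (bracket g m) - bracket g (bracket f m)" if "m \<in> A" for m
    using balancedD[OF f gA that] by simp
  have "jacobiator ?F h k = 0" if h: "h \<in> A" and k: "k \<in> A" for h k
  proof -
    note cl = bracket_closed fA gA h k
    have fg: "bracket f (bracket g (bracket h k)) =
        bracket (bracket f (bracket g h)) k + bracket (bracket g h) (bracket f k) +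
        (bracket (bracket f h) (bracket g k) + bracket h (bracket f (bracket g k)))"
      unfolding balancedD[OF g h k] by (simp add: bracket_add_right balancedD[OF f] cl)
    have gf: "bracket g (bracket f (bracket h k)) =
        bracket (bracket g (bracket f h)) k + bracket (bracket f h) (bracket g k) +
        (bracket (bracket g h) (bracket f k) + bracket h (bracket g (bracket f k)))"
      unfolding balancedD[OF f h k] by (simp add: bracket_add_right balancedD[OF g] cl)
    have "bracket (bracket f (bracket g h)) k - bracket (bracket g (bracket f h)) k = bracket (bracket ?F h) k"
    proof -
      have "bracket f (bracket g h) = bracket ?F h + bracket g (bracket f h)" using F[OF h] by simp
      then show ?thesis by (simp add: bracket_add_left cl)
    qed
    moreover have "bracket h (bracket f (bracket g k)) - bracket h (bracket g (bracket f k)) = bracket h (bracket ?F k)"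
    proof -
      have "bracket f (bracket g k) = bracket ?F k + bracket g (bracket f k)" using F[OF k] by simp
      then show ?thesis by (simp add: bracket_add_right cl)
    qed
    moreover have "bracket ?F (bracket h k) = bracket f (bracket g (bracket h k)) - bracket g (bracket f (bracket h k))"
      by (rule F) (simp add: cl)
    ultimately have "bracket ?F (bracket h k) = bracket (bracket ?F h) k + bracket h (bracket ?F k)"
      unfolding fg gf by (simp add: algebra_simps)
    then show ?thesis using jacobiator_derivation_form[of ?F h k] by (simp add: cl)
  qed
  then show ?thesis using bracket_closed[OF fA gA] by (simp add: balanced_def)
qed

lemma balanced_one: "balanced 1"
  by (auto simp: balanced_def jacobiator_eq one_closed D_1)

lemma balanced_add: "balanced f \<Longrightarrow> balanced g \<Longrightarrow> balanced (f + g)"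
  by (auto simp: balanced_def jacobiator_eq add_closed D_add distrib_left distrib_right sum.distrib)

lemma balanced_uminus: "balanced f \<Longrightarrow> balanced (- f)"
  by (auto simp: balanced_def jacobiator_eq uminus_closed D_uminus sum_negf)

lemma balanced_mult: "balanced f \<Longrightarrow> balanced g \<Longrightarrow> balanced (f * g)"
proof -
  assume f: "balanced f" and g: "balanced g"
  then have A: "f \<in> A" "g \<in> A" by (auto simp: balanced_def)
  have "jacobiator (f * g) h k = f * jacobiator g h k + jacobiator f h k * g" if "h \<in> A" "k \<in> A" for h k
    using A that
    by (simp add: jacobiator_eq mult_closed D_mult sum_distrib_left sum_distrib_right algebra_simps
        flip: sum.distrib)
  then show ?thesis using f g mult_closed by (auto simp: balanced_def)
qed

lemma balanced_diff: "balanced f \<Longrightarrow> balanced g \<Longrightarrow> balanced (f - g)"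
  using balanced_add[OF _ balanced_uminus, of f g] by simp

end

section \<open>The Jacobi identity propagates from generators\<close>

lemma UNIV_coord: "UNIV = {Q11, Q12, Q21, Q22, C0, C1, C2, C3, D0, D1, D2, D3, Y00, Y01, Y02, Y10, Y11, Y12,
    Y20, Y21, Y22, Z0, Z1, Zb0, Zb1, W00, W01, W10}"
  by (auto intro: coord.exhaust)

instance coord :: finite
  by standard (simp add: UNIV_coord)

context commuting_derivations
begin

lemma of_nat_closed: "of_nat n \<in> A"
  by (induction n) (auto intro: zero_closed add_closed one_closed)

lemma of_int_closed: "of_int c \<in> A"
  by (cases c) (auto intro!: of_nat_closed uminus_closed add_closed one_closed simp del: of_nat_Suc minus_add_distrib)

lemma D_of_nat: "D i (of_nat n) = 0"
  by (induction n) (simp_all add: D_0 D_1 D_add one_closed of_nat_closed)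

lemma D_of_int: "D i (of_int c) = 0"
  by (cases c) (simp_all add: D_of_nat D_uminus of_nat_closed del: of_nat_Suc minus_add_distrib)

lemma balanced_of_int: "balanced (of_int c)"
  by (auto simp: balanced_def jacobiator_eq of_int_closed D_of_int)

lemma monomial_val_closed: "(\<And>v. X v \<in> A) \<Longrightarrow> monomial_val X m \<in> A"
  by (induction m) (auto intro: one_closed mult_closed)

lemma peval_closed: "(\<And>v. X v \<in> A) \<Longrightarrow> peval X p \<in> A"
  by (induction X p rule: peval.induct) (auto intro: zero_closed add_closed mult_closed of_int_closed monomial_val_closed)

lemma D_monomial_val: "(\<And>v. X v \<in> A) \<Longrightarrow> D a (monomial_val X m) = mder (\<lambda>v. D a (X v)) X m"
  by (induction m) (auto simp: D_1 D_mult monomial_val_closed add.commute)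

lemma D_peval: "(\<And>v. X v \<in> A) \<Longrightarrow> D a (peval X p) = pder (\<lambda>v. D a (X v)) X p"
  by (induction X p rule: peval.induct)
     (auto simp: D_0 D_add D_mult D_of_int D_monomial_val mult_closed of_int_closed monomial_val_closed peval_closed)

lemma balanced_monomial_val: "(\<And>v. v \<in> set m \<Longrightarrow> balanced (X v)) \<Longrightarrow> balanced (monomial_val X m)"
  by (induction m) (auto intro: balanced_one balanced_mult)

lemma balanced_zero: "balanced 0"
  using balanced_of_int[of 0] by simp

lemma balanced_peval:
  "(\<And>c m v. (c, m) \<in> set p \<Longrightarrow> v \<in> set m \<Longrightarrow> balanced (X v)) \<Longrightarrow> balanced (peval X p)"
proof (induction X p rule: peval.induct)
  case (2 X c m p)
  then show ?case by (auto intro!: balanced_add balanced_mult balanced_of_int balanced_monomial_val)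
qed (simp add: balanced_zero)

end

lemma mder_linear:
  assumes "finite I"
  shows "(\<Sum>a\<in>I. p a * mder (d a) x m) = mder (\<lambda>v. \<Sum>a\<in>I. p a * d a v) x m"
proof (induction m)
  case (Cons i m)
  have "(\<Sum>a\<in>I. p a * mder (d a) x (i # m)) =
      (\<Sum>a\<in>I. p a * d a i) * monomial_val x m + x i * (\<Sum>a\<in>I. p a * mder (d a) x m)"
    unfolding sum_distrib_left sum_distrib_right sum.distrib[symmetric]
    by (rule sum.cong) (simp_all add: algebra_simps)
  then show ?case by (simp add: Cons.IH)
qed simp

lemma pder_linear:
  "finite I \<Longrightarrow> (\<Sum>a\<in>I. p a * pder (d a) x q) = pder (\<lambda>v. \<Sum>a\<in>I. p a * d a v) x q"
proof (induction q rule: list.induct)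
  case (Cons t q)
  obtain c m where t: "t = (c, m)" by force
  have "(\<Sum>a\<in>I. p a * (of_int c * mder (d a) x m)) = of_int c * (\<Sum>a\<in>I. p a * mder (d a) x m)"
    by (simp add: sum_distrib_left mult_ac)
  then show ?case using Cons by (simp add: t distrib_left sum.distrib mder_linear)
qed simp

lemma peval_remove1:
  "(c, m) \<in> set p \<Longrightarrow> peval x p = of_int c * monomial_val x m + peval x (remove1 (c, m) p)"
  by (induction p) (auto simp: add_ac)

text \<open>The elements \<open>X\<close> are coordinates dual to the derivations, and the table gives their brackets.  A ring
  in which nonzero integers can be cancelled suffices, as the coefficients of the table get divided
  by.\<close>

locale coordinate_bracket =
  commuting_derivations A D "\<lambda>i j. entry X i j" for A and D :: "coord \<Rightarrow> 'r::comm_ring_1 \<Rightarrow> 'r" and X +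
  assumes X_closed: "X i \<in> A" and D_X: "D i (X j) = (if i = j then 1 else 0)"
    and torsion_free: "of_int c * (f :: 'r) = 0 \<Longrightarrow> c \<noteq> 0 \<Longrightarrow> f = 0"
    and jac_generators: "g \<in> {Q11, Q12, Q21, Q22, C0, D0} \<Longrightarrow> jac X g j k = 0"
begin

lemma structure_jacobiator_eq: "structure_jacobiator i j k = jac X i j k"
proof -
  have "(\<Sum>a\<in>UNIV. entry X i a * D a (entry X j k)) = dentry (entry X i) X j k" for i j k
  proof -
    have "D a (entry X j k) = dentry (\<lambda>l. D a (X l)) X j k" for a
      unfolding entry_def dentry_def
      using D_add[of _ "- peval X (look j (row k))"]
      by (simp add: D_peval D_uminus X_closed peval_closed uminus_closed)
    then have "(\<Sum>a\<in>UNIV. entry X i a * D a (entry X j k)) =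
        dentry (\<lambda>l. \<Sum>a\<in>UNIV. entry X i a * D a (X l)) X j k"
      by (simp add: dentry_def right_diff_distrib sum_subtractf pder_linear)
    also have "(\<lambda>l. \<Sum>a\<in>UNIV. entry X i a * D a (X l)) = entry X i"
      by (simp add: D_X if_distrib cong: if_cong)
    finally show ?thesis .
  qed
  then show ?thesis by (simp add: structure_jacobiator_def jac_def sum.distrib)
qed

lemma bracket_X: "bracket (X i) (X j) = entry X i j"
proof -
  have "bracket (X i) (X j) = (\<Sum>a\<in>UNIV. \<Sum>b\<in>UNIV. if b = j then (if a = i then entry X a b else 0) else 0)"
    unfolding bracket_def by (intro sum.cong refl) (simp add: D_X)
  then show ?thesis by simp
qed

lemma jacobiator_X: 
  assumes "g \<in> A" "h \<in> A"
  shows "jacobiator (X i) g h = (\<Sum>j\<in>UNIV. \<Sum>k\<in>UNIV. jac X i j k * (D j g * D k h))"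
proof -
  have "jacobiator (X i) g h = (\<Sum>a\<in>UNIV. if a = i then (\<Sum>j\<in>UNIV. \<Sum>k\<in>UNIV. jac X a j k * (D j g * D k h)) else 0)"
    unfolding jacobiator_eq[OF X_closed assms] structure_jacobiator_eq
    by (intro sum.cong refl) (simp add: D_X)
  then show ?thesis by simp
qed

lemma jacobiator_X_X: "jacobiator (X i) (X j) (X k) = jac X i j k"
proof -
  have "jacobiator (X i) (X j) (X k) =
      (\<Sum>a\<in>UNIV. \<Sum>b\<in>UNIV. if b = k then (if a = j then jac X i a b else 0) else 0)"
    unfolding jacobiator_X[OF X_closed X_closed] by (intro sum.cong refl) (simp add: D_X)
  then show ?thesis by simp
qed

lemma balanced_generator: "g \<in> {Q11, Q12, Q21, Q22, C0, D0} \<Longrightarrow> balanced (X g)"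
  unfolding balanced_def by (simp add: X_closed jacobiator_X jac_generators)

lemma balanced_divide:
  assumes "balanced (of_int c * f)" "f \<in> A" "c \<noteq> 0" shows "balanced f"
proof -
  have eq: "of_int c * jacobiator f g h = jacobiator (of_int c * f) g h" if "g \<in> A" "h \<in> A" for g h
    using assms(2) that
    by (simp add: jacobiator_eq D_mult mult_closed of_int_closed D_of_int sum_distrib_left mult_ac)
  show ?thesis unfolding balanced_def
  proof (intro conjI ballI)
    fix g h assume gh: "g \<in> A" "h \<in> A"
    have "of_int c * jacobiator f g h = 0" using assms(1) gh eq[OF gh] by (simp add: balanced_def)
    then show "jacobiator f g h = 0" using assms(3) by (rule torsion_free)
  qed (rule assms(2))
qed

text \<open>If \<open>{i, j}\<close> has a linear term \<open>c * l\<close> and all other coordinates in it are balanced, then \<open>l\<close> is the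
  difference of a bracket and a polynomial of balanced elements, divided by \<open>c\<close>.\<close>

lemma balanced_extract:
  assumes ij: "balanced (X i)" "balanced (X j)" and l: "(c, [l]) \<in> set (look j (row i))" "c \<noteq> 0"
    and 0: "look i (row j) = []"
    and rest: "\<And>c' m v. (c', m) \<in> set (remove1 (c, [l]) (look j (row i))) \<Longrightarrow> v \<in> set m \<Longrightarrow> balanced (X v)"
  shows "balanced (X l)"
proof -
  have "entry X i j = of_int c * X l + peval X (remove1 (c, [l]) (look j (row i)))"
    unfolding entry_def 0 by (subst peval_remove1[OF l(1)]) simp
  then have "of_int c * X l = bracket (X i) (X j) - peval X (remove1 (c, [l]) (look j (row i)))"
    unfolding bracket_X by simp
  also have "balanced \<dots>"
    by (intro balanced_diff balanced_bracket ij balanced_peval) (rule rest)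
  finally show ?thesis using X_closed l(2) by (rule balanced_divide)
qed

text \<open>Each line picks a pair of coordinates known to be balanced whose bracket contains the new coordinate
  linearly.  The numbers are the coefficients of the linear term in the table.\<close>

lemma balanced_X: "balanced (X l)"
proof -
  note b = balanced_generator[of Q11, simplified] balanced_generator[of Q12, simplified]
    balanced_generator[of Q21, simplified] balanced_generator[of Q22, simplified]
    balanced_generator[of C0, simplified] balanced_generator[of D0, simplified]
  have "balanced (X Y00)" by (rule balanced_extract[of C0 D0 "9"]) (use b in auto)
  note b = b this
  have "balanced (X Y01)" by (rule balanced_extract[of Q12 Y00 "4"]) (use b in auto)
  note b = b this
  have "balanced (X Y02)" by (rule balanced_extract[of Q12 Y01 "2"]) (use b in auto)
  note b = b this
  have "balanced (X D1)" by (rule balanced_extract[of Q12 D0 "6"]) (use b in auto)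
  note b = b this
  have "balanced (X D2)" by (rule balanced_extract[of Q12 D1 "4"]) (use b in auto)
  note b = b this
  have "balanced (X D3)" by (rule balanced_extract[of Q12 D2 "2"]) (use b in auto)
  note b = b this
  have "balanced (X Y10)" by (rule balanced_extract[of Q21 Y00 "-4"]) (use b in auto)
  note b = b this
  have "balanced (X Y20)" by (rule balanced_extract[of Q21 Y10 "-2"]) (use b in auto)
  note b = b this
  have "balanced (X C1)" by (rule balanced_extract[of Q21 C0 "-6"]) (use b in auto)
  note b = b this
  have "balanced (X C2)" by (rule balanced_extract[of Q21 C1 "-4"]) (use b in auto)
  note b = b this
  have "balanced (X Y12)" by (rule balanced_extract[of C2 D3 "6"]) (use b in auto)
  note b = b this
  have "balanced (X C3)" by (rule balanced_extract[of Q21 C2 "-2"]) (use b in auto)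
  note b = b this
  have "balanced (X Y21)" by (rule balanced_extract[of C3 D2 "6"]) (use b in auto)
  note b = b this
  have "balanced (X Y22)" by (rule balanced_extract[of C3 D3 "9"]) (use b in auto)
  note b = b this
  have "balanced (X Y11)" by (rule balanced_extract[of C1 D1 "4"]) (use b in auto)
  note b = b this
  have "balanced (X W01)" by (rule balanced_extract[of Y00 Y12 "-2"]) (use b in auto)
  note b = b this
  have "balanced (X W00)" by (rule balanced_extract[of Q21 W01 "4"]) (use b in auto)
  note b = b this
  have "balanced (X W10)" by (rule balanced_extract[of Q21 W00 "-2"]) (use b in auto)
  note b = b this
  have "balanced (X Z1)" by (rule balanced_extract[of C0 Y20 "-6"]) (use b in auto)
  note b = b this
  have "balanced (X Z0)" by (rule balanced_extract[of Q12 Z1 "-2"]) (use b in auto)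
  note b = b this
  have "balanced (X Zb1)" by (rule balanced_extract[of D0 Y02 "6"]) (use b in auto)
  note b = b this
  have "balanced (X Zb0)" by (rule balanced_extract[of Q21 Zb1 "2"]) (use b in auto)
  note b = b this
  show ?thesis using b by (cases l) auto
qed

theorem jacobi: "f \<in> A \<Longrightarrow> g \<in> A \<Longrightarrow> h \<in> A \<Longrightarrow> jacobiator f g h = 0"
proof -
  have "jac X i j k = 0" for i j k
    using balanced_X[of i] X_closed unfolding balanced_def jacobiator_X_X[symmetric] by blast
  then show "f \<in> A \<Longrightarrow> g \<in> A \<Longrightarrow> h \<in> A \<Longrightarrow> jacobiator f g h = 0"
    by (simp add: jacobiator_eq structure_jacobiator_eq)
qed

end

section \<open>The Poisson structure and the embedding\<close>

text \<open>The table is written in complex coordinates, so the Jacobi identity is proved for complex-valued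
  functions and then restricted to real ones.\<close>

definition csmooth :: "('a::euclidean_space \<Rightarrow> complex) set" where
  "csmooth = {f. smooth_on UNIV (\<lambda>x. Re (f x)) \<and> smooth_on UNIV (\<lambda>x. Im (f x))}"

definition cdir :: "'a::euclidean_space \<Rightarrow> ('a \<Rightarrow> complex) \<Rightarrow> 'a \<Rightarrow> complex" where
  "cdir v f x = Complex (ddir v (\<lambda>x. Re (f x)) x) (ddir v (\<lambda>x. Im (f x)) x)"

lemma cdir_eq: "(f has_derivative f') (at x) \<Longrightarrow> cdir v f x = f' v"
proof -
  assume f: "(f has_derivative f') (at x)"
  have "((\<lambda>x. Re (f x)) has_derivative (\<lambda>v. Re (f' v))) (at x)"
    "((\<lambda>x. Im (f x)) has_derivative (\<lambda>v. Im (f' v))) (at x)"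
    using bounded_linear.has_derivative[OF bounded_linear_Re f] bounded_linear.has_derivative[OF bounded_linear_Im f] .
  from this[THEN frechet_derivative_at] show ?thesis
    unfolding cdir_def by (metis complex.collapse)
qed

lemma csmooth_has_derivative:
  assumes "f \<in> csmooth" shows "(f has_derivative (\<lambda>v. cdir v f x)) (at x)"
proof -
  have "((\<lambda>x. Re (f x)) has_derivative frechet_derivative (\<lambda>x. Re (f x)) (at x)) (at x)"
    "((\<lambda>x. Im (f x)) has_derivative frechet_derivative (\<lambda>x. Im (f x)) (at x)) (at x)"
    using assms by (auto simp: csmooth_def intro!: smooth_on_has_derivative[of UNIV])
  then have "((\<lambda>x. complex_of_real (Re (f x)) + \<i> * complex_of_real (Im (f x))) has_derivative
      (\<lambda>v. complex_of_real (ddir v (\<lambda>x. Re (f x)) x) + \<i> * complex_of_real (ddir v (\<lambda>x. Im (f x)) x))) (at x)"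
    by (intro has_derivative_add has_derivative_mult_right has_derivative_of_real)
  then show ?thesis by (simp add: cdir_def complex_eq[symmetric] Complex_eq)
qed

lemma csmooth_const: "(\<lambda>x. c) \<in> csmooth"
  by (simp add: csmooth_def smooth_on_const)

lemma csmooth_add: "f \<in> csmooth \<Longrightarrow> g \<in> csmooth \<Longrightarrow> (\<lambda>x. f x + g x) \<in> csmooth"
  by (simp add: csmooth_def smooth_on_add)

lemma csmooth_mult: "f \<in> csmooth \<Longrightarrow> g \<in> csmooth \<Longrightarrow> (\<lambda>x. f x * g x) \<in> csmooth"
  by (simp add: csmooth_def smooth_on_add smooth_on_diff smooth_on_mult)

lemma csmooth_cdir: "f \<in> csmooth \<Longrightarrow> cdir v f \<in> csmooth"
  by (simp add: csmooth_def cdir_def smooth_on_ddir)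

lemma csmooth_linear: "bounded_linear f \<Longrightarrow> f \<in> csmooth"
  by (simp add: csmooth_def smooth_on_linear bounded_linear_compose[OF bounded_linear_Re]
      bounded_linear_compose[OF bounded_linear_Im])

lemma cdir_linear: "bounded_linear f \<Longrightarrow> cdir v f = (\<lambda>x. f v)"
  using cdir_eq[OF bounded_linear_imp_has_derivative] by blast

lemma cdir_add: "f \<in> csmooth \<Longrightarrow> g \<in> csmooth \<Longrightarrow> cdir v (\<lambda>x. f x + g x) = (\<lambda>x. cdir v f x + cdir v g x)"
  using cdir_eq[OF has_derivative_add[OF csmooth_has_derivative csmooth_has_derivative]] by blast

lemma cdir_mult: "f \<in> csmooth \<Longrightarrow> g \<in> csmooth \<Longrightarrow>
    cdir v (\<lambda>x. f x * g x) = (\<lambda>x. f x * cdir v g x + cdir v f x * g x)"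
  using cdir_eq[OF has_derivative_mult[OF csmooth_has_derivative csmooth_has_derivative]] by blast

lemma cdir_cmult: "f \<in> csmooth \<Longrightarrow> cdir v (\<lambda>x. c * f x) = (\<lambda>x. c * cdir v f x)"
  using cdir_eq[OF has_derivative_mult_right[OF csmooth_has_derivative]] by blast

lemma cdir_commute:
  assumes "f \<in> csmooth" shows "cdir v (cdir w f) = cdir w (cdir v f)"
proof
  fix x
  have "ddir v (ddir w (\<lambda>x. Re (f x))) = ddir w (ddir v (\<lambda>x. Re (f x)))"
    "ddir v (ddir w (\<lambda>x. Im (f x))) = ddir w (ddir v (\<lambda>x. Im (f x)))"
    using assms by (auto simp: csmooth_def intro!: ddir_commute)
  from this[THEN fun_cong, of x] show "cdir v (cdir w f) x = cdir w (cdir v f) x"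
    by (simp add: cdir_def)
qed

lemma cdir_of_real: "cdir v (\<lambda>x. complex_of_real (f x)) x = of_real (ddir v f x)"
proof -
  have "ddir v (\<lambda>x. 0) x = 0" by (metis frechet_derivative_at has_derivative_const)
  then show ?thesis by (simp add: cdir_def complex_eq_iff)
qed

lemma of_int_fun_apply: "(of_int c :: 'a \<Rightarrow> complex) x = of_int c"
proof -
  have nat: "(of_nat n :: 'a \<Rightarrow> complex) x = of_nat n" for n
    by (induction n) simp_all
  show ?thesis
    by (cases c) (simp_all add: nat del: of_nat_Suc minus_add_distrib)
qed

lemma monomial_val_apply: "monomial_val X m x = monomial_val (\<lambda>v. X v x) m" for X :: "'v \<Rightarrow> 'a \<Rightarrow> complex"
  by (induction m) simp_all

lemma peval_apply: "peval X p x = peval (\<lambda>v. X v x) p" for X :: "'v \<Rightarrow> 'a \<Rightarrow> complex"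
  by (induction X p rule: peval.induct) (simp_all add: of_int_fun_apply monomial_val_apply)

lemma mder_apply: "mder d X m x = mder (\<lambda>v. d v x) (\<lambda>v. X v x) m" for X :: "'v \<Rightarrow> 'a \<Rightarrow> complex"
  by (induction m) (simp_all add: monomial_val_apply)

lemma pder_apply: "pder d X p x = pder (\<lambda>v. d v x) (\<lambda>v. X v x) p" for X :: "'v \<Rightarrow> 'a \<Rightarrow> complex"
  by (induction d X p rule: pder.induct) (simp_all add: of_int_fun_apply mder_apply)

lemma entry_apply: "entry X i j x = entry (\<lambda>v. X v x) i j" for X :: "coord \<Rightarrow> 'a \<Rightarrow> complex"
  by (simp add: entry_def peval_apply)

lemma jac_apply: "jac X i j k x = jac (\<lambda>v. X v x) i j k" for X :: "coord \<Rightarrow> 'a \<Rightarrow> complex"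
  by (simp add: jac_def dentry_def pder_apply entry_apply[abs_def])

lemma monomial_val_cnj: "cnj (monomial_val x m) = monomial_val (\<lambda>v. cnj (x v)) m"
  by (induction m) simp_all

lemma peval_cnj: "cnj (peval x p) = peval (\<lambda>v. cnj (x v)) p"
  by (induction x p rule: peval.induct) (simp_all add: monomial_val_cnj)

lemma entry_cnj: "cnj (entry x i j) = entry (\<lambda>v. cnj (x v)) i j"
  by (simp add: entry_def peval_cnj)

lemma monomial_val_has_derivative:
  fixes y :: "'v \<Rightarrow> 'a::real_normed_vector \<Rightarrow> complex"
  assumes "\<And>v. (y v has_derivative d v) (at x)"
  shows "((\<lambda>x. monomial_val (\<lambda>v. y v x) m) has_derivative (\<lambda>h. mder (\<lambda>v. d v h) (\<lambda>v. y v x) m)) (at x)"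
proof (induction m)
  case (Cons i m)
  show ?case
    using has_derivative_mult[OF assms[of i] Cons.IH] by (simp add: add.commute)
qed simp

lemma peval_has_derivative:
  fixes y :: "'v \<Rightarrow> 'a::real_normed_vector \<Rightarrow> complex"
  assumes "\<And>v. (y v has_derivative d v) (at x)"
  shows "((\<lambda>x. peval (\<lambda>v. y v x) p) has_derivative (\<lambda>h. pder (\<lambda>v. d v h) (\<lambda>v. y v x) p)) (at x)"
proof (induction p)
  case (Cons t p)
  obtain c m where t: "t = (c, m)" by force
  show ?case
    unfolding t peval.simps pder.simps
    by (intro has_derivative_add has_derivative_mult_right monomial_val_has_derivative assms Cons.IH)
qed simp

lemma bar_bar [simp]: "bar (bar i) = i"
  by (cases i) simp_all

lemma sum_bar: "(\<Sum>i\<in>UNIV. f (bar i)) = (\<Sum>i\<in>UNIV. f i)"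
  by (rule sum.reindex_bij_witness[of _ bar bar]) auto

text \<open>This constant makes real coordinates treat self-conjugate coordinates and conjugate pairs alike: the
  complex coordinate is \<open>\<kappa> * x i + cnj \<kappa> * x (bar i)\<close>, and \<open>x i\<close> is the sum of its real and imaginary
  part.  If \<open>bar i = i\<close> the combination is just \<open>x i\<close>.\<close>

definition \<kappa> :: complex where "\<kappa> = Complex (1/2) (1/2)"

lemma \<kappa>: "\<kappa> * cnj \<kappa> = 1/2" "\<kappa> * \<kappa> + cnj \<kappa> * cnj \<kappa> = 0"
  by (simp_all add: \<kappa>_def complex_eq_iff)

text \<open>The 28 coordinates are placed among those of a larger space; the remaining ones do not enter the
  bracket and are Casimir functions.\<close>

locale coordinate_embedding =
  fixes \<rho> :: "coord \<Rightarrow> 'n::finite" assumes inj_\<rho>: "inj \<rho>"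
begin

definition \<xi> :: "coord \<Rightarrow> real ^ 'n \<Rightarrow> complex" where
  "\<xi> i x = \<kappa> * of_real (x $ \<rho> i) + cnj \<kappa> * of_real (x $ \<rho> (bar i))"

text \<open>The derivations dual to the complex coordinates, as complex combinations of the real directional
  derivatives.\<close>

definition \<delta> :: "coord \<Rightarrow> (real ^ 'n \<Rightarrow> complex) \<Rightarrow> real ^ 'n \<Rightarrow> complex" where
  "\<delta> i f = (\<lambda>x. cnj \<kappa> * cdir (axis (\<rho> i) 1) f x + \<kappa> * cdir (axis (\<rho> (bar i)) 1) f x)"

lemma bounded_linear_\<xi>: "bounded_linear (\<xi> i)"
  unfolding \<xi>_def[abs_def]
  by (intro bounded_linear_add bounded_linear_const_mult bounded_linear_compose[OF bounded_linear_of_real] bounded_linear_vec_nth)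

lemma cnj_\<xi>: "cnj (\<xi> i x) = \<xi> (bar i) x"
  by (simp add: \<xi>_def add.commute)

lemma \<delta>_\<xi>: "\<delta> i (\<xi> j) = (\<lambda>x. if i = j then 1 else 0)"
proof
  fix x
  have ax: "axis (\<rho> k) (1::real) $ \<rho> l = (if k = l then 1 else 0)" for k l
    using inj_\<rho> by (auto simp: axis_def inj_eq)
  have bars: "bar i = bar j \<longleftrightarrow> i = j" "bar i = j \<longleftrightarrow> i = bar j" by (metis bar_bar)+
  have comb: "cnj \<kappa> * (\<kappa> * p + cnj \<kappa> * q) + \<kappa> * (\<kappa> * q + cnj \<kappa> * p) = p" for p q
  proof -
    have "cnj \<kappa> * (\<kappa> * p + cnj \<kappa> * q) + \<kappa> * (\<kappa> * q + cnj \<kappa> * p) =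
        (2 * (\<kappa> * cnj \<kappa>)) * p + (\<kappa> * \<kappa> + cnj \<kappa> * cnj \<kappa>) * q" by (simp add: algebra_simps)
    then show ?thesis unfolding \<kappa> by simp
  qed
  have "\<delta> i (\<xi> j) x = cnj \<kappa> * (\<kappa> * of_real (if i = j then 1 else 0) + cnj \<kappa> * of_real (if i = bar j then 1 else 0)) +
      \<kappa> * (\<kappa> * of_real (if i = bar j then 1 else 0) + cnj \<kappa> * of_real (if i = j then 1 else 0))"
    unfolding \<delta>_def cdir_linear[OF bounded_linear_\<xi>] unfolding \<xi>_def ax bars ..
  then show "\<delta> i (\<xi> j) x = (if i = j then 1 else 0)" unfolding comb by simp
qed

lemma \<delta>_of_real_cnj: "cnj (\<delta> i (\<lambda>x. of_real (F x)) x) = \<delta> (bar i) (\<lambda>x. of_real (F x)) x"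
  by (simp add: \<delta>_def cdir_of_real add.commute)

sublocale coordinate_bracket csmooth \<delta> \<xi>
proof
  show "1 \<in> (csmooth :: (real ^ 'n \<Rightarrow> complex) set)"
    using csmooth_const[of 1] by (simp add: one_fun_def)
  show add: "f + g \<in> csmooth" if "f \<in> csmooth" "g \<in> csmooth" for f g :: "real ^ 'n \<Rightarrow> complex"
    using csmooth_add[OF that] by (simp add: plus_fun_def)
  show mult: "f * g \<in> csmooth" if "f \<in> csmooth" "g \<in> csmooth" for f g :: "real ^ 'n \<Rightarrow> complex"
    using csmooth_mult[OF that] by (simp add: times_fun_def)
  show um: "- f \<in> csmooth" if "f \<in> csmooth" for f :: "real ^ 'n \<Rightarrow> complex"
    using csmooth_mult[OF csmooth_const[of "-1"] that] by (simp add: fun_Compl_def)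
  show "\<delta> i f \<in> csmooth" if "f \<in> csmooth" for i f
    unfolding \<delta>_def using that by (intro csmooth_add csmooth_mult csmooth_const csmooth_cdir)
  show "\<delta> i (f + g) = \<delta> i f + \<delta> i g" if "f \<in> csmooth" "g \<in> csmooth" for i f g
    using that by (simp add: \<delta>_def plus_fun_def cdir_add fun_eq_iff algebra_simps)
  show "\<delta> i (f * g) = f * \<delta> i g + \<delta> i f * g" if "f \<in> csmooth" "g \<in> csmooth" for i f g
    using that by (simp add: \<delta>_def times_fun_def plus_fun_def cdir_mult fun_eq_iff algebra_simps)
  show "\<delta> i (\<delta> j f) = \<delta> j (\<delta> i f)" if f: "f \<in> csmooth" for i j f
  proof -
    have "cdir v (\<delta> j f) = (\<lambda>x. cnj \<kappa> * cdir v (cdir (axis (\<rho> j) 1) f) x + \<kappa> * cdir v (cdir (axis (\<rho> (bar j)) 1) f) x)" for v j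
      unfolding \<delta>_def using f
      by (simp add: cdir_add cdir_cmult csmooth_mult csmooth_const csmooth_cdir)
    then have "\<delta> i (\<delta> j f) = (\<lambda>x.
        cnj \<kappa> * (cnj \<kappa> * cdir (axis (\<rho> i) 1) (cdir (axis (\<rho> j) 1) f) x + \<kappa> * cdir (axis (\<rho> i) 1) (cdir (axis (\<rho> (bar j)) 1) f) x) +
        \<kappa> * (cnj \<kappa> * cdir (axis (\<rho> (bar i)) 1) (cdir (axis (\<rho> j) 1) f) x + \<kappa> * cdir (axis (\<rho> (bar i)) 1) (cdir (axis (\<rho> (bar j)) 1) f) x))" for i j
      by (simp add: \<delta>_def[of i "\<delta> j f"])
    note * = this
    show ?thesis unfolding *[of i j] *[of j i]
      cdir_commute[OF f, of "axis (\<rho> j) 1"] cdir_commute[OF f, of "axis (\<rho> (bar j)) 1"]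
      by (auto simp: algebra_simps)
  qed
  show X: "\<xi> i \<in> csmooth" for i by (rule csmooth_linear[OF bounded_linear_\<xi>])
  have oi: "(of_int c :: real ^ 'n \<Rightarrow> complex) \<in> csmooth" for c
  proof -
    have "(of_int c :: real ^ 'n \<Rightarrow> complex) = (\<lambda>x. of_int c)" by (simp add: fun_eq_iff of_int_fun_apply)
    then show ?thesis using csmooth_const by simp
  qed
  have mo: "monomial_val \<xi> m \<in> csmooth" for m
  proof (induction m)
    case Nil show ?case using csmooth_const[of 1] by (simp add: one_fun_def)
  next
    case (Cons i m) show ?case unfolding monomial_val.simps by (rule mult[OF X Cons.IH])
  qed
  have pe: "peval \<xi> p \<in> csmooth" for p
  proof (induction p)
    case Nil show ?case using csmooth_const[of 0] by (simp add: zero_fun_def)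
  next
    case (Cons t p)
    obtain c m where t: "t = (c, m)" by force
    show ?case unfolding t peval.simps by (rule add[OF mult[OF oi mo] Cons.IH])
  qed
  show "entry \<xi> i j \<in> csmooth" for i j
    using add[OF pe um[OF pe]] by (simp add: entry_def)
  show "entry \<xi> i j = - entry \<xi> j i" for i j by (simp add: entry_def)
  show "\<delta> i (\<xi> j) = (if i = j then 1 else 0)" for i j
    by (simp add: \<delta>_\<xi> one_fun_def zero_fun_def)
  show "f = 0" if "of_int c * f = 0" "c \<noteq> 0" for c and f :: "real ^ 'n \<Rightarrow> complex"
  proof
    fix x show "f x = 0 x" using fun_cong[OF that(1), of x] that(2) by (simp add: of_int_fun_apply)
  qed
  show "jac \<xi> g j k = 0" if "g \<in> {Q11, Q12, Q21, Q22, C0, D0}" for g j k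
  proof
    fix x show "jac \<xi> g j k x = 0 x"
      unfolding jac_apply using that
      by (auto simp: jac_Q11 jac_Q12 jac_Q21 jac_Q22 jac_C0 jac_D0)
  qed
qed

abbreviation cx :: "(real ^ 'n \<Rightarrow> real) \<Rightarrow> real ^ 'n \<Rightarrow> complex" where
  "cx F \<equiv> (\<lambda>x. complex_of_real (F x))"

text \<open>Taking the real part only fixes the type, because the value is real by \<open>entry_bar\<close>.\<close>

definition br :: "(real ^ 'n) bracket" where
  "br F G = (\<lambda>x. Re (- \<i> * bracket (cx F) (cx G) x))"

lemma cx_csmooth: "F \<in> smooth_functions \<Longrightarrow> cx F \<in> csmooth"
  by (simp add: smooth_functions_iff csmooth_def smooth_on_const)

lemma bracket_apply: "bracket f g x = (\<Sum>i\<in>UNIV. \<Sum>j\<in>UNIV. entry (\<lambda>v. \<xi> v x) i j * (\<delta> i f x * \<delta> j g x))"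
proof -
  have sa: "(\<Sum>i\<in>I. h i) x = (\<Sum>i\<in>I. h i x)" for I :: "coord set" and h :: "coord \<Rightarrow> real ^ 'n \<Rightarrow> complex"
    by (induction I rule: infinite_finite_induct) auto
  show ?thesis by (simp add: bracket_def sa entry_apply)
qed

lemma cx_br: "cx (br F G) = (\<lambda>x. - \<i> * bracket (cx F) (cx G) x)"
proof
  fix x
  have "cnj (bracket (cx F) (cx G) x) =
      (\<Sum>i\<in>UNIV. \<Sum>j\<in>UNIV. - (entry (\<lambda>v. \<xi> v x) (bar i) (bar j) * (\<delta> (bar i) (cx F) x * \<delta> (bar j) (cx G) x)))"
    by (simp add: bracket_apply entry_cnj cnj_\<xi> \<delta>_of_real_cnj entry_bar[of "\<lambda>v. \<xi> v x"])
  also have "\<dots> = - bracket (cx F) (cx G) x"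
    unfolding bracket_apply sum_negf
    using sum_bar[of "\<lambda>i. \<Sum>j\<in>UNIV. entry (\<lambda>v. \<xi> v x) i (bar j) * (\<delta> i (cx F) x * \<delta> (bar j) (cx G) x)"]
      sum_bar[of "\<lambda>j. entry (\<lambda>v. \<xi> v x) i j * (\<delta> i (cx F) x * \<delta> j (cx G) x)" for i] by simp
  finally have "cnj (- \<i> * bracket (cx F) (cx G) x) = - \<i> * bracket (cx F) (cx G) x" by simp
  then show "cx (br F G) x = - \<i> * bracket (cx F) (cx G) x"
    unfolding br_def by (metis Reals_cnj_iff of_real_Re)
qed

lemma br_smooth:
  assumes "F \<in> smooth_functions" "G \<in> smooth_functions" shows "br F G \<in> smooth_functions"
proof -
  have "(\<lambda>x. - \<i> * bracket (cx F) (cx G) x) \<in> csmooth"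
    by (intro csmooth_mult csmooth_const bracket_closed cx_csmooth assms)
  then show ?thesis by (simp add: smooth_functions_iff csmooth_def br_def)
qed

lemma const_closed: "(\<lambda>x. c) \<in> csmooth" by (rule csmooth_const)

lemma \<delta>_const: "\<delta> i (\<lambda>x. c) = 0"
proof -
  have "cdir v (\<lambda>x::real ^ 'n. c) = (\<lambda>x. 0)" for v
    using cdir_eq[OF has_derivative_const[of c]] by blast
  then show ?thesis by (simp add: \<delta>_def zero_fun_def)
qed

lemma bracket_const_left: "bracket (\<lambda>x. c) h = 0"
  by (simp add: bracket_def \<delta>_const)

lemma bracket_scale_left:
  "f \<in> csmooth \<Longrightarrow> h \<in> csmooth \<Longrightarrow> bracket (\<lambda>x. c * f x) h = (\<lambda>x. c * bracket f h x)"
  using bracket_mult_left[OF const_closed[of c], of f h] bracket_const_left[of c h]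
  by (simp add: times_fun_def plus_fun_def zero_fun_def)

lemma bracket_scale_right:
  "f \<in> csmooth \<Longrightarrow> h \<in> csmooth \<Longrightarrow> bracket h (\<lambda>x. c * f x) = (\<lambda>x. c * bracket h f x)"
  using bracket_scale_left[of f h c] bracket_antisym[of h] by (simp add: fun_Compl_def)

lemma br_antisym: "br G F = (\<lambda>x. - br F G x)"
  unfolding br_def bracket_antisym[of "cx G"] by simp

lemma br_linear:
  assumes "F \<in> smooth_functions" "G \<in> smooth_functions" "H \<in> smooth_functions"
  shows "br (\<lambda>x. a * F x + b * G x) H = (\<lambda>x. a * br F H x + b * br G H x)"
proof -
  note s = assms[THEN cx_csmooth]
  have "bracket (cx (\<lambda>x. a * F x + b * G x)) (cx H) =
      bracket ((\<lambda>x. of_real a * cx F x) + (\<lambda>x. of_real b * cx G x)) (cx H)"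
    by (simp add: plus_fun_def)
  also have "\<dots> = bracket (\<lambda>x. of_real a * cx F x) (cx H) + bracket (\<lambda>x. of_real b * cx G x) (cx H)"
    by (rule bracket_add_left) (intro csmooth_mult const_closed s)+
  finally have "bracket (cx (\<lambda>x. a * F x + b * G x)) (cx H) =
      (\<lambda>x. of_real a * bracket (cx F) (cx H) x + of_real b * bracket (cx G) (cx H) x)"
    unfolding bracket_scale_left[OF s(1,3)] bracket_scale_left[OF s(2,3)] by (simp add: plus_fun_def)
  then show ?thesis by (simp add: br_def algebra_simps)
qed

lemma br_leibniz:
  assumes "F \<in> smooth_functions" "G \<in> smooth_functions" "H \<in> smooth_functions"
  shows "br (\<lambda>x. F x * G x) H = (\<lambda>x. F x * br G H x + br F H x * G x)"
proof -
  note s = assms[THEN cx_csmooth]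
  have "cx (\<lambda>x. F x * G x) = cx F * cx G" by (simp add: times_fun_def)
  then have "bracket (cx (\<lambda>x. F x * G x)) (cx H) = cx F * bracket (cx G) (cx H) + bracket (cx F) (cx H) * cx G"
    using bracket_mult_left[OF s] by simp
  then show ?thesis by (simp add: br_def algebra_simps)
qed

text \<open>Two factors \<open>- \<i>\<close> contribute the same sign to every summand.\<close>

lemma br_jacobi:
  assumes "F \<in> smooth_functions" "G \<in> smooth_functions" "H \<in> smooth_functions"
  shows "br F (br G H) x + br G (br H F) x + br H (br F G) x = 0"
proof -
  note s = assms[THEN cx_csmooth]
  \<comment> \<open>The minus sign is the square of the factor \<open>- \<i>\<close>.\<close>
  have nest: "of_real (br F (br G H) x) = - bracket (cx F) (bracket (cx G) (cx H)) x"
    if "cx F \<in> csmooth" "cx G \<in> csmooth" "cx H \<in> csmooth" for F G H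
  proof -
    have "complex_of_real (br F (br G H) x) = - \<i> * bracket (cx F) (cx (br G H)) x"
      using fun_cong[OF cx_br[of F "br G H"], of x] .
    also have "\<dots> = - \<i> * (- \<i> * bracket (cx F) (bracket (cx G) (cx H)) x)"
      unfolding cx_br by (subst bracket_scale_right) (simp_all add: that bracket_closed)
    finally show ?thesis by simp
  qed
  have "complex_of_real (br F (br G H) x + br G (br H F) x + br H (br F G) x) =
      - jacobiator (cx F) (cx G) (cx H) x"
    by (simp add: nest s jacobiator_def)
  also have "\<dots> = 0" using jacobi[OF s] by simp
  finally show ?thesis by (simp only: of_real_eq_0_iff)
qed

theorem poisson_br: "poisson_bracket_on smooth_functions br"
proof -
  have right: "br H (\<lambda>x. a * F x + b * G x) = (\<lambda>x. a * br H F x + b * br H G x)"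
    "br H (\<lambda>x. F x * G x) = (\<lambda>x. F x * br H G x + br H F x * G x)"
    if "F \<in> smooth_functions" "G \<in> smooth_functions" "H \<in> smooth_functions" for F G H a b
    using br_linear[OF that, of a b] br_leibniz[OF that]
    unfolding br_antisym[of H] by (simp_all add: algebra_simps)
  have "br F F = (\<lambda>x. 0)" for F
  proof
    fix x show "br F F x = 0" using fun_cong[OF br_antisym[of F F], of x] by simp
  qed
  then show ?thesis
    unfolding poisson_bracket_on_def lie_bracket_on_def
    by (simp add: br_smooth br_linear br_leibniz right br_jacobi)
qed

text \<open>As \<open>\<rho>\<close> is injective, at most one summand is nonzero; coordinates outside the range of \<open>\<rho>\<close> vanish.\<close>

definition \<Phi> :: "complex \<times> complex \<Rightarrow> real ^ 'n" where
  "\<Phi> z = (\<chi> k. \<Sum>i\<in>UNIV. if \<rho> i = k then Re (inv_at i z) + Im (inv_at i z) else 0)"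

lemma inv_at_bar: "cnj (inv_at i z) = inv_at (bar i) z"
  by (cases i) (simp_all add: inv_at_def phase_val_def mult_ac)

lemma \<Phi>_\<rho>: "\<Phi> z $ \<rho> i = Re (inv_at i z) + Im (inv_at i z)"
  using inj_\<rho> by (simp add: \<Phi>_def inj_eq)

lemma \<xi>_\<Phi>: "\<xi> i (\<Phi> z) = inv_at i z"
  unfolding \<xi>_def \<Phi>_\<rho> inv_at_bar[symmetric] by (simp add: \<kappa>_def complex_eq_iff algebra_simps)

lemma inv_at_csmooth: "inv_at i \<in> csmooth"
proof -
  have ph: "(\<lambda>z. phase_val z p) \<in> csmooth" for p
    by (cases p) (simp_all add: phase_val_def csmooth_linear bounded_linear_fst bounded_linear_snd
        bounded_linear_compose[OF bounded_linear_cnj])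
  have mo: "(\<lambda>z. monomial_val (phase_val z) m) \<in> csmooth" for m
    by (induction m) (simp_all add: csmooth_const csmooth_mult ph)
  have "(\<lambda>z. peval (phase_val z) q) \<in> csmooth" for q
  proof (induction q)
    case (Cons t q)
    obtain c m where "t = (c, m)" by force
    then show ?case using Cons by (simp add: csmooth_add csmooth_mult csmooth_const mo)
  qed (simp add: csmooth_const)
  then show ?thesis by (simp add: inv_at_def[abs_def])
qed

lemma smooth_\<Phi>_component: "smooth_on UNIV (\<lambda>z. \<Phi> z $ k)"
proof -
  have "smooth_on UNIV (\<lambda>z. \<Sum>i\<in>UNIV. if \<rho> i = k then Re (inv_at i z) + Im (inv_at i z) else 0)"
  proof (intro smooth_on_sum open_UNIV)
    fix i show "smooth_on UNIV (\<lambda>z. if \<rho> i = k then Re (inv_at i z) + Im (inv_at i z) else 0)"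
      using inv_at_csmooth[of i] by (cases "\<rho> i = k") (simp_all add: smooth_on_add smooth_on_const csmooth_def)
  qed
  then show ?thesis by (simp add: \<Phi>_def)
qed

lemma \<Phi>_0: "\<Phi> 0 = 0"
proof -
  have "inv_at i 0 = 0" for i by (cases i) (simp_all add: inv_at_def phase_val_def)
  then show ?thesis by (simp add: \<Phi>_def vec_eq_iff cong: if_cong)
qed

lemma inv_at_scale2:
  assumes "\<zeta> ^ 3 = 1" shows "inv_at i (scale2 \<zeta> z) = inv_at i z"
proof -
  have "cmod \<zeta> ^ 3 = 1" using assms by (metis norm_one norm_power)
  then have "cmod \<zeta> = 1" using power_eq_imp_eq_base[of "cmod \<zeta>" 3 1] by simp
  then have 1: "\<zeta> * cnj \<zeta> = 1" by (simp add: complex_norm_square[symmetric])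
  have 2: "\<zeta> * (\<zeta> * \<zeta>) = 1" using assms by (simp add: power3_eq_cube mult.assoc)
  have 3: "cnj \<zeta> * (cnj \<zeta> * cnj \<zeta>) = 1" using arg_cong[OF 2, of cnj] by simp
  show ?thesis
    by (induction i; simp only: inv_at_def inv_poly.simps peval.simps monomial_val.simps phase_val_def
        phase.case scale2_def fst_conv snd_conv complex_cnj_mult; (insert 1 2 3, algebra)?)
qed

sublocale invariant_map \<Phi> \<xi>
proof (rule invariant_map.intro)
  show "bounded_linear (\<xi> i)" for i by (rule bounded_linear_\<xi>)
  show "\<xi> i (\<Phi> z) = inv_at i z" for i z by (rule \<xi>_\<Phi>)
  show "\<Phi> 0 = 0" by (rule \<Phi>_0)
  show sm: "smooth_on UNIV (\<lambda>z. \<Phi> z \<bullet> b)" if "b \<in> Basis" for b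
    using that smooth_\<Phi>_component by (auto simp: Basis_vec_def inner_axis)
  show "\<Phi> (scale2 \<zeta> z) = \<Phi> z" if "\<zeta> ^ 3 = 1" for \<zeta> z
    unfolding \<Phi>_def inv_at_scale2[OF that] ..
  have "(\<lambda>z. \<Phi> z \<bullet> b) \<in> O[nhds 0](\<lambda>z. norm z ^ 1)" if "b \<in> Basis" for b
    using taylor_expansion[OF sm[OF that], of 1] by (simp add: \<Phi>_0)
  then have "(\<lambda>z. \<Sum>b\<in>Basis. \<bar>\<Phi> z \<bullet> b\<bar>) \<in> O[nhds 0](norm)"
    by (intro big_sum_in_bigo) (simp add: landau_o.big.abs_in_iff)
  moreover have "(\<lambda>z. norm (\<Phi> z)) \<in> O[nhds 0](\<lambda>z. \<Sum>b\<in>Basis. \<bar>\<Phi> z \<bullet> b\<bar>)"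
    by (rule bigoI[where c = 1])
       (auto intro!: always_eventually order_trans[OF norm_le_l1] simp: sum_nonneg)
  ultimately show "(\<lambda>z. norm (\<Phi> z)) \<in> O[nhds 0](norm)" by (rule landau_o.big_trans[rotated])
qed

end

definition toC :: "V \<Rightarrow> complex \<times> complex" where
  "toC v = (Complex (fst v $ 1) (fst v $ 2), Complex (snd v $ 1) (snd v $ 2))"

definition fromC :: "complex \<times> complex \<Rightarrow> V" where
  "fromC z = (vector [Re (fst z), Im (fst z)], vector [Re (snd z), Im (snd z)])"

lemma fromC_toC [simp]: "fromC (toC v) = v"
  by (simp add: fromC_def toC_def prod_eq_iff vec_eq_iff forall_2)

lemma toC_fromC [simp]: "toC (fromC z) = z"
  by (simp add: fromC_def toC_def prod_eq_iff complex_eq_iff)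

lemma bounded_linear_toC: "bounded_linear toC"
  unfolding linear_conv_bounded_linear[symmetric]
  by (rule linearI) (simp_all add: toC_def prod_eq_iff complex_eq_iff)

lemma bounded_linear_fromC: "bounded_linear fromC"
  unfolding linear_conv_bounded_linear[symmetric]
  by (rule linearI) (simp_all add: fromC_def prod_eq_iff vec_eq_iff forall_2)

text \<open>The given matrix rotates clockwise, so the generator acts by the conjugate of \<open>\<omega>3\<close>.\<close>

lemma toC_rotation: "toC (rotation v) = scale2 (\<omega>3 ^ 2) (toC v)"
proof -
  have eq: "2 * pi / 3 = pi - pi / 3" by simp
  have c: "cos (2 * pi / 3) = - (1 / 2)" and s: "sin (2 * pi / 3) = sqrt 3 / 2"
    unfolding eq cos_pi_minus sin_pi_minus by (simp_all add: cos_60 sin_60)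
  have mult: "rotation_matrix *v u =
      vector [sqrt 3 / 2 * u $ 2 - u $ 1 / 2, - sqrt 3 / 2 * u $ 1 - u $ 2 / 2]" for u :: "real ^ 2"
    unfolding rotation_matrix_def c s
    by (simp add: vec_eq_iff forall_2 matrix_vector_mult_def sum_2)
  show ?thesis
    unfolding \<omega>3(2)[symmetric]
    by (simp add: toC_def rotation_def mult scale2_def \<omega>3_def prod_eq_iff complex_eq_iff field_simps)
qed

lemma toC_rotation_power: "toC ((rotation ^^ k) v) = scale2 ((\<omega>3 ^ 2) ^ k) (toC v)"
  by (induction k) (simp_all add: toC_rotation, simp_all add: scale2_def mult.assoc)

lemma rotation_power_root: "((\<omega>3 ^ 2) ^ k) ^ 3 = 1"
  by (metis \<omega>3(1) mult.commute power_mult power_one)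

lemma cube_root_of_unity: assumes "\<zeta> ^ 3 = 1" obtains k where "k < 3" "\<zeta> = (\<omega>3 ^ 2) ^ k"
proof -
  have "(\<zeta> - 1) * (\<zeta> - \<omega>3) * (\<zeta> - \<omega>3 ^ 2) = 0"
    using assms \<omega>3(1,3) by algebra
  then consider "\<zeta> = 1" | "\<zeta> = \<omega>3" | "\<zeta> = \<omega>3 ^ 2" by auto
  moreover have "(\<omega>3 ^ 2) ^ 2 = \<omega>3" using \<omega>3(1) by algebra
  ultimately show thesis using that[of 0] that[of 1] that[of 2] by cases auto
qed

lemma orbit_relation_iff: "(v, w) \<in> orbit_relation \<longleftrightarrow> (\<exists>\<zeta>. \<zeta> ^ 3 = 1 \<and> toC w = scale2 \<zeta> (toC v))"
proof
  assume "(v, w) \<in> orbit_relation"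
  then obtain k where "w = (rotation ^^ k) v" by (auto simp: orbit_relation_def Z3_def)
  then show "\<exists>\<zeta>. \<zeta> ^ 3 = 1 \<and> toC w = scale2 \<zeta> (toC v)"
    using toC_rotation_power rotation_power_root by blast
next
  assume "\<exists>\<zeta>. \<zeta> ^ 3 = 1 \<and> toC w = scale2 \<zeta> (toC v)"
  then obtain \<zeta> where "\<zeta> ^ 3 = 1" "toC w = scale2 \<zeta> (toC v)" by blast
  moreover from this(1) obtain k where "k < 3" "\<zeta> = (\<omega>3 ^ 2) ^ k" by (rule cube_root_of_unity)
  ultimately have "toC w = toC ((rotation ^^ k) v)" "k < 3" by (simp_all add: toC_rotation_power)
  then have "w = (rotation ^^ k) v" "k < 3" by (metis fromC_toC)+
  then show "(v, w) \<in> orbit_relation" by (auto simp: orbit_relation_def Z3_def)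
qed

text \<open>If \<open>fst z\<close> is nonzero, the quotient of the first components is the required root of unity and the
  invariant \<open>fst z ^ 2 * snd z\<close> shows that it also relates the second components.\<close>

lemma invariants_separate:
  assumes eq: "\<And>i. inv_at i z = inv_at i z'"
  obtains \<zeta> where "\<zeta> ^ 3 = 1" "z' = scale2 \<zeta> z"
proof -
  have c: "fst z' ^ 3 = fst z ^ 3" "fst z' ^ 2 * snd z' = fst z ^ 2 * snd z" "snd z' ^ 3 = snd z ^ 3"
    using eq[of C0] eq[of C1] eq[of C3]
    by (simp_all add: inv_at_def phase_val_def power2_eq_square power3_eq_cube mult.assoc)
  show thesis
  proof (cases "fst z = 0")
    case True
    then have 1: "fst z' = 0" using c(1) by simp
    show thesis
    proof (cases "snd z = 0")
      case True
      then have "snd z' = 0" using c(3) by simp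
      with 1 \<open>fst z = 0\<close> True show thesis by (intro that[of 1]) (simp_all add: scale2_def prod_eq_iff)
    next
      case False
      with 1 \<open>fst z = 0\<close> c(3) show thesis
        by (intro that[of "snd z' / snd z"]) (simp_all add: scale2_def prod_eq_iff power_divide)
    qed
  next
    case False
    have "fst z' \<noteq> 0"
    proof
      assume "fst z' = 0"
      then have "fst z ^ 3 = 0" using c(1) by simp
      then show False using False by simp
    qed
    have "fst z' ^ 2 * (fst z * snd z') = fst z' ^ 2 * (fst z' * snd z)"
      using c(1,2) by algebra
    then have "fst z * snd z' = fst z' * snd z" using \<open>fst z' \<noteq> 0\<close> by simp
    with False c(1) show thesis
      by (intro that[of "fst z' / fst z"]) (simp_all add: scale2_def prod_eq_iff power_divide field_simps)
  qed
qed

context coordinate_embedding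
begin

definition embedding :: "V set \<Rightarrow> real ^ 'n" where
  "embedding S = \<Phi> (toC (SOME v. v \<in> S))"

lemma embedding_orbit: "embedding (orbit v) = \<Phi> (toC v)"
proof -
  have "v \<in> orbit v"
    by (auto simp: orbit_def orbit_relation_iff scale2_def prod_eq_iff intro!: exI[of _ 1])
  then have "(SOME w. w \<in> orbit v) \<in> orbit v" by (rule someI)
  then have "(v, SOME w. w \<in> orbit v) \<in> orbit_relation" by (simp add: orbit_def)
  then obtain \<zeta> where "\<zeta> ^ 3 = 1" "toC (SOME w. w \<in> orbit v) = scale2 \<zeta> (toC v)"
    by (auto simp: orbit_relation_iff)
  then show ?thesis by (simp add: embedding_def \<Phi>_invariant)
qed

lemma pullback_embedding: "pullback embedding F = (\<lambda>v. F (\<Phi> (toC v)))"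
  by (simp add: pullback_def embedding_orbit)

lemma embedding_inj: "inj_on embedding V_mod_Z3"
proof (rule inj_onI)
  fix S T assume ST: "S \<in> V_mod_Z3" "T \<in> V_mod_Z3" and eq: "embedding S = embedding T"
  obtain v w where vw: "S = orbit v" "T = orbit w"
    using ST by (auto simp: V_mod_Z3_def orbit_def elim!: quotientE)
  then have "\<Phi> (toC v) = \<Phi> (toC w)" using eq by (simp add: embedding_orbit)
  then have "inv_at i (toC v) = inv_at i (toC w)" for i by (metis \<xi>_\<Phi>)
  then obtain \<zeta> where "\<zeta> ^ 3 = 1" "toC w = scale2 \<zeta> (toC v)" by (rule invariants_separate)
  then have "(v, w) \<in> orbit_relation" by (auto simp: orbit_relation_iff)
  then show "S = T" unfolding vw orbit_def by (rule equiv_class_eq[OF equiv_orbit_relation])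
qed

lemma pullback_invariant:
  assumes F: "F \<in> smooth_functions"
  shows "pullback embedding F \<in> invariant_smooth_functions"
proof -
  have "smooth_on UNIV (\<lambda>z. F (\<Phi> z))"
    by (rule smooth_on_compose[OF open_UNIV smooth_\<Phi>]) (use F in \<open>auto simp: smooth_functions_iff\<close>)
  from smooth_bounded_linear_compose[OF this bounded_linear_toC]
  have "pullback embedding F \<in> smooth_functions" by (simp add: pullback_embedding smooth_functions_iff)
  moreover have "pullback embedding F (g v) = pullback embedding F v" if "g \<in> Z3" for g v
    using that by (auto simp: Z3_def pullback_embedding toC_rotation_power \<Phi>_invariant rotation_power_root)
  ultimately show ?thesis by (simp add: invariant_smooth_functions_def)
qed

lemma embedding_smooth: "smooth_embedding embedding"
  unfolding smooth_embedding_def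
proof (intro conjI embedding_inj equalityI subsetI)
  show "f \<in> invariant_smooth_functions" if "f \<in> pullback embedding ` smooth_functions" for f
    using that pullback_invariant by blast
  fix f assume f: "f \<in> invariant_smooth_functions"
  have "smooth_on UNIV (\<lambda>z. f (fromC z))"
    using f by (intro smooth_bounded_linear_compose[OF _ bounded_linear_fromC])
      (simp add: invariant_smooth_functions_def smooth_functions_iff)
  moreover have "cube_invariant (\<lambda>z. f (fromC z))"
    unfolding cube_invariant_def
  proof (intro allI impI)
    fix \<zeta> z assume "(\<zeta>::complex) ^ 3 = 1"
    then obtain k where k: "k < 3" "\<zeta> = (\<omega>3 ^ 2) ^ k" by (rule cube_root_of_unity)
    have "toC (fromC (scale2 \<zeta> z)) = toC ((rotation ^^ k) (fromC z))"
      by (simp add: toC_rotation_power k)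
    then have "fromC (scale2 \<zeta> z) = (rotation ^^ k) (fromC z)" by (metis fromC_toC)
    moreover have "rotation ^^ k \<in> Z3" using k(1) by (auto simp: Z3_def)
    then have "f ((rotation ^^ k) (fromC z)) = f (fromC z)"
      using f unfolding invariant_smooth_functions_def by blast
    ultimately show "f (fromC (scale2 \<zeta> z)) = f (fromC z)" by simp
  qed
  ultimately obtain F where "smooth_on UNIV F" "\<And>z. F (\<Phi> z) = f (fromC z)"
    using invariant_factors by blast
  then have "F \<in> smooth_functions" "pullback embedding F = f"
    by (simp_all add: smooth_functions_iff pullback_embedding)
  then show "f \<in> pullback embedding ` smooth_functions" by blast
qed

abbreviation inv_der :: "coord \<Rightarrow> V \<Rightarrow> V \<Rightarrow> complex" where
  "inv_der i v w \<equiv> pder (phase_val (toC w)) (phase_val (toC v)) (inv_poly i)"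

lemma inv_at_has_derivative: "((\<lambda>v. inv_at i (toC v)) has_derivative inv_der i v) (at v)"
  unfolding inv_at_def
proof (rule peval_has_derivative)
  fix p
  have "bounded_linear (\<lambda>v. phase_val (toC v) p)"
    by (cases p) (simp_all add: phase_val_def bounded_linear_compose[OF bounded_linear_fst bounded_linear_toC]
        bounded_linear_compose[OF bounded_linear_snd bounded_linear_toC]
        bounded_linear_compose[OF bounded_linear_cnj])
  then show "((\<lambda>v. phase_val (toC v) p) has_derivative (\<lambda>w. phase_val (toC w) p)) (at v)"
    by (rule bounded_linear_imp_has_derivative)
qed

lemma inv_der_bar: "cnj (inv_der i v w) = inv_der (bar i) v w"
  by (cases i) (simp_all add: phase_val_def algebra_simps)

text \<open>The chain rule, regrouped from real to complex coordinates: the real and imaginary parts of the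
  invariants are expressed by the invariants and their conjugates, and conjugation permutes the
  coordinates.\<close>

lemma pullback_derivative:
  assumes F: "F \<in> smooth_functions"
  shows "complex_of_real (frechet_derivative (pullback embedding F) (at v) w) =
     (\<Sum>i\<in>UNIV. \<delta> i (cx F) (\<Phi> (toC v)) * inv_der i v w)"
proof -
  let ?y = "\<Phi> (toC v)"
  let ?DF = "frechet_derivative F (at ?y)"
  let ?r = "\<lambda>i. complex_of_real (ddir (axis (\<rho> i) 1) F ?y)"
  have \<Phi>_sum: "\<Phi> z = (\<Sum>i\<in>UNIV. (Re (inv_at i z) + Im (inv_at i z)) *\<^sub>R axis (\<rho> i) 1)" for z
    by (auto simp: \<Phi>_def vec_eq_iff axis_def intro!: sum.cong)
  have d\<Phi>: "((\<lambda>v. \<Phi> (toC v)) has_derivative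
      (\<lambda>w. \<Sum>i\<in>UNIV. (Re (inv_der i v w) + Im (inv_der i v w)) *\<^sub>R axis (\<rho> i) 1)) (at v)"
    unfolding \<Phi>_sum
    by (intro has_derivative_sum has_derivative_scaleR_left has_derivative_add
        bounded_linear.has_derivative[OF bounded_linear_Re] bounded_linear.has_derivative[OF bounded_linear_Im]
        inv_at_has_derivative)
  have dF: "(F has_derivative ?DF) (at ?y)"
    using F by (intro smooth_on_has_derivative[of UNIV]) (simp_all add: smooth_functions_iff)
  have "frechet_derivative (pullback embedding F) (at v) w =
      ?DF (\<Sum>i\<in>UNIV. (Re (inv_der i v w) + Im (inv_der i v w)) *\<^sub>R axis (\<rho> i) 1)"
    unfolding pullback_embedding
    by (rule fun_cong[OF frechet_derivative_at[OF has_derivative_compose[OF d\<Phi> dF]], of w, symmetric])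
  also have "\<dots> = (\<Sum>i\<in>UNIV. (Re (inv_der i v w) + Im (inv_der i v w)) * ddir (axis (\<rho> i) 1) F ?y)"
    using has_derivative_linear[OF dF] by (simp add: linear_sum linear_scale)
  finally have "complex_of_real (frechet_derivative (pullback embedding F) (at v) w) =
      (\<Sum>i\<in>UNIV. of_real (Re (inv_der i v w) + Im (inv_der i v w)) * ?r i)" by simp
  also have "\<dots> = (\<Sum>i\<in>UNIV. cnj \<kappa> * inv_der i v w * ?r i + \<kappa> * inv_der (bar i) v w * ?r i)"
  proof (rule sum.cong[OF refl])
    fix i
    have "complex_of_real (Re c + Im c) = cnj \<kappa> * c + \<kappa> * cnj c" for c
      by (simp add: \<kappa>_def complex_eq_iff)
    then show "of_real (Re (inv_der i v w) + Im (inv_der i v w)) * ?r i =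
        cnj \<kappa> * inv_der i v w * ?r i + \<kappa> * inv_der (bar i) v w * ?r i"
      by (simp only: inv_der_bar distrib_right)
  qed
  also have "\<dots> = (\<Sum>i\<in>UNIV. cnj \<kappa> * inv_der i v w * ?r i) + (\<Sum>i\<in>UNIV. \<kappa> * inv_der i v w * ?r (bar i))"
    using sum_bar[of "\<lambda>i. \<kappa> * inv_der i v w * ?r (bar i)"] by (simp add: sum.distrib)
  also have "\<dots> = (\<Sum>i\<in>UNIV. \<delta> i (cx F) ?y * inv_der i v w)"
    unfolding sum.distrib[symmetric] \<delta>_def cdir_of_real
    by (rule sum.cong[OF refl]) (simp only: ring_distribs mult_ac)
  finally show ?thesis .
qed

lemma phase_val_basis:
  "phase_val (toC (axis 1 1, 0)) = e1" "phase_val (toC (axis 2 1, 0)) = e2"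
  "phase_val (toC (0, axis 1 1)) = e3" "phase_val (toC (0, axis 2 1)) = e4"
  by (auto simp: phase_val_def toC_def e1_def e2_def e3_def e4_def fun_eq_iff axis_def complex_eq_iff
      split: phase.splits)

text \<open>Both sides are bilinear in the first derivatives at the image point, so only the brackets of the
  coordinate functions have to be compared.\<close>

lemma pullback_bracket:
  assumes F: "F \<in> smooth_functions" and G: "G \<in> smooth_functions"
  shows "pullback embedding (br F G) = standard_bracket (pullback embedding F) (pullback embedding G)"
proof
  fix v
  let ?y = "\<Phi> (toC v)" and ?x = "phase_val (toC v)"
  let ?f = "\<lambda>i. \<delta> i (cx F) ?y" and ?g = "\<lambda>i. \<delta> i (cx G) ?y"
  let ?S = "\<lambda>d e. (\<Sum>i\<in>UNIV. ?f i * pder d ?x (inv_poly i)) * (\<Sum>j\<in>UNIV. ?g j * pder e ?x (inv_poly j))"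
  have prod: "?S d e = (\<Sum>i\<in>UNIV. \<Sum>j\<in>UNIV. (?f i * ?g j) * (pder d ?x (inv_poly i) * pder e ?x (inv_poly j)))" for d e
    unfolding sum_product by (intro sum.cong refl) (simp add: mult_ac)
  have "complex_of_real (standard_bracket (pullback embedding F) (pullback embedding G) v) =
      ?S e1 e2 - ?S e2 e1 + ?S e3 e4 - ?S e4 e3"
    unfolding standard_bracket_def Let_def of_real_add of_real_diff of_real_mult
      pullback_derivative[OF F] pullback_derivative[OF G] phase_val_basis ..
  also have "\<dots> = (\<Sum>i\<in>UNIV. \<Sum>j\<in>UNIV. (?f i * ?g j) *
      (pder e1 ?x (inv_poly i) * pder e2 ?x (inv_poly j) - pder e2 ?x (inv_poly i) * pder e1 ?x (inv_poly j) +
       pder e3 ?x (inv_poly i) * pder e4 ?x (inv_poly j) - pder e4 ?x (inv_poly i) * pder e3 ?x (inv_poly j)))"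
    unfolding prod sum.distrib[symmetric] sum_subtractf[symmetric]
    by (simp only: distrib_left right_diff_distrib)
  also have "\<dots> = - \<i> * bracket (cx F) (cx G) ?y"
    unfolding entry_invariants bracket_apply \<xi>_\<Phi> inv_at_def[symmetric] sum_distrib_left
    by (simp only: inv_at_def mult_ac)
  also have "\<dots> = complex_of_real (br F G ?y)" using fun_cong[OF cx_br[of F G], of ?y] by simp
  finally show "pullback embedding (br F G) v = standard_bracket (pullback embedding F) (pullback embedding G) v"
    by (simp only: pullback_embedding of_real_eq_iff)
qed

theorem poisson_embedding: "poisson_embedding br embedding"
  unfolding poisson_embedding_def poisson_algebra_hom_def
  using embedding_smooth pullback_invariant pullback_bracket by (auto simp: pullback_def)

end

theorem theorem1p0p3:
  shows "\<exists>(br :: (real ^ 78) bracket) (\<phi> :: V set \<Rightarrow> real ^ 78).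
           poisson_bracket_on smooth_functions br \<and> poisson_embedding br \<phi>"
proof -
  have "card (UNIV :: coord set) \<le> card (UNIV :: 78 set)" by (simp add: UNIV_coord)
  then obtain \<rho> :: "coord \<Rightarrow> 78" where "inj \<rho>"
    using card_le_inj[of "UNIV :: coord set" "UNIV :: 78 set"] by auto
  then interpret coordinate_embedding \<rho> by unfold_locales
  show ?thesis using poisson_br poisson_embedding by blast
qed

end
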